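(* There exists $m_0 \in \mathbb{N}$ such that for every integer $m \ge m_0$ and every $3$-graph $G$ with exactly $m$ edges, $$\lambda(G) \le \lambda(\mathcal{C}(m,3)).$$
   Context: $\mathbb{N} = \{1,2,3,\dots\}$, and for a set $X$, $X^{(r)}$ denotes the family of all $r$-element subsets of $X$. An $r$-graph is a finite family $G \subseteq \mathbb{N}^{(r)}$; its members are its edges, and $|G|$ is the number of edges. The Lagrangian of $G$ is $$\lambda(G) := \max\Big\{ \sum_{e \in G} \prod_{x \in e} w(x) \;:\; w(x) \in \mathbb{R}_{\ge 0} \text{ for all } x \in \mathbb{N},\ \sum_{x \in \mathbb{N}} w(x) = 1 \Big\}.$$ The colexicographic order on $\mathbb{N}^{(r)}$ is defined by $A < B$ if and only if $\sum_{i \in A} 2^i < \sum_{i \in B} 2^i$; $\mathcal{C}(m,r)$ denotes the family of the first $m$ sets of $\mathbb{N}^{(r)}$ in this order. *)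

theory Defs
  imports "HOL-Analysis.Analysis" "HOL-Library.Ramsey"
begin

text \<open>Vertices are the positive integers, i.e. the set \<open>{1..}\<close> of type \<^typ>\<open>nat set\<close>, and
  \<^term>\<open>nsets {1..} r\<close> is the family of its \<open>r\<close>-element subsets.\<close>

definition rgraph :: "nat \<Rightarrow> nat set set \<Rightarrow> bool" where
  "rgraph r G \<longleftrightarrow> finite G \<and> G \<subseteq> nsets {1..} r"

text \<open>The values of a weighting at \<open>0\<close>, which is not a vertex, are unconstrained and irrelevant.
  The total weight is a sum over all vertices; the support may be infinite.\<close>

definition weighting :: "(nat \<Rightarrow> real) \<Rightarrow> bool" where
  "weighting w \<longleftrightarrow> (\<forall>x\<in>{1..}. w x \<ge> 0) \<and> (w has_sum 1) {1..}"

definition edge_weight :: "nat set set \<Rightarrow> (nat \<Rightarrow> real) \<Rightarrow> real" where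
  "edge_weight G w = (\<Sum>e\<in>G. \<Prod>x\<in>e. w x)"

text \<open>The maximum exists for every \<open>r\<close>-graph; see \<open>lagrangian_attained\<close> below.\<close>

definition lagrangian :: "nat set set \<Rightarrow> real" where
  "lagrangian G = (GREATEST v. \<exists>w. weighting w \<and> v = edge_weight G w)"

definition colex_less :: "nat set \<Rightarrow> nat set \<Rightarrow> bool" where
  "colex_less A B \<longleftrightarrow> (\<Sum>i\<in>A. 2 ^ i :: nat) < (\<Sum>i\<in>B. 2 ^ i)"

text \<open>The first \<open>m\<close> sets are those with fewer than \<open>m\<close> predecessors. The set of predecessors
  is finite (\<open>finite_colex_predecessors\<close>), so that \<^const>\<open>card\<close> is its true cardinality.\<close>

definition colex_initial :: "nat \<Rightarrow> nat \<Rightarrow> nat set set" where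
  "colex_initial m r =
     {A \<in> nsets {1..} r. card {B \<in> nsets {1..} r. colex_less B A} < m}"

lemma finite_colex_predecessors: "finite {B \<in> nsets {1..} r. colex_less B A}"
proof -
  define N where "N = (\<Sum>i\<in>A. 2 ^ i :: nat)"
  have "B \<subseteq> {..<N}" if B: "B \<in> nsets {1..} r" "colex_less B A" for B
  proof
    fix x assume x: "x \<in> B"
    have "finite B" using B by (simp add: nsets_def)
    then have "(2::nat) ^ x \<le> (\<Sum>i\<in>B. 2 ^ i)" using x by (intro member_le_sum) auto
    also have "\<dots> < N" using B by (simp add: colex_less_def N_def)
    finally have "2 ^ x < N" .
    with less_exp[of x] have "x < N" by (rule less_trans)
    then show "x \<in> {..<N}" by simp
  qed
  then have "{B \<in> nsets {1..} r. colex_less B A} \<subseteq> Pow {..<N}" by blast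
  then show ?thesis by (rule finite_subset) simp
qed

lemma inj_on_sum_powers: "inj_on (\<lambda>A. \<Sum>i\<in>A. 2 ^ i :: nat) {A. finite A}"
  using inj_on_set_encode by (simp add: set_encode_def[abs_def])

lemma
  assumes "r > 0"
  shows finite_colex_initial: "finite (colex_initial m r)"
    and card_colex_initial: "card (colex_initial m r) = m"
proof -
  define S where "S = nsets {1::nat..} r"
  define f where "f = (\<lambda>A. \<Sum>i\<in>A. 2 ^ i :: nat)"
  have inj: "inj_on f S"
    unfolding f_def S_def by (rule inj_on_subset[OF inj_on_sum_powers]) (auto simp: nsets_def)
  have "infinite S" unfolding S_def
    using assms infinite_Ici by (intro infinite_imp_infinite_nsets)
  then have inf: "infinite (f ` S)" using inj finite_imageD by blast
  have en: "card {y \<in> f ` S. y < enumerate (f ` S) n} = n" for n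
  proof -
    have "{y \<in> f ` S. y < enumerate (f ` S) n} = enumerate (f ` S) ` {..<n}"
    proof (intro set_eqI iffI)
      fix y assume y: "y \<in> {y \<in> f ` S. y < enumerate (f ` S) n}"
      then obtain k where k: "y = enumerate (f ` S) k"
        using range_enumerate[OF inf] by auto
      with y inf have "k < n" by (simp add: enumerate_mono_iff)
      with k show "y \<in> enumerate (f ` S) ` {..<n}" by blast
    next
      fix y assume "y \<in> enumerate (f ` S) ` {..<n}"
      then show "y \<in> {y \<in> f ` S. y < enumerate (f ` S) n}"
        using inf enumerate_in_set[OF inf] by (auto simp: enumerate_mono_iff)
    qed
    then show ?thesis
      using inj_enumerate[OF inf] by (simp add: card_image inj_on_subset)
  qed
  have cards: "card {B \<in> S. colex_less B A} = card {y \<in> f ` S. y < f A}" for A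
  proof -
    have "{y \<in> f ` S. y < f A} = f ` {B \<in> S. colex_less B A}"
      by (auto simp: f_def colex_less_def)
    moreover have "inj_on f {B \<in> S. colex_less B A}"
      using inj by (rule inj_on_subset) auto
    ultimately show ?thesis by (simp add: card_image)
  qed
  have img: "f ` colex_initial m r = enumerate (f ` S) ` {..<m}"
  proof (intro set_eqI iffI)
    fix y assume "y \<in> f ` colex_initial m r"
    then obtain A where A: "A \<in> S" "y = f A" "card {y \<in> f ` S. y < f A} < m"
      using cards by (auto simp: colex_initial_def S_def)
    obtain n where n: "f A = enumerate (f ` S) n"
      using range_enumerate[OF inf] A(1) by (metis imageE image_eqI)
    show "y \<in> enumerate (f ` S) ` {..<m}" using A en[of n] n by auto
  next
    fix y assume "y \<in> enumerate (f ` S) ` {..<m}"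
    then obtain n where n: "n < m" "y = enumerate (f ` S) n" by auto
    obtain A where A: "A \<in> S" "y = f A" using enumerate_in_set[OF inf] n by (metis imageE)
    have "A \<in> colex_initial m r"
      using A n en[of n] cards[of A] by (simp add: colex_initial_def S_def)
    then show "y \<in> f ` colex_initial m r" using A by blast
  qed
  have inj': "inj_on f (colex_initial m r)"
    using inj by (rule inj_on_subset) (auto simp: colex_initial_def S_def)
  have "finite (f ` colex_initial m r)" by (simp add: img)
  then show "finite (colex_initial m r)" using inj' finite_imageD by blast
  have "card (colex_initial m r) = card (f ` colex_initial m r)"
    using inj' by (simp add: card_image)
  also have "\<dots> = m"
    using inj_enumerate[OF inf] by (simp add: img card_image inj_on_subset)
  finally show "card (colex_initial m r) = m" .
qed

lemma rgraph_colex_initial: "r > 0 \<Longrightarrow> rgraph r (colex_initial m r)"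
  using finite_colex_initial by (auto simp: rgraph_def colex_initial_def)

lemma lagrangian_attained:
  assumes G: "rgraph r G"
  obtains w where "weighting w" "lagrangian G = edge_weight G w"
    "\<And>w'. weighting w' \<Longrightarrow> edge_weight G w' \<le> edge_weight G w"
proof -
  define V where "V = insert 1 (\<Union>G)"
  have e: "finite e" "e \<subseteq> V" if "e \<in> G" for e
    using G that by (auto simp: rgraph_def nsets_def V_def)
  have V: "finite V" "V \<subseteq> {1..}" "1 \<in> V"
    using G e by (auto simp: rgraph_def nsets_def V_def)
  define B where "B = (\<lambda>x. if x \<in> V then {0..1::real} else {0})"
  define K where "K = (PiE UNIV B) \<inter> {w. (\<Sum>x\<in>V. w x) = 1}"
  have K: "w \<in> K \<longleftrightarrow> (\<forall>x\<in>V. 0 \<le> w x \<and> w x \<le> 1) \<and> (\<forall>x. x \<notin> V \<longrightarrow> w x = 0) \<and> (\<Sum>x\<in>V. w x) = 1" for w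
    by (fastforce simp: K_def B_def PiE_iff split: if_splits)
  have "compactin (product_topology (\<lambda>_. euclidean) UNIV) (PiE UNIV B)"
    by (simp add: compactin_PiE B_def)
  then have cB: "compact (PiE UNIV B)"
    by (simp add: euclidean_product_topology)
  have "closed {w. (\<Sum>x\<in>V. w x) = (1::real)}"
    by (intro closed_Collect_eq continuous_on_sum continuous_on_product_coordinates continuous_on_const)
  then have "compact K" unfolding K_def using cB by (rule compact_Int_closed[rotated])
  moreover have "(\<lambda>x. if x = 1 then 1 else 0) \<in> K"
    using V by (auto simp: K)
  then have "K \<noteq> {}" by blast
  moreover have "continuous_on K (edge_weight G)"
    unfolding edge_weight_def
    by (intro continuous_on_sum continuous_on_prod)
       (rule continuous_on_subset[OF continuous_on_product_coordinates], simp)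
  ultimately obtain w where w: "w \<in> K" "\<forall>w'\<in>K. edge_weight G w' \<le> edge_weight G w"
    using continuous_attains_sup by blast
  have "(w has_sum 1) V" using w V by (simp add: K has_sum_finiteI)
  then have "(w has_sum 1) {1..}"
    using V w by (subst has_sum_cong_neutral[where S=V and g=w, symmetric]) (auto simp: K)
  moreover have "w x \<ge> 0" for x using w(1) by (cases "x \<in> V") (auto simp: K)
  ultimately have ww: "weighting w" by (simp add: weighting_def)
  have max: "edge_weight G w' \<le> edge_weight G w" if w': "weighting w'" for w'
  proof -
    have nn: "w' x \<ge> 0" if "x \<in> {1..}" for x using w' that by (simp add: weighting_def)
    have le: "(\<Sum>x\<in>V. w' x) \<le> 1"
    proof (rule has_sum_mono_neutral)
      show "(w' has_sum (\<Sum>x\<in>V. w' x)) V" using V by (simp add: has_sum_finite)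
      show "(w' has_sum 1) {1..}" using w' by (simp add: weighting_def)
    qed (use nn V in auto)
    define d where "d = 1 - (\<Sum>x\<in>V. w' x)"
    define u where "u = (\<lambda>x. (if x \<in> V then w' x else 0) + (if x = 1 then d else 0))"
    have d: "d \<ge> 0" using le by (simp add: d_def)
    have "(\<Sum>x\<in>V. u x) = 1"
      using V by (simp add: u_def sum.distrib d_def)
    moreover have u0: "0 \<le> u x" if "x \<in> V" for x
      using d nn V that by (auto simp: u_def)
    moreover have "u x \<le> (\<Sum>x\<in>V. u x)" if "x \<in> V" for x
      using that V u0 by (intro member_le_sum) auto
    ultimately have "u \<in> K" using V by (auto simp: K u_def)
    moreover have "edge_weight G w' \<le> edge_weight G u"
      unfolding edge_weight_def
    proof (intro sum_mono prod_mono conjI)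
      fix f x assume "f \<in> G" "x \<in> f"
      then have "x \<in> V" using e by blast
      then show "0 \<le> w' x" "w' x \<le> u x" using nn V d by (auto simp: u_def)
    qed
    ultimately show ?thesis using w by fastforce
  qed
  have "lagrangian G = edge_weight G w"
    unfolding lagrangian_def
    by (rule Greatest_equality) (use ww max in auto)
  with ww max show thesis using that by blast
qed

end

theory Submission
  imports Defs
begin

text \<open>Let \<open>t choose 3 < m \<le> (t + 1) choose 3\<close> and take an optimal weighting of \<open>G\<close> with value at least that
  of the complete 3-graph on \<open>t\<close> vertices. Cauchy--Schwarz and the stationarity of the weighting
  force all weights to be at most about \<open>1/t\<close> and every degree in the support to be about \<open>t\<^sup>2/2\<close>. So the
  support has \<open>t + O(1)\<close> vertices and misses only \<open>O(t)\<close> triples, hence has at most \<open>n = t + 1\<close> vertices.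

  It remains to show that, among \<open>s \<le> n - 2\<close> non-edges on \<open>n\<close> vertices, the best choice is a set
  of triples through a common pair (\<open>s = n - 2\<close> already gives the complete 3-graph on \<open>t\<close> vertices).
  The weight of all triples is a function of the power sums, so one minimises the sum of
  \<open>x\<^sup>2/2 - x\<^sup>3/3\<close> over the vertices plus the weight of the non-edges. For weights
  \<open>c - r\<close> near a constant \<open>c\<close> this is a quadratic problem whose minimum is governed
  by the sum of the squared degrees of the non-edges. For bounded \<open>s\<close> this sum is maximal only for
  triples through a common pair and, when \<open>s \<in> {3, 4}\<close>, for triples inside a 4-set, which lose at
  the next order. For large \<open>s\<close> one first fixes the smallest weight \<open>\<epsilon>\<close>, at a vertex \<open>z\<close>,
  and, unless its weight is too close to the others, the weight of the vertex of largest codegree with \<open>z\<close>.\<close>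

section \<open>Vertex potentials and pair stars\<close>

text \<open>Every comparison follows one pattern. A level \<open>c\<close> is chosen so that an
  explicit weighting of a pair star has total 1; the competing weighting is then bounded below at
  this same \<open>c\<close>, by the tangent of \<open>pot\<close>. That inequality holds at any
  level, and its linear part sees only the total weight, so it agrees on both sides and the optimal
  multiplier never has to be found. What remains is a quadratic in the deviations from
  \<open>c\<close>, minimised vertex by vertex.

  The split at 2000 comes from the error terms. One unit in the sum of squared degrees is worth
  about \<open>c^2 / 2\<close>, while the third-order terms have size \<open>c^3 * s^3\<close>; so
  \<open>s\<close> must be bounded and \<open>n\<close> huge, which is the origin of
  \<open>10^12\<close>. When \<open>s\<close> is comparable to \<open>n\<close>, a star lowers its
  two centres by a constant fraction of \<open>c\<close>, and expanding about \<open>c\<close> is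
  useless there. Keeping the smallest weight exact leaves a problem in which an edge burdens only
  two vertices; its slack, where codegrees are compared, grows like \<open>s^2\<close>, and
  \<open>s \<ge> 2000\<close> absorbs the errors linear in \<open>s\<close>.\<close>

lemma sum_nsets_insert:
  fixes x :: "'a \<Rightarrow> real"
  assumes "finite U" "u \<notin> U"
  shows "(\<Sum>e\<in>nsets (insert u U) (Suc k). prod x e)
       = (\<Sum>e\<in>nsets U (Suc k). prod x e) + x u * (\<Sum>e\<in>nsets U k. prod x e)"
proof -
  have eq: "nsets (insert u U) (Suc k) = nsets U (Suc k) \<union> insert u ` nsets U k"
  proof (intro equalityI subsetI)
    fix e assume e: "e \<in> nsets (insert u U) (Suc k)"
    show "e \<in> nsets U (Suc k) \<union> insert u ` nsets U k"
    proof (cases "u \<in> e")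
      case True
      then have "e = insert u (e - {u})" "e - {u} \<in> nsets U k"
        using e by (auto simp: nsets_def)
      then show ?thesis by blast
    qed (use e in \<open>auto simp: nsets_def\<close>)
  qed (use assms in \<open>auto simp: nsets_def card_insert_if\<close>)
  have inj: "inj_on (insert u) (nsets U k)"
    using assms by (intro inj_onI) (metis (no_types, lifting) insert_ident mem_Collect_eq nsets_def subsetD)
  have "(\<Sum>e\<in>nsets (insert u U) (Suc k). prod x e)
      = (\<Sum>e\<in>nsets U (Suc k). prod x e) + (\<Sum>e\<in>insert u ` nsets U k. prod x e)"
    unfolding eq using assms
    by (intro sum.union_disjoint finite_imp_finite_nsets finite_imageI) (auto simp: nsets_def)
  also have "(\<Sum>e\<in>insert u ` nsets U k. prod x e) = (\<Sum>e\<in>nsets U k. x u * prod x e)"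
    unfolding sum.reindex[OF inj] o_def using assms
    by (intro sum.cong refl prod.insert) (auto simp: nsets_def)
  finally show ?thesis by (simp add: sum_distrib_left)
qed

lemma sum_nsets_1: "(\<Sum>e\<in>nsets U (Suc 0). prod x e) = sum x U" for x :: "'a \<Rightarrow> real"
proof -
  have "nsets U (Suc 0) = (\<lambda>a. {a}) ` U"
    by (auto simp: nsets_def card_Suc_eq)
  then show ?thesis by (simp add: sum.reindex o_def)
qed

lemma sum_nsets_2:
  fixes x :: "'a \<Rightarrow> real"
  assumes "finite U"
  shows "(\<Sum>e\<in>nsets U 2. prod x e) = ((sum x U)\<^sup>2 - (\<Sum>a\<in>U. (x a)\<^sup>2)) / 2"
  using assms
proof (induction U)
  case empty
  then show ?case by (simp add: nsets_def sum.neutral)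
next
  case (insert u U)
  then show ?case
    using sum_nsets_insert[of U u x 1]
    by (simp add: numeral_2_eq_2 sum_nsets_1) (simp add: algebra_simps power2_eq_square)
qed

text \<open>Newton's identity for the third elementary symmetric polynomial.\<close>

lemma sum_nsets_3:
  fixes x :: "'a \<Rightarrow> real"
  assumes "finite U"
  shows "(\<Sum>e\<in>nsets U 3. prod x e)
       = ((sum x U) ^ 3 - 3 * sum x U * (\<Sum>a\<in>U. (x a)\<^sup>2) + 2 * (\<Sum>a\<in>U. (x a) ^ 3)) / 6"
  using assms
proof (induction U)
  case empty
  then show ?case by (simp add: nsets_def sum.neutral)
next
  case (insert u U)
  have "(\<Sum>e\<in>nsets (insert u U) 3. prod x e)
      = (\<Sum>e\<in>nsets U 3. prod x e) + x u * (\<Sum>e\<in>nsets U 2. prod x e)"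
    using sum_nsets_insert[of U u x 2] insert by (simp add: numeral_3_eq_3 numeral_2_eq_2)
  then show ?case using insert
    by (simp add: sum_nsets_2) (simp add: field_simps power2_eq_square power3_eq_cube)
qed

section \<open>The potential and its quadratic lower bounds\<close>

definition pot :: "real \<Rightarrow> real" where
  "pot x = x\<^sup>2 / 2 - x ^ 3 / 3"

definition cost :: "'a set \<Rightarrow> 'a set set \<Rightarrow> ('a \<Rightarrow> real) \<Rightarrow> real" where
  "cost U H x = (\<Sum>a\<in>U. pot (x a)) + (\<Sum>e\<in>H. prod x e)"

lemma sum_prod_eq_cost:
  assumes "finite U" "G \<subseteq> nsets U 3" "sum x U = 1"
  shows "(\<Sum>e\<in>G. prod x e) = 1 / 6 - cost U (nsets U 3 - G) x"
proof -
  have "(\<Sum>e\<in>nsets U 3. prod x e) = 1 / 6 - (\<Sum>a\<in>U. pot (x a))"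
    using assms by (simp add: sum_nsets_3 pot_def sum_subtractf flip: sum_divide_distrib)
  moreover have "(\<Sum>e\<in>nsets U 3. prod x e) = (\<Sum>e\<in>nsets U 3 - G. prod x e) + (\<Sum>e\<in>G. prod x e)"
    using assms by (intro sum.subset_diff finite_imp_finite_nsets)
  ultimately show ?thesis by (simp add: cost_def)
qed

text \<open>Exact Taylor expansion of a cubic: \<open>c - c^2\<close> becomes the multiplier of the
  total weight and \<open>1 - 2 * c\<close> is the curvature, called \<open>k\<close> later.\<close>

lemma pot_diff: "pot (c - r) = pot c - (c - c\<^sup>2) * r + (1/2 - c) * r\<^sup>2 + r ^ 3 / 3"
  by (simp add: pot_def field_simps power2_eq_square power3_eq_cube)

text \<open>Only weights below \<open>c\<close> receive the quadratic term. Above \<open>c\<close>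
  the tangent suffices, since replacing such a weight by \<open>c\<close> does not increase the
  non-edge products either. As \<open>pot\<close> is convex only up to 1/2, the tangent bound rests
  on \<open>2 * c + x \<le> 3/2\<close>.\<close>

lemma pot_lower:
  assumes "x \<le> 1" "0 \<le> c" "c \<le> 1/4"
  shows "pot x \<ge> pot c + (c - c\<^sup>2) * (x - c) + (1/2 - c) * (max 0 (c - x))\<^sup>2"
proof (cases "x \<le> c")
  case True
  then have "0 \<le> (c - x) ^ 3 / 3" by simp
  with True pot_diff[of c "c - x"] show ?thesis
    by (simp add: max_def algebra_simps)
next
  case False
  have "0 \<le> (c - x)\<^sup>2 * (1/2 - (2 * c + x) / 3)"
    using assms by simp
  with False pot_diff[of c "c - x"] show ?thesis
    by (simp add: max_def field_simps power2_eq_square power3_eq_cube)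
qed

lemma sum_pot_lower:
  fixes x :: "'a \<Rightarrow> real" and c :: real
  assumes "\<And>a. a \<in> A \<Longrightarrow> x a \<le> 1" "0 \<le> c" "c \<le> 1/4"
  shows "(\<Sum>a\<in>A. pot (x a)) \<ge> card A * pot c + (c - c\<^sup>2) * (sum x A - card A * c)
           + (1/2 - c) * (\<Sum>a\<in>A. (max 0 (c - x a))\<^sup>2)"
proof -
  have "(\<Sum>a\<in>A. pot c + (c - c\<^sup>2) * (x a - c) + (1/2 - c) * (max 0 (c - x a))\<^sup>2) \<le> (\<Sum>a\<in>A. pot (x a))"
    by (intro sum_mono pot_lower assms)
  moreover have "(\<Sum>a\<in>A. pot c + (c - c\<^sup>2) * (x a - c) + (1/2 - c) * (max 0 (c - x a))\<^sup>2)
      = card A * pot c + (c - c\<^sup>2) * (sum x A - card A * c) + (1/2 - c) * (\<Sum>a\<in>A. (max 0 (c - x a))\<^sup>2)"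
    by (simp add: sum.distrib sum_subtractf flip: sum_distrib_left)
  ultimately show ?thesis by simp
qed

text \<open>The minimum is attained at \<open>r = b / k\<close>. With \<open>b\<close> proportional
  to a degree, summation over the vertices turns deviations into the sum of squared degrees.\<close>

lemma quadratic_lower: "0 < k \<Longrightarrow> k / 2 * r\<^sup>2 - b * r \<ge> - (b\<^sup>2 / (2 * k))" for k r b :: real
proof -
  assume k: "0 < k"
  have "0 \<le> (k * r - b)\<^sup>2 / (2 * k)" using k by simp
  also have "\<dots> = k / 2 * r\<^sup>2 - b * r + b\<^sup>2 / (2 * k)"
    using k by (simp add: field_simps power2_eq_square)
  finally show ?thesis by simp
qed

section \<open>Families of triples through a common pair\<close>

definition pair_star :: "'a \<Rightarrow> 'a \<Rightarrow> 'a set \<Rightarrow> 'a set set" where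
  "pair_star z v L = (\<lambda>b. {z, v, b}) ` L"

lemma sum_pair_star:
  fixes x :: "'a \<Rightarrow> real"
  assumes "z \<noteq> v" "z \<notin> L" "v \<notin> L"
  shows "(\<Sum>e\<in>pair_star z v L. prod x e) = x z * x v * sum x L"
proof -
  have inj: "inj_on (\<lambda>b. {z, v, b}) L"
    using assms by (intro inj_onI) auto
  have "(\<Sum>e\<in>pair_star z v L. prod x e) = (\<Sum>b\<in>L. x z * x v * x b)"
    unfolding pair_star_def sum.reindex[OF inj] o_def
  proof (rule sum.cong)
    fix b assume "b \<in> L"
    then have "z \<noteq> b" "v \<noteq> b" using assms by auto
    with assms show "prod x {z, v, b} = x z * x v * x b" by simp
  qed simp
  then show ?thesis by (simp add: sum_distrib_left)
qed

lemma pair_star_of_common_pair: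
  assumes H: "H \<subseteq> nsets U 3" "finite U" and zv: "z \<noteq> v" "\<And>e. e \<in> H \<Longrightarrow> {z, v} \<subseteq> e"
  obtains L where "L \<subseteq> U - {z, v}" "card L = card H" "H = pair_star z v L"
proof -
  define L where "L = {b \<in> U - {z, v}. {z, v, b} \<in> H}"
  have "H \<subseteq> pair_star z v L"
  proof
    fix e assume e: "e \<in> H"
    then have e3: "finite e" "card e = 3" "e \<subseteq> U" and sub: "{z, v} \<subseteq> e" using H zv by (auto simp: nsets_def)
    then have "card (e - {z, v}) = 1" using zv(1) by (simp add: card_Diff_subset)
    then obtain b where b: "e - {z, v} = {b}" by (auto simp: card_1_singleton_iff)
    then have "e = {z, v, b}" using sub by auto
    moreover have "b \<in> L" using b e e3 \<open>e = {z, v, b}\<close> by (auto simp: L_def)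
    ultimately show "e \<in> pair_star z v L" by (auto simp: pair_star_def)
  qed
  then have eq: "H = pair_star z v L" by (auto simp: pair_star_def L_def)
  have "inj_on (\<lambda>b. {z, v, b}) L"
  proof (rule inj_onI)
    fix b b' assume b: "b \<in> L" "b' \<in> L" and eq': "{z, v, b} = {z, v, b'}"
    have "b \<in> {z, v, b'}" unfolding eq'[symmetric] by simp
    then show "b = b'" using b by (simp add: L_def)
  qed
  then have "card (pair_star z v L) = card L" unfolding pair_star_def by (rule card_image)
  then have "card L = card H" by (simp only: eq[symmetric])
  moreover have "L \<subseteq> U - {z, v}" by (auto simp: L_def)
  ultimately show thesis using eq that by blast
qed

text \<open>With \<open>D\<close> an incidence function, squared degrees are counted by ordered
  pairs of edges, so bounds on intersections bound the sum of squared degrees.\<close>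

lemma sum_squares_swap:
  fixes D :: "'b \<Rightarrow> 'a \<Rightarrow> real"
  shows "(\<Sum>a\<in>A. (\<Sum>e\<in>H. D e a)\<^sup>2) = (\<Sum>e\<in>H. \<Sum>f\<in>H. \<Sum>a\<in>A. D e a * D f a)"
proof -
  have "(\<Sum>a\<in>A. (\<Sum>e\<in>H. D e a)\<^sup>2) = (\<Sum>a\<in>A. \<Sum>e\<in>H. \<Sum>f\<in>H. D e a * D f a)"
    by (simp add: power2_eq_square sum_product)
  also have "\<dots> = (\<Sum>e\<in>H. \<Sum>a\<in>A. \<Sum>f\<in>H. D e a * D f a)"
    by (rule sum.swap)
  also have "\<dots> = (\<Sum>e\<in>H. \<Sum>f\<in>H. \<Sum>a\<in>A. D e a * D f a)"
    by (intro sum.cong refl sum.swap)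
  finally show ?thesis .
qed

section \<open>Boundedly many non-edges\<close>

lemma sum_star_weights:
  fixes F :: "'b \<Rightarrow> real"
  assumes "finite U" "z \<in> U" "v \<in> U" "z \<noteq> v" "L \<subseteq> U - {z, v}"
  shows "(\<Sum>a\<in>U. F (if a = z then A else if a = v then B else if a \<in> L then C else D))
       = F A + F B + card L * F C + (real (card U) - 2 - real (card L)) * F D"
proof -
  let ?x = "\<lambda>a. if a = z then A else if a = v then B else if a \<in> L then C else D"
  let ?R = "U - {z, v} - L"
  have fin: "finite L" "finite ?R" using assms finite_subset by auto
  have "U = insert z (insert v (L \<union> ?R))" using assms by auto
  then have "(\<Sum>a\<in>U. F (?x a)) = (\<Sum>a\<in>insert z (insert v (L \<union> ?R)). F (?x a))" by simp
  also have "\<dots> = F A + F B + (\<Sum>a\<in>L \<union> ?R. F (?x a))"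
    using assms fin by (auto simp: sum.insert_if)
  also have "(\<Sum>a\<in>L \<union> ?R. F (?x a)) = (\<Sum>a\<in>L. F (?x a)) + (\<Sum>a\<in>?R. F (?x a))"
    using fin by (intro sum.union_disjoint) auto
  also have "(\<Sum>a\<in>L. F (?x a)) = (\<Sum>a\<in>L. F C)" using assms by (intro sum.cong) auto
  also have "(\<Sum>a\<in>?R. F (?x a)) = (\<Sum>a\<in>?R. F D)" using assms by (intro sum.cong) auto
  also have "card ?R = card U - 2 - card L"
    using assms fin by (subst card_Diff_subset) (auto simp: card_Diff_insert)
  moreover have "card L \<le> card (U - {z, v})" using assms by (intro card_mono) auto
  then have "card L \<le> card U - 2" using assms by (simp add: card_Diff_insert)
  moreover have "2 \<le> card U"
    using card_mono[of U "{z, v}"] assms by auto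
  ultimately show ?thesis by (simp add: of_nat_diff)
qed

lemma cost_pair_star:
  fixes A B C D :: real
  assumes "finite U" "z \<in> U" "v \<in> U" "z \<noteq> v" "L \<subseteq> U - {z, v}"
  defines "x \<equiv> \<lambda>a. if a = z then A else if a = v then B else if a \<in> L then C else D"
  shows "cost U (pair_star z v L) x
       = pot A + pot B + card L * pot C + (real (card U) - 2 - real (card L)) * pot D + A * B * (card L * C)"
proof -
  have "sum x L = (\<Sum>a\<in>L. C)" using assms by (intro sum.cong) (auto simp: x_def)
  moreover have "x z = A" "x v = B" using assms by (auto simp: x_def)
  moreover have "(\<Sum>e\<in>pair_star z v L. prod x e) = x z * x v * sum x L"
    using assms by (intro sum_pair_star) auto
  moreover have "(\<Sum>a\<in>U. pot (x a)) = pot A + pot B + card L * pot C + (real (card U) - 2 - real (card L)) * pot D"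
    unfolding x_def by (rule sum_star_weights[of U z v L pot A B C D]) (use assms in auto)
  ultimately show ?thesis by (simp add: cost_def)
qed

lemma obtain_star_vertices:
  assumes "finite U" "s \<le> card U - 2" "2 \<le> card U"
  obtains z v L where "z \<in> U" "v \<in> U" "z \<noteq> v" "L \<subseteq> U - {z, v}" "card L = s"
proof -
  obtain T where T: "T \<subseteq> U" "card T = 2" using assms obtain_subset_with_card_n by metis
  then obtain z v where zv: "T = {z, v}" "z \<noteq> v" by (auto simp: card_2_iff)
  have "card (U - {z, v}) = card U - 2" using assms T zv by (simp add: card_Diff_insert)
  then obtain L where "L \<subseteq> U - {z, v}" "card L = s"
    using assms obtain_subset_with_card_n by metis
  with T zv show thesis by (intro that) auto
qed

text \<open>The left side comes from relative deviations \<open>s * \<eta>\<close> at the two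
  centres and \<open>\<eta>\<close> at the leaves. Since \<open>2 * s^2 + s\<close> is the sum of
  squared degrees of the star, the first two terms on the right are the minimum of the linearised
  problem; \<open>s^3 + 2 * s^2\<close> comes from the pairwise products in
  \<open>(1 - s * \<eta>)^2 * (1 - \<eta>)\<close>, and 1/2 absorbs everything else.\<close>

lemma small_star_real:
  fixes c \<eta> s :: real
  assumes s: "0 \<le> s" "s \<le> 2000" and \<eta>: "0 < \<eta>" "\<eta> \<le> 1 / 10^12"
    and c: "c = \<eta> + 3 * s * \<eta>\<^sup>2 * c" "0 < c"
  shows "(1/2 - c) * \<eta>\<^sup>2 * (2 * s\<^sup>2 + s) + c / 3 * \<eta>^3 * (2 * s^3 + s) + c * s * (1 - s * \<eta>)\<^sup>2 * (1 - \<eta>)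
    \<le> c * s - c\<^sup>2 * (2 * s\<^sup>2 + s) / (2 * (1 - 2 * c)) + c^3 * (s^3 + 2 * s\<^sup>2 + 1/2)"
proof -
  define E where "E = 2 * s\<^sup>2 + s"
  define k where "k = 1 - 2 * c"
  \<comment> \<open>The exact minimiser would have \<open>c / k\<close> in place of
    \<open>\<eta>\<close>. The discrepancy \<open>d\<close> is of order \<open>c^2\<close> and costs
    only its square.\<close>
  define d where "d = c - k * \<eta>"
  have s\<eta>: "s * \<eta> \<le> 2000 * (1 / 10^12)" using s \<eta> by (intro mult_mono) auto
  have "3 * s * \<eta>\<^sup>2 * c = (3 * (s * \<eta>)) * (\<eta> * c)" by (simp add: power2_eq_square)
  also have "\<dots> \<le> (1/2) * (\<eta> * c)" using s\<eta> \<eta> c by (intro mult_right_mono) auto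
  finally have c1: "c \<le> \<eta> + (1/2) * (\<eta> * c)" using c(1) by linarith
  have "\<eta> * c \<le> 1 * c" using \<eta> c by (intro mult_right_mono) auto
  then have c2: "c \<le> 2 * \<eta>" using c1 by simp
  then have c3: "c \<le> 2 / 10^12" using \<eta> by simp
  have k: "k \<ge> 99/100" "k \<le> 1" using c3 c by (auto simp: k_def)
  have \<eta>c: "\<eta> \<le> c"
  proof -
    have "0 \<le> 3 * s * \<eta>\<^sup>2 * c" using s c by simp
    then show ?thesis using c by linarith
  qed
  have d_eq: "d = c - \<eta> + 2 * (\<eta> * c)" by (simp add: d_def k_def algebra_simps)
  have "0 \<le> \<eta> * c" using \<eta> c by simp
  then have d0: "0 \<le> d" using \<eta>c d_eq by linarith
  have "d \<le> (5/2) * (\<eta> * c)" using c1 d_eq by linarith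
  also have "\<dots> \<le> 3 * (c * c)" using \<eta>c c \<eta> by (intro mult_mono) auto
  finally have d1: "d \<le> 3 * c\<^sup>2" by (simp add: power2_eq_square)
  have dd: "d\<^sup>2 \<le> 9 * c^4"
    using power_mono[OF d1 d0, of 2] by (simp add: power_mult_distrib flip: power_mult)
  have E0: "0 \<le> E" "E \<le> 10^7"
  proof -
    have "s\<^sup>2 \<le> 2000\<^sup>2" using s by (intro power_mono) auto
    then show "E \<le> 10^7" unfolding E_def using s by simp
  qed (use s in \<open>simp add: E_def\<close>)
  have t1: "E * d\<^sup>2 / (2 * k) \<le> 5 * E * c^4"
  proof -
    have "E * d\<^sup>2 / (2 * k) \<le> E * (9 * c^4) / (2 * (99/100))"
      using E0 dd k by (intro frac_le mult_left_mono) auto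
    also have "\<dots> \<le> 5 * E * c^4" using E0 c by (simp add: field_simps)
    finally show ?thesis .
  qed
  have t2: "c * \<eta>\<^sup>2 * (s^3 + 2 * s\<^sup>2) \<le> c * c\<^sup>2 * (s^3 + 2 * s\<^sup>2)"
    using \<eta> \<eta>c c s by (intro mult_right_mono mult_left_mono power_mono) auto
  have t3: "c / 3 * \<eta>^3 * (2 * s^3 + s) \<le> c / 3 * c^3 * (2 * s^3 + s)"
    using \<eta> \<eta>c c s by (intro mult_right_mono mult_left_mono power_mono) auto
  have s3: "2 * s^3 + s \<le> 2 * 10^10"
  proof -
    have "s^3 \<le> 2000^3" using s by (intro power_mono) auto
    then show ?thesis using s by simp
  qed
  have t4: "5 * E * c^4 + c / 3 * c^3 * (2 * s^3 + s) \<le> c^3 * (1/2)"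
  proof -
    have "c * (5 * E + (2 * s^3 + s) / 3) \<le> (2 / 10^12) * (5 * 10^7 + (2 * 10^10) / 3)"
      using c c3 E0 s3 s by (intro mult_mono add_mono divide_right_mono) auto
    also have "\<dots> \<le> 1/2" by simp
    finally have "c^3 * (c * (5 * E + (2 * s^3 + s) / 3)) \<le> c^3 * (1/2)"
      using c by (intro mult_left_mono) auto
    moreover have "c^3 * (c * (5 * E + (2 * s^3 + s) / 3)) = 5 * E * c^4 + c / 3 * c^3 * (2 * s^3 + s)"
      by (simp add: field_simps power3_eq_cube power4_eq_xxxx)
    ultimately show ?thesis by simp
  qed
  have ident: "(1/2 - c) * \<eta>\<^sup>2 * E - c * \<eta> * E = E * d\<^sup>2 / (2 * k) - c\<^sup>2 * E / (2 * k)"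
  proof -
    have h: "1/2 - c = k / 2" by (simp add: k_def)
    show ?thesis unfolding h d_def using k by (simp add: field_simps power2_eq_square)
  qed
  have expand: "c * s * (1 - s * \<eta>)\<^sup>2 * (1 - \<eta>)
     = c * s - c * \<eta> * E + c * \<eta>\<^sup>2 * (s^3 + 2 * s\<^sup>2) - c * (s * s\<^sup>2 * \<eta>^3)"
    by (simp add: E_def algebra_simps power2_eq_square power3_eq_cube)
  have "0 \<le> c * (s * s\<^sup>2 * \<eta>^3)" using c s \<eta> by simp
  moreover have "c^3 * (s^3 + 2 * s\<^sup>2 + 1/2) = c * c\<^sup>2 * (s^3 + 2 * s\<^sup>2) + c^3 * (1/2)"
    by (simp add: algebra_simps power2_eq_square power3_eq_cube)
  ultimately show ?thesis
    unfolding E_def[symmetric] k_def[symmetric]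
    using expand ident t1 t2 t3 t4 by linarith
qed

text \<open>The Taylor coefficients of \<open>pot\<close> are replaced by free variables, which
  makes this a polynomial identity; \<open>3 * s\<close> is the total degree of the star.\<close>

lemma star_cost_identity:
  fixes c s \<eta> n P K h t :: real
  shows "2 * (P - K * (c * s * \<eta>) + h * (c * s * \<eta>)\<^sup>2 + t * (c * s * \<eta>)^3)
       + s * (P - K * (c * \<eta>) + h * (c * \<eta>)\<^sup>2 + t * (c * \<eta>)^3) + (n - 2 - s) * P
       + (c - c * s * \<eta>) * (c - c * s * \<eta>) * (s * (c - c * \<eta>))
     = n * P - K * (c * (3 * s * \<eta>))
      + c\<^sup>2 * (h * \<eta>\<^sup>2 * (2 * s\<^sup>2 + s) + c * t * \<eta>^3 * (2 * s^3 + s) + c * s * (1 - s * \<eta>)\<^sup>2 * (1 - \<eta>))"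
  by algebra

text \<open>The witness has weights \<open>c (1 - d/n)\<close> at vertices of degree \<open>d\<close> in the star, the first-order optimum.\<close>
lemma small_star:
  fixes U :: "'a set" and n s :: nat and c :: real
  assumes "finite U" "card U = n" "s \<le> 2000" "real n \<ge> 10^12"
  defines "c \<equiv> real n / ((real n)\<^sup>2 - 3 * real s)"
  obtains z v L x where "z \<in> U" "v \<in> U" "z \<noteq> v" "L \<subseteq> U - {z, v}" "card L = s"
    "\<And>a. a \<in> U \<Longrightarrow> 0 \<le> x a" "sum x U = 1"
    "cost U (pair_star z v L) x \<le> n * pot c + (c - c\<^sup>2) * (1 - n * c)
       + c\<^sup>2 * (c * s - c\<^sup>2 * (2 * s\<^sup>2 + s) / (2 * (1 - 2 * c)) + c^3 * (s^3 + 2 * s\<^sup>2 + 1/2))"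
proof -
  note n = assms(4)
  then have "n \<ge> 2002" by simp
  with assms(1-3) have "s \<le> card U - 2" "2 \<le> card U" by auto
  from obtain_star_vertices[OF assms(1) this]
  obtain z v L where zvL: "z \<in> U" "v \<in> U" "z \<noteq> v" "L \<subseteq> U - {z, v}" "card L = s"
    by blast
  define \<eta> where "\<eta> = 1 / real n"
  have s: "real s \<le> 2000" using assms(3) by simp
  have "real n * 1 \<le> real n * real n" using n by (intro mult_left_mono) auto
  moreover have "real n \<ge> 6001" using n by simp
  ultimately have pos: "(real n)\<^sup>2 - 3 * real s > 0" unfolding power2_eq_square using s by linarith
  have c0: "0 < c" using pos n by (simp add: c_def)
  \<comment> \<open>This is the condition that the total is 1: the star takes off
    \<open>c / n\<close> per incidence, and there are \<open>3 * s\<close> incidences.\<close>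
  have ceq: "c * (n - 3 * s * \<eta>) = 1"
    using pos n by (simp add: c_def \<eta>_def field_simps power2_eq_square)
  have \<eta>: "0 < \<eta>" "\<eta> \<le> 1/10^12" "n * \<eta> = 1" using n by (auto simp: \<eta>_def field_simps)
  have ceq': "c = \<eta> + 3 * s * \<eta>\<^sup>2 * c"
  proof -
    have "\<eta> * (c * (n - 3 * s * \<eta>)) = \<eta>" using ceq by simp
    moreover have "\<eta> * (c * (n - 3 * s * \<eta>)) = c * (n * \<eta>) - 3 * s * \<eta>\<^sup>2 * c"
      by (simp add: algebra_simps power2_eq_square)
    ultimately show ?thesis using \<eta> by simp
  qed
  define x where "x = (\<lambda>a. if a = z then c - c * s * \<eta> else if a = v then c - c * s * \<eta>
     else if a \<in> L then c - c * \<eta> else c)"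
  have "s * \<eta> \<le> 2000 * (1/10^12)" using s \<eta> by (intro mult_mono) auto
  then have s\<eta>: "s * \<eta> \<le> 1" by simp
  have nn: "0 \<le> x a" for a
  proof -
    have "c * (s * \<eta>) \<le> c * 1" using s\<eta> c0 by (intro mult_left_mono) auto
    moreover have "c * \<eta> \<le> c * 1" using \<eta> c0 by (intro mult_left_mono) auto
    ultimately show ?thesis using c0 by (auto simp: x_def mult.assoc)
  qed
  have sumx: "sum x U = 1"
    using sum_star_weights[of U z v L "\<lambda>y. y" "c - c * s * \<eta>" "c - c * s * \<eta>" "c - c * \<eta>" c]
      zvL assms(1,2) ceq by (simp add: x_def algebra_simps)
  have "cost U (pair_star z v L) x
     = pot (c - c * s * \<eta>) + pot (c - c * s * \<eta>) + s * pot (c - c * \<eta>) + (real n - 2 - real s) * pot c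
       + (c - c * s * \<eta>) * (c - c * s * \<eta>) * (s * (c - c * \<eta>))"
    unfolding x_def using cost_pair_star[of U z v L] zvL assms(1,2) by simp
  also have "\<dots> = n * pot c - (c - c\<^sup>2) * (c * (3 * s * \<eta>))
      + c\<^sup>2 * ((1/2 - c) * \<eta>\<^sup>2 * (2 * s\<^sup>2 + s) + c / 3 * \<eta>^3 * (2 * s^3 + s) + c * s * (1 - s * \<eta>)\<^sup>2 * (1 - \<eta>))"
    using star_cost_identity[of "pot c" "c - c\<^sup>2" c "real s" \<eta> "1/2 - c" "1/3" "real n"]
    unfolding pot_diff by simp
  also have "c * (3 * s * \<eta>) = n * c - 1" using ceq by (simp add: algebra_simps)
  finally have eq: "cost U (pair_star z v L) x = n * pot c - (c - c\<^sup>2) * (n * c - 1)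
      + c\<^sup>2 * ((1/2 - c) * \<eta>\<^sup>2 * (2 * s\<^sup>2 + s) + c / 3 * \<eta>^3 * (2 * s^3 + s) + c * s * (1 - s * \<eta>)\<^sup>2 * (1 - \<eta>))" .
  have "c\<^sup>2 * ((1/2 - c) * \<eta>\<^sup>2 * (2 * s\<^sup>2 + s) + c / 3 * \<eta>^3 * (2 * s^3 + s) + c * s * (1 - s * \<eta>)\<^sup>2 * (1 - \<eta>))
    \<le> c\<^sup>2 * (c * s - c\<^sup>2 * (2 * s\<^sup>2 + s) / (2 * (1 - 2 * c)) + c^3 * (s^3 + 2 * s\<^sup>2 + 1/2))"
    using small_star_real[of s \<eta> c] s \<eta> ceq' c0 by (intro mult_left_mono) auto
  then have "cost U (pair_star z v L) x \<le> n * pot c + (c - c\<^sup>2) * (1 - n * c)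
       + c\<^sup>2 * (c * s - c\<^sup>2 * (2 * s\<^sup>2 + s) / (2 * (1 - 2 * c)) + c^3 * (s^3 + 2 * s\<^sup>2 + 1/2))"
    unfolding eq by (simp add: algebra_simps)
  with that zvL nn sumx show thesis by blast
qed

section \<open>Lower bounds for a competing family with boundedly many edges\<close>

text \<open>Puts an arbitrary weighting into the same form as the bound of
  \<open>small_star\<close>. The relative deviations \<open>\<rho>\<close> are truncated at 0 and
  lie in [0,1], so all factors \<open>1 - \<rho> a\<close> are nonnegative and the products can be
  compared factor by factor.\<close>

lemma small_lower:
  fixes x :: "'a \<Rightarrow> real" and c :: real
  assumes U: "finite U" "H \<subseteq> nsets U 3"
    and x: "\<And>a. a \<in> U \<Longrightarrow> 0 \<le> x a" "sum x U = 1" and c: "0 < c" "c \<le> 1/4"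
  defines "\<rho> \<equiv> \<lambda>a. max 0 (c - x a) / c"
  shows "card U * pot c + (c - c\<^sup>2) * (1 - card U * c)
     + c\<^sup>2 * ((1/2 - c) * (\<Sum>a\<in>U. (\<rho> a)\<^sup>2) + c * (\<Sum>e\<in>H. \<Prod>a\<in>e. 1 - \<rho> a)) \<le> cost U H x"
proof -
  have "x a \<le> 1" if "a \<in> U" for a
    using member_le_sum[of a U x] that x U by auto
  from sum_pot_lower[of U x c, OF this]
  have "card U * pot c + (c - c\<^sup>2) * (1 - card U * c) + (1/2 - c) * (\<Sum>a\<in>U. (max 0 (c - x a))\<^sup>2)
     \<le> (\<Sum>a\<in>U. pot (x a))" using c x by simp
  moreover have "(\<Sum>a\<in>U. (max 0 (c - x a))\<^sup>2) = c\<^sup>2 * (\<Sum>a\<in>U. (\<rho> a)\<^sup>2)"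
    using c unfolding sum_distrib_left by (intro sum.cong) (auto simp: \<rho>_def power_divide)
  moreover have "c ^ 3 * (\<Sum>e\<in>H. \<Prod>a\<in>e. 1 - \<rho> a) \<le> (\<Sum>e\<in>H. prod x e)"
    unfolding sum_distrib_left
  proof (rule sum_mono)
    fix e assume "e \<in> H"
    then have e: "e \<subseteq> U" "finite e" "card e = 3" using U by (auto simp: nsets_def)
    have "c ^ 3 * (\<Prod>a\<in>e. 1 - \<rho> a) = (\<Prod>a\<in>e. c * (1 - \<rho> a))"
      by (simp add: prod.distrib e)
    also have "\<dots> \<le> prod x e"
    proof (rule prod_mono)
      fix a assume "a \<in> e"
      then have "0 \<le> x a" using e x by auto
      moreover have "c * (1 - \<rho> a) = c - max 0 (c - x a)" using c by (simp add: \<rho>_def field_simps)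
      ultimately show "0 \<le> c * (1 - \<rho> a) \<and> c * (1 - \<rho> a) \<le> x a" using c by auto
    qed
    finally show "c ^ 3 * (\<Prod>a\<in>e. 1 - \<rho> a) \<le> prod x e" .
  qed
  ultimately show ?thesis
    by (simp add: cost_def algebra_simps power2_eq_square power3_eq_cube)
qed

text \<open>Distinct triples overlap in at most 2 points and equal ones in 3, which gives
  \<open>2 * s^2 + s\<close>, the value of a pair star. The one deficient ordered pair
  \<open>(e, f)\<close> saves a unit.\<close>

lemma sum_overlaps_le:
  assumes U: "finite U" "H \<subseteq> nsets U 3"
    and e: "e \<in> H" "f \<in> H" "e \<noteq> f" "card (e \<inter> f) \<le> 1"
  shows "(\<Sum>a\<in>U. (\<Sum>e\<in>H. of_bool (a \<in> e))\<^sup>2) \<le> 2 * (real (card H))\<^sup>2 + card H - 1"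
proof -
  have fin: "finite H" using U by (meson finite_imp_finite_nsets finite_subset)
  have inter: "(\<Sum>a\<in>U. of_bool (a \<in> p) * of_bool (a \<in> q)) = real (card (p \<inter> q))" if "p \<in> H" for p q
  proof -
    have "(\<Sum>a\<in>U. of_bool (a \<in> p) * of_bool (a \<in> q)) = (\<Sum>a\<in>p \<inter> q. 1::real)"
      by (intro sum.mono_neutral_cong_right) (use U that in \<open>auto simp: nsets_def\<close>)
    then show ?thesis by simp
  qed
  have le: "real (card (p \<inter> q)) \<le> 2 + of_bool (p = q) - of_bool (p = e \<and> q = f)" if "p \<in> H" "q \<in> H" for p q
  proof -
    have pq: "finite p" "card p = 3" "finite q" "card q = 3" using that U by (auto simp: nsets_def)
    show ?thesis
    proof (cases "p = q")
      case False
      have "card (p \<inter> q) < card p"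
      proof (rule psubset_card_mono)
        show "p \<inter> q \<subset> p" using False pq by (metis card_subset_eq inf.cobounded1 inf.cobounded2 psubsetI)
      qed (use pq in auto)
      then show ?thesis using pq e False by auto
    qed (use pq e in auto)
  qed
  have "(\<Sum>a\<in>U. (\<Sum>e\<in>H. of_bool (a \<in> e))\<^sup>2) = (\<Sum>p\<in>H. \<Sum>q\<in>H. real (card (p \<inter> q)))"
    unfolding sum_squares_swap by (intro sum.cong refl inter)
  also have "\<dots> \<le> (\<Sum>p\<in>H. \<Sum>q\<in>H. 2 + of_bool (p = q) - of_bool (p = e \<and> q = f))"
    by (intro sum_mono le)
  also have "\<dots> = 2 * (real (card H))\<^sup>2 + (\<Sum>p\<in>H. \<Sum>q\<in>H. of_bool (p = q)) - (\<Sum>p\<in>H. \<Sum>q\<in>H. of_bool (p = e \<and> q = f))"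
    by (simp add: sum.distrib sum_subtractf power2_eq_square)
  also have "(\<Sum>p\<in>H. \<Sum>q\<in>H. of_bool (p = q)) = (\<Sum>p\<in>H. (1::real))"
  proof (rule sum.cong)
    fix p assume "p \<in> H"
    then show "(\<Sum>q\<in>H. of_bool (p = q)) = (1::real)"
      using fin sum.delta[of H p "\<lambda>_. 1::real"] by (simp add: of_bool_def)
  qed simp
  also have "(\<Sum>p\<in>H. \<Sum>q\<in>H. of_bool (p = e \<and> q = f)) = (\<Sum>p\<in>H. if p = e then 1 else (0::real))"
  proof (rule sum.cong)
    fix p assume "p \<in> H"
    show "(\<Sum>q\<in>H. of_bool (p = e \<and> q = f)) = (if p = e then 1 else (0::real))"
      using fin e sum.delta[of H f "\<lambda>_. 1::real"] by (simp add: of_bool_def)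
  qed simp
  also have "\<dots> = 1" using fin e by simp
  finally show ?thesis by simp
qed

section \<open>Triples pairwise sharing two points, and the ties inside a 4-set\<close>

lemma subset_insert_cases: "T \<subseteq> H \<Longrightarrow> H \<subseteq> insert X T \<Longrightarrow> H = T \<or> H = insert X T"
  by blast

text \<open>Two edges share a pair, and an edge missing one point of that pair must contain the
  other together with both outer points \<open>a\<close> and \<open>b\<close>. An edge leaving the
  resulting 4-set would meet all three of these edges in the same two points, but they have only one
  point in common.\<close>

lemma pairwise_two_intersecting:
  assumes H: "H \<subseteq> nsets U 3" and two: "\<And>e f. e \<in> H \<Longrightarrow> f \<in> H \<Longrightarrow> e \<noteq> f \<Longrightarrow> 2 \<le> card (e \<inter> f)"
    and ne: "e \<in> H" "f \<in> H" "e \<noteq> f"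
    and nopair: "\<And>z v. z \<noteq> v \<Longrightarrow> \<exists>g\<in>H. \<not> {z, v} \<subseteq> g"
  obtains k1 k2 k3 k4 where "distinct [k1, k2, k3, k4]" "{k1, k2, k3, k4} \<subseteq> U"
    "H = {{k1, k2, k3}, {k1, k2, k4}, {k1, k3, k4}} \<or>
     H = insert {k2, k3, k4} {{k1, k2, k3}, {k1, k2, k4}, {k1, k3, k4}}"
proof -
  note goal = that
  have c3: "finite h \<and> card h = 3 \<and> h \<subseteq> U" if "h \<in> H" for h using that H by (auto simp: nsets_def)
  have lt: "card (p \<inter> q) = 2" if "p \<in> H" "q \<in> H" "p \<noteq> q" for p q
  proof -
    have "p \<inter> q \<subset> p" using that c3[of p] c3[of q]
      by (metis card_subset_eq inf.cobounded1 inf.cobounded2 psubsetI)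
    then have "card (p \<inter> q) < 3" using that c3[of p] psubset_card_mono by metis
    then show ?thesis using two[OF that] by simp
  qed
  obtain z v where zv: "e \<inter> f = {z, v}" "z \<noteq> v" using lt[OF ne] by (auto simp: card_2_iff)
  have "card (e - {z, v}) = 1" "card (f - {z, v}) = 1"
    using card_Diff_subset[of "e \<inter> f" e] card_Diff_subset[of "e \<inter> f" f] lt[OF ne] c3[OF ne(1)] c3[OF ne(2)] zv(1)
    by auto
  then obtain a b where ab: "e - {z, v} = {a}" "f - {z, v} = {b}" by (auto simp: card_1_singleton_iff)
  then have ef: "e = {z, v, a}" "f = {z, v, b}" using zv by auto
  have d: "a \<noteq> z" "a \<noteq> v" "b \<noteq> z" "b \<noteq> v" "a \<noteq> b" using ab ef zv ne by auto
  have main: thesis if g: "g \<in> H" "v' \<notin> g" and zv': "{z', v'} = {z, v}" "z' \<noteq> v'" for g z' v'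
  proof -
    have e': "e = {z', v', a}" "f = {z', v', b}" using ef zv' by auto
    have d': "a \<noteq> z'" "a \<noteq> v'" "b \<noteq> z'" "b \<noteq> v'" using d zv' by auto
    have "g \<noteq> e" "g \<noteq> f" using g e' by auto
    then have "card (g \<inter> e) = 2" "card (g \<inter> f) = 2" using lt g ne by auto
    moreover have "g \<inter> e \<subseteq> {z', a}" "g \<inter> f \<subseteq> {z', b}" using g e' by auto
    ultimately have "g \<inter> e = {z', a}" "g \<inter> f = {z', b}"
      using d' by (metis card_2_iff card_subset_eq finite.emptyI finite.insertI)+
    then have "{z', a, b} \<subseteq> g" by auto
    moreover have "card {z', a, b} = 3" using d d' by auto
    ultimately have ge: "g = {z', a, b}" using c3[OF g(1)] by (metis card_subset_eq)
    have sub: "h \<subseteq> {z', v', a, b}" if h: "h \<in> H" for h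
    proof (rule ccontr)
      assume "\<not> ?thesis"
      then have "h \<inter> {z', v', a, b} \<subset> h" by auto
      then have "card (h \<inter> {z', v', a, b}) < 3" using c3[OF h] psubset_card_mono by metis
      then have le: "card (h \<inter> {z', v', a, b}) \<le> 2" by simp
      have "h \<inter> p = h \<inter> {z', v', a, b}" if "p \<in> {e, f, g}" for p
      proof (rule card_seteq)
        have "p \<subseteq> {z', v', a, b}" using that e' ge by auto
        then show "h \<inter> p \<subseteq> h \<inter> {z', v', a, b}" by auto
        have "h \<noteq> p" using \<open>\<not> h \<subseteq> _\<close> \<open>p \<subseteq> _\<close> by auto
        then show "card (h \<inter> {z', v', a, b}) \<le> card (h \<inter> p)"
          using lt[of h p] h that ne g le by auto
      qed (use c3[OF h] in auto)
      then have "h \<inter> {z', v', a, b} \<subseteq> e \<inter> f \<inter> g" by blast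
      also have "\<dots> = {z'}" using e' ge d d' zv' by auto
      finally have "card (h \<inter> {z', v', a, b}) \<le> 1" using card_mono[of "{z'}"] by force
      moreover have "2 \<le> card (h \<inter> {z', v', a, b})"
      proof -
        have "h \<noteq> e" using \<open>\<not> h \<subseteq> _\<close> e' by auto
        then have "card (h \<inter> e) = 2" using lt h ne by auto
        moreover have "card (h \<inter> e) \<le> card (h \<inter> {z', v', a, b})"
          using e' by (intro card_mono) auto
        ultimately show ?thesis by simp
      qed
      ultimately show False by simp
    qed
    let ?T = "{{z', v', a}, {z', v', b}, {z', a, b}}"
    have "?T \<subseteq> H" using e' ge ne g by auto
    moreover have "H \<subseteq> insert {v', a, b} ?T"
    proof
      fix h assume h: "h \<in> H"
      have K: "card {z', v', a, b} = 4" using d d' zv' by auto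
      have "card ({z', v', a, b} - h) = 1"
        using sub[OF h] c3[OF h] K by (simp add: card_Diff_subset)
      then obtain k where k: "{z', v', a, b} - h = {k}" by (auto simp: card_1_singleton_iff)
      then have "h = {z', v', a, b} - {k}" "k \<in> {z', v', a, b}" using sub[OF h] by auto
      then show "h \<in> insert {v', a, b} ?T" using d d' zv' by auto
    qed
    ultimately have cases: "H = ?T \<or> H = insert {v', a, b} ?T"
      by (rule subset_insert_cases)
    have sub4: "{z', v', a, b} \<subseteq> U" using c3[OF ne(1)] c3[OF ne(2)] e' by auto
    have dist4: "distinct [z', v', a, b]" using d d' zv' by auto
    show thesis by (rule goal[OF dist4 sub4 cases])
  qed
  obtain g where g: "g \<in> H" "\<not> {z, v} \<subseteq> g" using nopair zv by blast
  show thesis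
  proof (cases "v \<in> g")
    case True
    then show thesis using main[of g z v] g zv by auto
  next
    case False
    then show thesis using main[of g v z] g zv by auto
  qed
qed

lemma three_factors_lower:
  fixes u v w :: real
  assumes "0 \<le> u" "u \<le> 1" "0 \<le> v" "v \<le> 1" "0 \<le> w" "w \<le> 1"
  shows "(1 - u) * (1 - v) * (1 - w) \<ge> 1 - u - v - w"
proof -
  have "0 \<le> u * v * (1 - w) + u * w + v * w" using assms by simp
  then show ?thesis by (simp add: algebra_simps)
qed

text \<open>Retains the second-order products, measured by lower bounds on the deviations; the
  factor 999/1000 pays for the third-order term.\<close>

lemma three_factors_lower':
  fixes u v w a b d :: real
  assumes "0 \<le> a" "a \<le> u" "0 \<le> b" "b \<le> v" "0 \<le> d" "d \<le> w" "w \<le> 1/1000"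
  shows "(1 - u) * (1 - v) * (1 - w) \<ge> 1 - u - v - w + 999/1000 * (a * b + a * d + b * d)"
proof -
  have "999/1000 * (a * b) \<le> (1 - w) * (u * v)" "999/1000 * (a * d) \<le> 1 * (u * w)"
    "999/1000 * (b * d) \<le> 1 * (v * w)"
    using mult_mono[of "999/1000" "1 - w" "a * b" "u * v"] mult_mono[of "999/1000" 1 "a * d" "u * w"]
      mult_mono[of "999/1000" 1 "b * d" "v * w"] mult_mono[of a u b v] mult_mono[of a u d w] mult_mono[of b v d w]
      assms by auto
  moreover have "(1 - u) * (1 - v) * (1 - w) = 1 - u - v - w + ((1 - w) * (u * v) + u * w + v * w)"
    by (simp add: algebra_simps)
  ultimately show ?thesis unfolding distrib_left by linarith
qed

lemma complete_square:
  fixes k c d r :: real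
  assumes "0 < k"
  shows "k / 2 * r\<^sup>2 = d * (c * r) + k / 2 * (r - c * d / k)\<^sup>2 - d\<^sup>2 * (c\<^sup>2 / (2 * k))"
  using assms by (simp add: field_simps power2_eq_square)

text \<open>Applied with \<open>r\<close> the distance from the quadratic optimum. An error above
  \<open>c / 100\<close> costs a multiple of \<open>c^2\<close>, more than \<open>97 * c^3\<close>,
  which covers the third-order constants 91/2 and 193/2 of the two ties.\<close>

lemma far_square:
  fixes k c r :: real
  assumes "99/100 \<le> k" "0 < c" "c \<le> 1/10^11" "c / 100 < \<bar>r\<bar>"
  shows "97 * c^3 \<le> k / 2 * r\<^sup>2"
proof -
  have "c * (97 * c\<^sup>2) \<le> (1/10^11) * (97 * c\<^sup>2)" using assms by (intro mult_right_mono) auto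
  also have "\<dots> \<le> (99/100) / 2 * (c / 100)\<^sup>2" by (simp add: power_divide)
  also have "\<dots> \<le> k / 2 * \<bar>r\<bar>\<^sup>2" using assms by (intro mult_mono power_mono) auto
  finally show ?thesis by (simp add: power2_eq_square power3_eq_cube)
qed

text \<open>Three triples in a 4-set have degrees 3, 2, 2, 2 with square sum 21, as for the star
  with three edges, so the second order ties. At third order the products of degrees over pairs
  within an edge add up to \<open>3 * 16 = 48\<close>, against \<open>3^3 + 2 * 3^2 = 45\<close> for
  the star; 91/2 is 45 plus the 1/2 lost in \<open>small_star\<close>.\<close>

lemma tie_three:
  fixes k c p q r t :: real
  assumes k: "99/100 \<le> k" "k \<le> 1" and c: "0 < c" "c \<le> 1/10^11"
    and p: "0 \<le> p" "p \<le> 1" and q: "0 \<le> q" "q \<le> 1" and r: "0 \<le> r" "r \<le> 1" and t: "0 \<le> t" "t \<le> 1"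
  shows "k / 2 * (p\<^sup>2 + q\<^sup>2 + r\<^sup>2 + t\<^sup>2)
     + c * ((1 - p) * (1 - q) * (1 - r) + (1 - p) * (1 - q) * (1 - t) + (1 - p) * (1 - r) * (1 - t))
     \<ge> 3 * c - 21 * (c\<^sup>2 / (2 * k)) + c^3 * (91/2)" (is "?L \<ge> _")
proof -
  define E where "E = (1 - p) * (1 - q) * (1 - r) + (1 - p) * (1 - q) * (1 - t) + (1 - p) * (1 - r) * (1 - t)"
  \<comment> \<open>The excess of the products over their linear part, a nonnegative quantity of
    second order.\<close>
  define X where "X = E - (3 - 3 * p - 2 * q - 2 * r - 2 * t)"
  define dp where "dp = p - c * 3 / k"
  define dq where "dq = q - c * 2 / k"
  define dr where "dr = r - c * 2 / k"
  define dt where "dt = t - c * 2 / k"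
  have k0: "0 < k" using k by simp
  have cX_eq: "c * X = c * E - 3 * c + 3 * (c * p) + 2 * (c * q) + 2 * (c * r) + 2 * (c * t)"
    by (simp add: X_def algebra_simps)
  have sp: "k / 2 * p\<^sup>2 = 3 * (c * p) + k / 2 * dp\<^sup>2 - 9 * (c\<^sup>2 / (2 * k))"
    using complete_square[OF k0, where r = p and d = 3 and c = c] by (simp add: dp_def)
  have sq: "k / 2 * q\<^sup>2 = 2 * (c * q) + k / 2 * dq\<^sup>2 - 4 * (c\<^sup>2 / (2 * k))"
    using complete_square[OF k0, where r = q and d = 2 and c = c] by (simp add: dq_def)
  have sr: "k / 2 * r\<^sup>2 = 2 * (c * r) + k / 2 * dr\<^sup>2 - 4 * (c\<^sup>2 / (2 * k))"
    using complete_square[OF k0, where r = r and d = 2 and c = c] by (simp add: dr_def)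
  have st: "k / 2 * t\<^sup>2 = 2 * (c * t) + k / 2 * dt\<^sup>2 - 4 * (c\<^sup>2 / (2 * k))"
    using complete_square[OF k0, where r = t and d = 2 and c = c] by (simp add: dt_def)
  have L: "?L = 3 * c - 21 * (c\<^sup>2 / (2 * k)) + c * X + (k / 2 * dp\<^sup>2 + k / 2 * dq\<^sup>2 + k / 2 * dr\<^sup>2 + k / 2 * dt\<^sup>2)"
    unfolding E_def[symmetric] using cX_eq sp sq sr st by (simp only: distrib_left)
  have nn: "0 \<le> k / 2 * dp\<^sup>2" "0 \<le> k / 2 * dq\<^sup>2" "0 \<le> k / 2 * dr\<^sup>2" "0 \<le> k / 2 * dt\<^sup>2"
    using k by auto
  have X0: "0 \<le> X"
    unfolding X_def E_def using three_factors_lower[of p q r] three_factors_lower[of p q t]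
      three_factors_lower[of p r t] assms by linarith
  have cX: "0 \<le> c * X" using X0 c by simp
  have c3: "0 < c^3" using c by simp
  show ?thesis
  \<comment> \<open>Far from the quadratic optimum the squares alone win. Near it the deviations are
    about \<open>3 * c\<close> and \<open>2 * c\<close>, which makes \<open>X\<close> large
    enough.\<close>
  proof (cases "\<bar>dp\<bar> \<le> c / 100 \<and> \<bar>dq\<bar> \<le> c / 100 \<and> \<bar>dr\<bar> \<le> c / 100 \<and> \<bar>dt\<bar> \<le> c / 100")
    case False
    then have "97 * c^3 \<le> k / 2 * dp\<^sup>2 \<or> 97 * c^3 \<le> k / 2 * dq\<^sup>2 \<or> 97 * c^3 \<le> k / 2 * dr\<^sup>2 \<or> 97 * c^3 \<le> k / 2 * dt\<^sup>2"
      using far_square[OF k(1) c] by (meson linorder_not_le)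
    then show ?thesis using L nn cX c3 by linarith
  next
    case True
    have ck: "c \<le> c / k" "c / k \<le> c / (99/100)" using c k by (auto simp: field_simps intro!: divide_left_mono)
    have dev: "\<bar>p - 3 * (c / k)\<bar> \<le> c / 100" "\<bar>q - 2 * (c / k)\<bar> \<le> c / 100" "\<bar>r - 2 * (c / k)\<bar> \<le> c / 100" "\<bar>t - 2 * (c / k)\<bar> \<le> c / 100"
      using True by (auto simp: dp_def dq_def dr_def dt_def mult.commute)
    have lo: "c * (299/100) \<le> p" "c * (199/100) \<le> q" "c * (199/100) \<le> r" "c * (199/100) \<le> t"
      using dev ck by linarith+
    have "c / (99/100) \<le> 1/10000" using c by simp
    with ck(2) have small: "c / k \<le> 1/10000" "c \<le> 1/1000" using c by auto
    have hi: "r \<le> 1/1000" "t \<le> 1/1000"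
      using dev(3) dev(4) small by linarith+
    have pos: "0 \<le> c * (299/100)" "0 \<le> c * (199/100)" using c by auto
    have comb: "3 * K \<le> A + B + C - (3 - 3 * p - 2 * q - 2 * r - 2 * t)"
      if "1 - p - q - r + K \<le> A" "1 - p - q - t + K \<le> B" "1 - p - r - t + K \<le> C" for K A B C
      using that by linarith
    have "X \<ge> 3 * (999/1000 * (c * (299/100) * (c * (199/100)) + c * (299/100) * (c * (199/100)) + c * (199/100) * (c * (199/100))))"
      unfolding X_def E_def
      by (rule comb[OF three_factors_lower'[OF pos(1) lo(1) pos(2) lo(2) pos(2) lo(3) hi(1)]
        three_factors_lower'[OF pos(1) lo(1) pos(2) lo(2) pos(2) lo(4) hi(2)]
        three_factors_lower'[OF pos(1) lo(1) pos(2) lo(3) pos(2) lo(4) hi(2)]])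
    then have "X \<ge> 475333191/10000000 * (c * c)" by (simp add: algebra_simps)
    moreover have "0 \<le> c * c" by simp
    ultimately have "X \<ge> 91/2 * (c * c)" by linarith
    then have "c * X \<ge> c * (91/2 * (c * c))" using c by (intro mult_left_mono) auto
    then show ?thesis using L nn by (simp add: power3_eq_cube)
  qed
qed

text \<open>The same for all four triples: degrees 3, 3, 3, 3 have square sum 36, as for the star
  with four edges, and the third order gives \<open>4 * 27 = 108\<close> against
  \<open>4^3 + 2 * 4^2 = 96\<close>; again 1/2 is added to the latter.\<close>

lemma tie_four:
  fixes k c p q r t :: real
  assumes k: "99/100 \<le> k" "k \<le> 1" and c: "0 < c" "c \<le> 1/10^11"
    and p: "0 \<le> p" "p \<le> 1" and q: "0 \<le> q" "q \<le> 1" and r: "0 \<le> r" "r \<le> 1" and t: "0 \<le> t" "t \<le> 1"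
  shows "k / 2 * (p\<^sup>2 + q\<^sup>2 + r\<^sup>2 + t\<^sup>2)
     + c * ((1 - p) * (1 - q) * (1 - r) + (1 - p) * (1 - q) * (1 - t) + (1 - p) * (1 - r) * (1 - t)
          + (1 - q) * (1 - r) * (1 - t))
     \<ge> 4 * c - 36 * (c\<^sup>2 / (2 * k)) + c^3 * (193/2)" (is "?L \<ge> _")
proof -
  define E where "E = (1 - p) * (1 - q) * (1 - r) + (1 - p) * (1 - q) * (1 - t) + (1 - p) * (1 - r) * (1 - t)
     + (1 - q) * (1 - r) * (1 - t)"
  define X where "X = E - (4 - 3 * p - 3 * q - 3 * r - 3 * t)"
  define dp where "dp = p - c * 3 / k"
  define dq where "dq = q - c * 3 / k"
  define dr where "dr = r - c * 3 / k"
  define dt where "dt = t - c * 3 / k"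
  have k0: "0 < k" using k by simp
  have cX_eq: "c * X = c * E - 4 * c + 3 * (c * p) + 3 * (c * q) + 3 * (c * r) + 3 * (c * t)"
    by (simp add: X_def algebra_simps)
  have sp: "k / 2 * p\<^sup>2 = 3 * (c * p) + k / 2 * dp\<^sup>2 - 9 * (c\<^sup>2 / (2 * k))"
    using complete_square[OF k0, where r = p and d = 3 and c = c] by (simp add: dp_def)
  have sq: "k / 2 * q\<^sup>2 = 3 * (c * q) + k / 2 * dq\<^sup>2 - 9 * (c\<^sup>2 / (2 * k))"
    using complete_square[OF k0, where r = q and d = 3 and c = c] by (simp add: dq_def)
  have sr: "k / 2 * r\<^sup>2 = 3 * (c * r) + k / 2 * dr\<^sup>2 - 9 * (c\<^sup>2 / (2 * k))"
    using complete_square[OF k0, where r = r and d = 3 and c = c] by (simp add: dr_def)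
  have st: "k / 2 * t\<^sup>2 = 3 * (c * t) + k / 2 * dt\<^sup>2 - 9 * (c\<^sup>2 / (2 * k))"
    using complete_square[OF k0, where r = t and d = 3 and c = c] by (simp add: dt_def)
  have L: "?L = 4 * c - 36 * (c\<^sup>2 / (2 * k)) + c * X + (k / 2 * dp\<^sup>2 + k / 2 * dq\<^sup>2 + k / 2 * dr\<^sup>2 + k / 2 * dt\<^sup>2)"
    unfolding E_def[symmetric] using cX_eq sp sq sr st by (simp only: distrib_left)
  have nn: "0 \<le> k / 2 * dp\<^sup>2" "0 \<le> k / 2 * dq\<^sup>2" "0 \<le> k / 2 * dr\<^sup>2" "0 \<le> k / 2 * dt\<^sup>2"
    using k by auto
  have X0: "0 \<le> X"
    unfolding X_def E_def using three_factors_lower[of p q r] three_factors_lower[of p q t]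
      three_factors_lower[of p r t] three_factors_lower[of q r t] assms by linarith
  have cX: "0 \<le> c * X" using X0 c by simp
  have c3: "0 < c^3" using c by simp
  show ?thesis
  proof (cases "\<bar>dp\<bar> \<le> c / 100 \<and> \<bar>dq\<bar> \<le> c / 100 \<and> \<bar>dr\<bar> \<le> c / 100 \<and> \<bar>dt\<bar> \<le> c / 100")
    case False
    then have "97 * c^3 \<le> k / 2 * dp\<^sup>2 \<or> 97 * c^3 \<le> k / 2 * dq\<^sup>2 \<or> 97 * c^3 \<le> k / 2 * dr\<^sup>2 \<or> 97 * c^3 \<le> k / 2 * dt\<^sup>2"
      using far_square[OF k(1) c] by (meson linorder_not_le)
    then show ?thesis using L nn cX c3 by linarith
  next
    case True
    have ck: "c \<le> c / k" "c / k \<le> c / (99/100)" using c k by (auto simp: field_simps intro!: divide_left_mono)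
    have dev: "\<bar>p - 3 * (c / k)\<bar> \<le> c / 100" "\<bar>q - 3 * (c / k)\<bar> \<le> c / 100" "\<bar>r - 3 * (c / k)\<bar> \<le> c / 100" "\<bar>t - 3 * (c / k)\<bar> \<le> c / 100"
      using True by (auto simp: dp_def dq_def dr_def dt_def mult.commute)
    have lo: "c * (299/100) \<le> p" "c * (299/100) \<le> q" "c * (299/100) \<le> r" "c * (299/100) \<le> t"
      using dev ck by linarith+
    have "c / (99/100) \<le> 1/10000" using c by simp
    with ck(2) have small: "c / k \<le> 1/10000" "c \<le> 1/1000" using c by auto
    have hi: "r \<le> 1/1000" "t \<le> 1/1000"
      using dev(3) dev(4) small by linarith+
    have pos: "0 \<le> c * (299/100)" "0 \<le> c * (199/100)" using c by auto
    have comb: "4 * K \<le> A + B + C + D - (4 - 3 * p - 3 * q - 3 * r - 3 * t)"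
      if "1 - p - q - r + K \<le> A" "1 - p - q - t + K \<le> B" "1 - p - r - t + K \<le> C"
        "1 - q - r - t + K \<le> D" for K A B C D
      using that by linarith
    have "X \<ge> 4 * (999/1000 * (c * (299/100) * (c * (299/100)) + c * (299/100) * (c * (299/100)) + c * (299/100) * (c * (299/100))))"
      unfolding X_def E_def
      by (rule comb[OF three_factors_lower'[OF pos(1) lo(1) pos(1) lo(2) pos(1) lo(3) hi(1)]
        three_factors_lower'[OF pos(1) lo(1) pos(1) lo(2) pos(1) lo(4) hi(2)]
        three_factors_lower'[OF pos(1) lo(1) pos(1) lo(3) pos(1) lo(4) hi(2)]
        three_factors_lower'[OF pos(1) lo(2) pos(1) lo(3) pos(1) lo(4) hi(2)]])
    then have "X \<ge> 267934797/2500000 * (c * c)" by (simp add: algebra_simps)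
    moreover have "0 \<le> c * c" by simp
    ultimately have "X \<ge> 193/2 * (c * c)" by linarith
    then have "c * X \<ge> c * (193/2 * (c * c))" using c by (intro mult_left_mono) auto
    then show ?thesis using L nn by (simp add: power3_eq_cube)
  qed
qed

text \<open>The sum of squared degrees reaches that of a star only if all edges pairwise share two
  points. Without a common pair this leaves three or four triples in a 4-set, where the third order
  decides; every other family loses a whole unit at second order.\<close>

lemma pair_star_optimal_small:
  fixes U :: "'a set" and x :: "'a \<Rightarrow> real"
  assumes U: "finite U" "card U = n" "real n \<ge> 10^12" and H: "H \<subseteq> nsets U 3" "card H = s" "s \<le> 2000"
    and x: "\<And>a. a \<in> U \<Longrightarrow> 0 \<le> x a" "sum x U = 1"
    and nopair: "\<And>z v. z \<noteq> v \<Longrightarrow> \<exists>g\<in>H. \<not> {z, v} \<subseteq> g" and ne: "e \<in> H" "f \<in> H" "e \<noteq> f"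
  obtains z v L x' where "z \<in> U" "v \<in> U" "z \<noteq> v" "L \<subseteq> U - {z, v}" "card L = s"
    "\<And>a. a \<in> U \<Longrightarrow> 0 \<le> x' a" "sum x' U = 1"
    "cost U (pair_star z v L) x' \<le> cost U H x"
proof -
  note goal = that
  define c where "c = real n / ((real n)\<^sup>2 - 3 * real s)"
  obtain z v L x' where star: "z \<in> U" "v \<in> U" "z \<noteq> v" "L \<subseteq> U - {z, v}" "card L = s"
    "\<And>a. a \<in> U \<Longrightarrow> 0 \<le> x' a" "sum x' U = 1"
    and le: "cost U (pair_star z v L) x' \<le> n * pot c + (c - c\<^sup>2) * (1 - n * c)
       + c\<^sup>2 * (c * s - c\<^sup>2 * (2 * s\<^sup>2 + s) / (2 * (1 - 2 * c)) + c^3 * (s^3 + 2 * s\<^sup>2 + 1/2))"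
    using small_star[OF U(1,2) H(3) U(3)] unfolding c_def by metis
  have s: "real s \<le> 2000" using H(3) by simp
  have "1000000000000 * real n \<le> real n * real n" using U(3) by (intro mult_right_mono) auto
  moreover have "real n \<ge> 6001" using U(3) by simp
  ultimately have big: "(real n)\<^sup>2 - 3 * real s \<ge> 100000000000 * real n"
    unfolding power2_eq_square using s by linarith
  have c: "0 < c" "c \<le> 1/10^11"
  proof -
    have pos: "0 < (100000000000 * real n)" using U(3) by simp
    then show "0 < c" using big \<open>real n \<ge> 6001\<close> unfolding c_def by (intro divide_pos_pos) linarith+
    have "c \<le> real n / (100000000000 * real n)"
      unfolding c_def using big pos by (intro divide_left_mono mult_pos_pos) auto
    then show "c \<le> 1/10^11" using U(3) by simp
  qed
  define k where "k = 1 - 2 * c"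
  have k: "99/100 \<le> k" "k \<le> 1" using c by (auto simp: k_def)
  define \<rho> where "\<rho> = (\<lambda>a. max 0 (c - x a) / c)"
  have \<rho>: "0 \<le> \<rho> a" "a \<in> U \<Longrightarrow> \<rho> a \<le> 1" for a
    using c x by (auto simp: \<rho>_def field_simps max_def)
  have lower: "n * pot c + (c - c\<^sup>2) * (1 - n * c)
     + c\<^sup>2 * ((1/2 - c) * (\<Sum>a\<in>U. (\<rho> a)\<^sup>2) + c * (\<Sum>e\<in>H. \<Prod>a\<in>e. 1 - \<rho> a)) \<le> cost U H x"
    using small_lower[OF U(1) H(1) x c(1)] c(2) U(2) by (simp add: \<rho>_def)
  have finH: "finite H" using U H by (meson finite_imp_finite_nsets finite_subset)
  have half: "1/2 - c = k / 2" by (simp add: k_def)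
  have "c * s - c\<^sup>2 * (2 * s\<^sup>2 + s) / (2 * k) + c^3 * (s^3 + 2 * s\<^sup>2 + 1/2)
    \<le> (1/2 - c) * (\<Sum>a\<in>U. (\<rho> a)\<^sup>2) + c * (\<Sum>e\<in>H. \<Prod>a\<in>e. 1 - \<rho> a)" (is "?A \<le> ?B")
  proof (cases "\<exists>e\<in>H. \<exists>f\<in>H. e \<noteq> f \<and> card (e \<inter> f) \<le> 1")
    case True
    define d where "d = (\<lambda>a. \<Sum>e\<in>H. of_bool (a \<in> e) :: real)"
    have D2: "(\<Sum>a\<in>U. (d a)\<^sup>2) \<le> 2 * (real s)\<^sup>2 + s - 1"
      using True sum_overlaps_le[OF U(1) H(1)] H(2) by (auto simp: d_def)
    have "(\<Sum>e\<in>H. \<Sum>a\<in>e. \<rho> a) = (\<Sum>e\<in>H. \<Sum>a\<in>U. of_bool (a \<in> e) * \<rho> a)"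
    proof (rule sum.cong)
      fix e assume "e \<in> H"
      then have "e \<subseteq> U" using H by (auto simp: nsets_def)
      then show "(\<Sum>a\<in>e. \<rho> a) = (\<Sum>a\<in>U. of_bool (a \<in> e) * \<rho> a)"
        using U by (intro sum.mono_neutral_cong_left) auto
    qed simp
    also have "\<dots> = (\<Sum>a\<in>U. d a * \<rho> a)" unfolding d_def sum_distrib_right by (rule sum.swap)
    finally have sw: "(\<Sum>e\<in>H. \<Sum>a\<in>e. \<rho> a) = (\<Sum>a\<in>U. d a * \<rho> a)" .
    have "(\<Sum>e\<in>H. 1 - (\<Sum>a\<in>e. \<rho> a)) \<le> (\<Sum>e\<in>H. \<Prod>a\<in>e. 1 - \<rho> a)"
      using H \<rho> by (intro sum_mono Weierstrass_prod_ineq) (auto simp: nsets_def)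
    then have "s - (\<Sum>a\<in>U. d a * \<rho> a) \<le> (\<Sum>e\<in>H. \<Prod>a\<in>e. 1 - \<rho> a)"
      using sw H(2) by (simp add: sum_subtractf)
    then have P: "c * (s - (\<Sum>a\<in>U. d a * \<rho> a)) \<le> c * (\<Sum>e\<in>H. \<Prod>a\<in>e. 1 - \<rho> a)"
      using c by (intro mult_left_mono) auto
    have "(\<Sum>a\<in>U. - ((c * d a)\<^sup>2 / (2 * k))) \<le> (\<Sum>a\<in>U. k / 2 * (\<rho> a)\<^sup>2 - (c * d a) * \<rho> a)"
      using k by (intro sum_mono quadratic_lower) auto
    also have "\<dots> = (1/2 - c) * (\<Sum>a\<in>U. (\<rho> a)\<^sup>2) - c * (\<Sum>a\<in>U. d a * \<rho> a)"
      unfolding half by (simp add: sum_subtractf sum_distrib_left mult.assoc)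
    also have "(\<Sum>a\<in>U. - ((c * d a)\<^sup>2 / (2 * k))) = - (c\<^sup>2 / (2 * k) * (\<Sum>a\<in>U. (d a)\<^sup>2))"
      by (simp add: sum_negf sum_distrib_left power_mult_distrib)
    finally have Q: "- (c\<^sup>2 / (2 * k) * (\<Sum>a\<in>U. (d a)\<^sup>2)) \<le> (1/2 - c) * (\<Sum>a\<in>U. (\<rho> a)\<^sup>2) - c * (\<Sum>a\<in>U. d a * \<rho> a)" .
    have "c\<^sup>2 / (2 * k) * (\<Sum>a\<in>U. (d a)\<^sup>2) \<le> c\<^sup>2 / (2 * k) * (2 * (real s)\<^sup>2 + s - 1)"
      using D2 k by (intro mult_left_mono) auto
    also have "\<dots> = c\<^sup>2 * (2 * s\<^sup>2 + s) / (2 * k) - c\<^sup>2 / (2 * k)"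
      using k by (simp add: field_simps)
    finally have R: "c\<^sup>2 / (2 * k) * (\<Sum>a\<in>U. (d a)\<^sup>2) \<le> c\<^sup>2 * (2 * s\<^sup>2 + s) / (2 * k) - c\<^sup>2 / (2 * k)" .
    \<comment> \<open>Here \<open>s\<close> must be bounded: the third-order terms of the star stay
      below \<open>c^2 / 2\<close>, hence below the unit \<open>c^2 / (2 * k)\<close> saved in the
      squared degrees.\<close>
    have "(real s)^3 + 2 * (real s)\<^sup>2 + 1/2 \<le> 2000^3 + 2 * 2000\<^sup>2 + 1/2"
      using s by (intro add_mono mult_left_mono power_mono) auto
    then have "c * ((real s)^3 + 2 * (real s)\<^sup>2 + 1/2) \<le> (1/10^11) * (2000^3 + 2 * 2000\<^sup>2 + 1/2)"
      using c by (intro mult_mono) auto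
    then have "c * ((real s)^3 + 2 * (real s)\<^sup>2 + 1/2) \<le> 1/2" by simp
    then have "c\<^sup>2 * (c * ((real s)^3 + 2 * (real s)\<^sup>2 + 1/2)) \<le> c\<^sup>2 * (1/2)" by (intro mult_left_mono) auto
    then have S: "c^3 * ((real s)^3 + 2 * (real s)\<^sup>2 + 1/2) \<le> c\<^sup>2 * (1/2)"
      by (simp add: power2_eq_square power3_eq_cube mult.assoc)
    have "c\<^sup>2 * (1/2) \<le> c\<^sup>2 / (2 * k)" using k c by (simp add: field_simps)
    with P Q R S show ?thesis by (simp add: right_diff_distrib)
  next
    case False
    then have two: "2 \<le> card (e \<inter> f)" if "e \<in> H" "f \<in> H" "e \<noteq> f" for e f
      using that by (metis One_nat_def Suc_1 not_less_eq_eq)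
    obtain k1 k2 k3 k4 where K: "distinct [k1, k2, k3, k4]" "{k1, k2, k3, k4} \<subseteq> U"
      "H = {{k1, k2, k3}, {k1, k2, k4}, {k1, k3, k4}} \<or>
       H = insert {k2, k3, k4} {{k1, k2, k3}, {k1, k2, k4}, {k1, k3, k4}}"
    proof (rule pairwise_two_intersecting[OF H(1) _ ne])
      show "2 \<le> card (e \<inter> f)" if "e \<in> H" "f \<in> H" "e \<noteq> f" for e f using that by (rule two)
      show "\<exists>g\<in>H. \<not> {z, v} \<subseteq> g" if "z \<noteq> v" for z v using that by (rule nopair)
    qed (rule that)
    have d: "{k1, k2, k3} \<noteq> {k1, k2, k4}" "{k1, k2, k3} \<noteq> {k1, k3, k4}" "{k1, k2, k4} \<noteq> {k1, k3, k4}"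
      "{k2, k3, k4} \<noteq> {k1, k2, k3}" "{k2, k3, k4} \<noteq> {k1, k2, k4}" "{k2, k3, k4} \<noteq> {k1, k3, k4}"
      using K(1) by (auto simp: set_eq_iff)
    let ?p = "\<lambda>i j l. (1 - \<rho> i) * (1 - \<rho> j) * (1 - \<rho> l)"
    have pr: "(\<Prod>a\<in>{k1, k2, k3}. 1 - \<rho> a) = ?p k1 k2 k3" "(\<Prod>a\<in>{k1, k2, k4}. 1 - \<rho> a) = ?p k1 k2 k4"
      "(\<Prod>a\<in>{k1, k3, k4}. 1 - \<rho> a) = ?p k1 k3 k4" "(\<Prod>a\<in>{k2, k3, k4}. 1 - \<rho> a) = ?p k2 k3 k4"
      using K(1) by auto
    have "(\<Sum>a\<in>{k1, k2, k3, k4}. (\<rho> a)\<^sup>2) \<le> (\<Sum>a\<in>U. (\<rho> a)\<^sup>2)"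
      using K U by (intro sum_mono2) auto
    then have "(\<rho> k1)\<^sup>2 + (\<rho> k2)\<^sup>2 + (\<rho> k3)\<^sup>2 + (\<rho> k4)\<^sup>2 \<le> (\<Sum>a\<in>U. (\<rho> a)\<^sup>2)" using K(1) by simp
    then have sq: "k / 2 * ((\<rho> k1)\<^sup>2 + (\<rho> k2)\<^sup>2 + (\<rho> k3)\<^sup>2 + (\<rho> k4)\<^sup>2) \<le> (1/2 - c) * (\<Sum>a\<in>U. (\<rho> a)\<^sup>2)"
      unfolding half using k by (intro mult_left_mono) auto
    have b: "0 \<le> \<rho> k1" "\<rho> k1 \<le> 1" "0 \<le> \<rho> k2" "\<rho> k2 \<le> 1" "0 \<le> \<rho> k3" "\<rho> k3 \<le> 1" "0 \<le> \<rho> k4" "\<rho> k4 \<le> 1"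
      using \<rho> K(2) by auto
    from K(3) show ?thesis
    proof
      assume h: "H = {{k1, k2, k3}, {k1, k2, k4}, {k1, k3, k4}}"
      have "s = 3" using H(2) d unfolding h by simp
      have "(\<Sum>e\<in>H. \<Prod>a\<in>e. 1 - \<rho> a) = ?p k1 k2 k3 + ?p k1 k2 k4 + ?p k1 k3 k4"
        unfolding h using d pr by (simp del: prod.insert)
      then show ?thesis using tie_three[OF k c b] sq \<open>s = 3\<close> by simp
    next
      assume h: "H = insert {k2, k3, k4} {{k1, k2, k3}, {k1, k2, k4}, {k1, k3, k4}}"
      have "s = 4" using H(2) d unfolding h by simp
      have "(\<Sum>e\<in>H. \<Prod>a\<in>e. 1 - \<rho> a) = ?p k1 k2 k3 + ?p k1 k2 k4 + ?p k1 k3 k4 + ?p k2 k3 k4"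
        unfolding h using d pr by (simp del: prod.insert)
      then show ?thesis using tie_four[OF k c b] sq \<open>s = 4\<close> by simp
    qed
  qed
  then have "c\<^sup>2 * ?A \<le> c\<^sup>2 * ?B" by (intro mult_left_mono) auto
  with le lower have "cost U (pair_star z v L) x' \<le> cost U H x" by (simp add: k_def)
  with star goal show thesis by blast
qed

section \<open>Many non-edges\<close>

text \<open>An edge meeting \<open>Y\<close> in one point is charged to its other two points; an edge avoiding \<open>Y\<close>
  is charged evenly to its three pairs. With charge 2 per edge, distinct edges overlap in charge at
  most 1, up to boundedly many exceptions for every edge.\<close>
definition charge :: "'a set \<Rightarrow> 'a set \<Rightarrow> 'a \<Rightarrow> real" where
  "charge Y e a = (if a \<in> e - Y then if card (e - Y) = 2 then 1 else 2/3 else 0)"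

section \<open>Charges, their overlaps, and lower bounds with exact small weights\<close>

lemma sum_charge_mult:
  assumes "finite U" "e \<subseteq> U"
  shows "(\<Sum>a\<in>U - Y. charge Y e a * r a) = (if card (e - Y) = 2 then 1 else 2/3) * sum r (e - Y)"
proof -
  have "(\<Sum>a\<in>U - Y. charge Y e a * r a) = (\<Sum>a\<in>e - Y. charge Y e a * r a)"
    using assms by (intro sum.mono_neutral_right) (auto simp: charge_def)
  also have "\<dots> = (\<Sum>a\<in>e - Y. (if card (e - Y) = 2 then 1 else 2/3) * r a)"
    by (intro sum.cong) (auto simp: charge_def)
  finally show ?thesis by (simp add: sum_distrib_left)
qed

lemma card_Diff_cases:
  assumes "card e = 3" "2 \<le> card (e - Y)"
  shows "card (e - Y) = 2 \<or> card (e - Y) = 3 \<and> e - Y = e"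
proof -
  have fin: "finite e" using assms card.infinite by force
  have "card (e - Y) \<le> 3" using assms fin card_mono[of e "e - Y"] by auto
  moreover have "e - Y = e" if "card (e - Y) = 3"
    using that assms fin by (intro card_subset_eq) auto
  ultimately show ?thesis using assms by linarith
qed

lemma sum_charge:
  assumes "finite U" "e \<subseteq> U" "card e = 3" "2 \<le> card (e - Y)"
  shows "(\<Sum>a\<in>U - Y. charge Y e a) = 2"
  using sum_charge_mult[of U e Y "\<lambda>_. 1"] card_Diff_cases[of e Y] assms by auto

text \<open>One factor is bounded below by the smallest weight \<open>\<epsilon>\<close>, the two
  charged ones by \<open>c^2 - c * (r a + r b)\<close>, dropping the nonnegative
  \<open>r a * r b\<close>. If the edge avoids \<open>Y\<close>, the bound is averaged over the
  three choices of the uncharged vertex, whence 2/3.\<close>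

lemma edge_charge_lower:
  fixes x :: "'a \<Rightarrow> real"
  assumes e: "card e = 3" "2 \<le> card (e - Y)" and \<epsilon>: "0 \<le> \<epsilon>" "\<And>a. a \<in> e \<Longrightarrow> \<epsilon> \<le> x a" "\<epsilon> \<le> c"
  defines "r \<equiv> \<lambda>a. max 0 (c - x a)"
  shows "\<epsilon> * (c\<^sup>2 - c * ((if card (e - Y) = 2 then 1 else 2/3) * sum r (e - Y))) \<le> prod x e"
proof -
  define y where "y = (\<lambda>a. c - r a)"
  have fin: "finite e" using e card.infinite by force
  have y: "\<epsilon> \<le> y a" "0 \<le> y a" "y a \<le> x a" if "a \<in> e" for a
    using \<epsilon>(1,3) \<epsilon>(2)[OF that] by (auto simp: y_def r_def)
  have r0: "0 \<le> r a" for a by (simp add: r_def)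
  have pair: "c\<^sup>2 - c * (r a + r b) \<le> y a * y b" for a b
    using r0[of a] r0[of b] by (simp add: y_def algebra_simps power2_eq_square)
  have "prod y e \<le> prod x e" using y by (intro prod_mono) auto
  moreover have "\<epsilon> * (c\<^sup>2 - c * ((if card (e - Y) = 2 then 1 else 2/3) * sum r (e - Y))) \<le> prod y e"
    using card_Diff_cases[OF e]
  proof
    assume two: "card (e - Y) = 2"
    then obtain a b where ab: "e - Y = {a, b}" "a \<noteq> b" by (auto simp: card_2_iff)
    have "card (e - {a, b}) = 1" using e fin ab by (subst card_Diff_subset) auto
    then obtain t where t: "e - {a, b} = {t}" by (auto simp: card_1_singleton_iff)
    then have e_eq: "e = {t, a, b}" "t \<noteq> a" "t \<noteq> b" using ab by auto
    have "\<epsilon> * (c\<^sup>2 - c * (r a + r b)) \<le> \<epsilon> * (y a * y b)" using \<epsilon> pair by (intro mult_left_mono)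
    also have "\<dots> \<le> y t * (y a * y b)" using y e_eq by (intro mult_right_mono) auto
    also have "\<dots> = prod y e" using e_eq ab by simp
    finally show ?thesis using two ab by simp
  next
    assume three: "card (e - Y) = 3 \<and> e - Y = e"
    obtain a b d where e_eq: "e = {a, b, d}" "a \<noteq> b" "a \<noteq> d" "b \<noteq> d"
      using e(1) by (auto simp: card_3_iff)
    have P: "\<epsilon> * (c\<^sup>2 - c * (r i + r j)) \<le> y k * (y i * y j)" if "{i, j, k} \<subseteq> e" for i j k
    proof -
      have "\<epsilon> * (c\<^sup>2 - c * (r i + r j)) \<le> \<epsilon> * (y i * y j)" using \<epsilon> pair by (intro mult_left_mono)
      also have "\<dots> \<le> y k * (y i * y j)" using y that by (intro mult_right_mono) auto
      finally show ?thesis .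
    qed
    have "prod y e = y a * (y b * y d)" using e_eq by simp
    then have "\<epsilon> * (c\<^sup>2 - c * (2/3 * (r a + r b + r d))) \<le> prod y e"
    proof -
      have "3 * (\<epsilon> * (c\<^sup>2 - c * (2/3 * (r a + r b + r d))))
        = \<epsilon> * (c\<^sup>2 - c * (r a + r b)) + \<epsilon> * (c\<^sup>2 - c * (r a + r d)) + \<epsilon> * (c\<^sup>2 - c * (r b + r d))"
        by (simp add: algebra_simps)
      moreover have "y d * (y a * y b) = prod y e" "y b * (y a * y d) = prod y e" "y a * (y b * y d) = prod y e"
        using e_eq by simp_all
      ultimately show ?thesis
        using P[of a b d] P[of a d b] P[of b d a] e_eq(1) by simp
    qed
    moreover have "sum r (e - Y) = r a + r b + r d" using three e_eq by simp
    ultimately show ?thesis using three e(1) by simp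
  qed
  ultimately show ?thesis by simp
qed

lemma overlap_charge:
  assumes "finite U" "e \<subseteq> U"
  shows "(\<Sum>a\<in>U - Y. charge Y e a * charge Y f a)
    = (if card (e - Y) = 2 then 1 else 2/3) * ((if card (f - Y) = 2 then 1 else 2/3) * card ((e - Y) \<inter> (f - Y)))"
proof -
  have fin: "finite (e - Y)" using assms finite_subset by blast
  have "sum (charge Y f) (e - Y) = (\<Sum>a\<in>e - Y. if a \<in> f - Y then (if card (f - Y) = 2 then 1 else 2/3) else 0)"
    by (intro sum.cong) (auto simp: charge_def)
  also have "\<dots> = (\<Sum>a\<in>(e - Y) \<inter> (f - Y). (if card (f - Y) = 2 then 1 else 2/3))"
    using fin by (subst sum.inter_restrict) auto
  finally show ?thesis using assms by (simp add: sum_charge_mult)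
qed

text \<open>Two charges overlap in more than 1 only if one trace outside \<open>Y\<close> contains
  the other; \<open>R\<close> allots 1/2 to each containment. The edges whose trace lies in that of
  \<open>e\<close> are triples in \<open>e \<union> Y\<close>, so there are at most
  \<open>5 choose 3 = 10\<close> of them, and both directions together add at most
  \<open>10 * card H\<close>.\<close>

lemma sum_squares_charge:
  assumes U: "finite U" "H \<subseteq> nsets U 3" "card Y \<le> 2" "finite Y"
    and H: "\<And>e. e \<in> H \<Longrightarrow> 2 \<le> card (e - Y)"
  shows "(\<Sum>a\<in>U - Y. (\<Sum>e\<in>H. charge Y e a)\<^sup>2) \<le> (real (card H))\<^sup>2 + 10 * real (card H)"
proof -
  have fin: "finite H" using U by (meson finite_imp_finite_nsets finite_subset)
  have e3: "finite e" "card e = 3" "e \<subseteq> U" if "e \<in> H" for e using that U by (auto simp: nsets_def)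
  define R where "R = (\<lambda>e f. of_bool (f - Y \<subseteq> e - Y) / 2 :: real)"
  have T: "(\<Sum>a\<in>U - Y. charge Y e a * charge Y f a) \<le> 1 + R e f + R f e" if ef: "e \<in> H" "f \<in> H" for e f
  proof -
    define E F where "E = e - Y" and "F = f - Y"
    have R: "R e f = of_bool (F \<subseteq> E) / 2" "R f e = of_bool (E \<subseteq> F) / 2"
      by (simp_all add: R_def E_def F_def)
    have fin: "finite E" "finite F" using e3 ef by (auto simp: E_def F_def)
    have c: "card E = 2 \<or> card E = 3" "card F = 2 \<or> card F = 3"
      using card_Diff_cases[of e Y] card_Diff_cases[of f Y] e3 H ef by (auto simp: E_def F_def)
    define m where "m = card (E \<inter> F)"
    have mE: "m \<le> card E" "m = card E \<Longrightarrow> E \<subseteq> F"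
      using fin card_mono[of E "E \<inter> F"] card_subset_eq[of E "E \<inter> F"] by (auto simp: m_def)
    have mF: "m \<le> card F" "m = card F \<Longrightarrow> F \<subseteq> E"
      using fin card_mono[of F "E \<inter> F"] card_subset_eq[of F "E \<inter> F"] by (auto simp: m_def)
    have "(if card E = 2 then 1 else 2/3) * ((if card F = 2 then 1 else 2/3) * real m)
      \<le> 1 + of_bool (F \<subseteq> E) / 2 + of_bool (E \<subseteq> F) / 2"
    proof -
      consider "card E = 2" "card F = 2" | "card E = 2" "card F = 3" | "card E = 3" "card F = 2"
        | "card E = 3" "card F = 3" using c by blast
      then show ?thesis
      proof cases
        case 1
        then show ?thesis using mE mF by (cases "m = 2") auto
      next
        case 2
        then show ?thesis using mE mF by (cases "m = 2") (auto simp: of_bool_def)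
      next
        case 3
        then show ?thesis using mE mF by (cases "m = 2") (auto simp: of_bool_def)
      next
        case 4
        then show ?thesis using mE mF by (cases "m = 3") auto
      qed
    qed
    then have "(if card E = 2 then 1 else 2/3) * ((if card F = 2 then 1 else 2/3) * real m) \<le> 1 + R e f + R f e"
      by (simp only: R)
    moreover have "(\<Sum>a\<in>U - Y. charge Y e a * charge Y f a)
      = (if card E = 2 then 1 else 2/3) * ((if card F = 2 then 1 else 2/3) * real m)"
      unfolding m_def E_def F_def using U e3 ef by (intro overlap_charge) auto
    ultimately show ?thesis by simp
  qed
  have five: "(\<Sum>f\<in>H. R e f) \<le> 5" if e: "e \<in> H" for e
  proof -
    have "{f \<in> H. f - Y \<subseteq> e - Y} \<subseteq> nsets (e \<union> Y) 3" using e3 by (auto simp: nsets_def)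
    then have "card {f \<in> H. f - Y \<subseteq> e - Y} \<le> card (nsets (e \<union> Y) 3)"
      using e3[OF e] U by (intro card_mono finite_imp_finite_nsets) auto
    also have "\<dots> = card (e \<union> Y) choose 3" by simp
    also have "\<dots> \<le> 5 choose 3"
      using card_Un_le[of e Y] e3[OF e] U by (intro binomial_right_mono) auto
    also have "\<dots> = 10" by (simp add: numeral_eq_Suc)
    finally have "card {f \<in> H. f - Y \<subseteq> e - Y} \<le> 10" .
    moreover have "(\<Sum>f\<in>H. R e f) = card {f \<in> H. f - Y \<subseteq> e - Y} / 2"
      using fin by (simp add: R_def of_bool_def sum.If_cases Int_def flip: sum_divide_distrib)
    ultimately show ?thesis by simp
  qed
  have S: "(\<Sum>e\<in>H. \<Sum>f\<in>H. R e f) \<le> 5 * card H"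
    using sum_mono[of H "\<lambda>e. \<Sum>f\<in>H. R e f" "\<lambda>_. 5"] five by (simp add: mult.commute)
  have "(\<Sum>a\<in>U - Y. (\<Sum>e\<in>H. charge Y e a)\<^sup>2) = (\<Sum>e\<in>H. \<Sum>f\<in>H. \<Sum>a\<in>U - Y. charge Y e a * charge Y f a)"
    by (rule sum_squares_swap)
  also have "\<dots> \<le> (\<Sum>e\<in>H. \<Sum>f\<in>H. 1 + R e f + R f e)" by (intro sum_mono T)
  also have "\<dots> = (real (card H))\<^sup>2 + (\<Sum>e\<in>H. \<Sum>f\<in>H. R e f) + (\<Sum>e\<in>H. \<Sum>f\<in>H. R f e)"
    by (simp add: sum.distrib power2_eq_square)
  also have "(\<Sum>e\<in>H. \<Sum>f\<in>H. R f e) = (\<Sum>e\<in>H. \<Sum>f\<in>H. R e f)" by (rule sum.swap)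
  finally show ?thesis using S by simp
qed

text \<open>Summing the overlaps of \<open>e\<close> with all edges through \<open>z\<close> yields,
  at each vertex charged by \<open>e\<close>, its codegree with \<open>z\<close>: at most
  \<open>2 * D\<close>, and the two orders give \<open>4 * D * card H\<close>. Two edges avoiding
  \<open>z\<close> overlap in \<open>4/9 * card (e \<inter> f)\<close>, which is at most 8/9, or 4/3
  if they are equal. Low codegrees thus push the coefficient of the square below 1.\<close>

lemma sum_squares_charge_singleton:
  assumes U: "finite U" "H \<subseteq> nsets U 3" and z: "z \<in> U"
    and deg: "\<And>a. a \<in> U - {z} \<Longrightarrow> real (card {e \<in> H. z \<in> e \<and> a \<in> e}) \<le> D"
  shows "(\<Sum>a\<in>U - {z}. (\<Sum>e\<in>H. charge {z} e a)\<^sup>2)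
    \<le> 4 * D * card H + 8/9 * (real (card H))\<^sup>2 + 4/9 * real (card H)"
proof -
  let ?Y = "{z}"
  have fin: "finite H" using U by (meson finite_imp_finite_nsets finite_subset)
  have e3: "finite e" "card e = 3" "e \<subseteq> U" if "e \<in> H" for e using that U by (auto simp: nsets_def)
  have e2: "2 \<le> card (e - ?Y)" if "e \<in> H" for e
    using e3[OF that] by (simp add: card_Diff_singleton_if)
  define T where "T = (\<lambda>e f. \<Sum>a\<in>U - ?Y. charge ?Y e a * charge ?Y f a)"
  have T0: "0 \<le> T e f" for e f by (auto simp: T_def charge_def intro!: sum_nonneg)
  have Tsym: "T e f = T f e" for e f by (simp add: T_def mult.commute)
  have T: "T e f \<le> of_bool (z \<in> f) * T e f + of_bool (z \<in> e) * T f e + (8/9 + 4/9 * of_bool (e = f))"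
    if ef: "e \<in> H" "f \<in> H" for e f
  proof (cases "z \<in> e \<or> z \<in> f")
    case True
    have "0 \<le> 8/9 + 4/9 * (of_bool (e = f) :: real)" by simp
    with True show ?thesis using T0[of e f] T0[of f e] Tsym[of e f] by auto
  next
    case False
    then have "e - ?Y = e" "f - ?Y = f" by auto
    then have "T e f = 4/9 * card (e \<inter> f)"
      using overlap_charge[of U e ?Y f] U e3 ef by (simp add: T_def)
    moreover have "card (e \<inter> f) \<le> 2" if "e \<noteq> f"
    proof -
      have "e \<inter> f \<subset> e" using e3[OF ef(1)] e3[OF ef(2)] that
        by (metis card_subset_eq inf.cobounded1 inf.cobounded2 psubsetI)
      then have "card (e \<inter> f) < 3" using e3[OF ef(1)] psubset_card_mono by metis
      then show ?thesis by simp
    qed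
    ultimately show ?thesis using e3[OF ef(1)] False by (cases "e = f") auto
  qed
  have half: "(\<Sum>f\<in>H. of_bool (z \<in> f) * T e f) \<le> 2 * D" if e: "e \<in> H" for e
  proof -
    have "(\<Sum>f\<in>H. of_bool (z \<in> f) * T e f)
        = (\<Sum>f\<in>H. \<Sum>a\<in>U - ?Y. charge ?Y e a * of_bool (z \<in> f \<and> a \<in> f))"
      unfolding T_def sum_distrib_left
    proof (intro sum.cong refl)
      fix f a assume f: "f \<in> H" and a: "a \<in> U - ?Y"
      have "card (f - ?Y) = 2" if "z \<in> f" using that e3[OF f] by simp
      then show "of_bool (z \<in> f) * (charge ?Y e a * charge ?Y f a) = charge ?Y e a * of_bool (z \<in> f \<and> a \<in> f)"
        using a by (auto simp: charge_def)
    qed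
    also have "\<dots> = (\<Sum>a\<in>U - ?Y. \<Sum>f\<in>H. charge ?Y e a * of_bool (z \<in> f \<and> a \<in> f))"
      by (rule sum.swap)
    also have "\<dots> = (\<Sum>a\<in>U - ?Y. charge ?Y e a * card {f \<in> H. z \<in> f \<and> a \<in> f})"
      using fin by (simp add: of_bool_def sum.If_cases Int_def flip: sum_distrib_left)
    also have "\<dots> \<le> (\<Sum>a\<in>U - ?Y. charge ?Y e a * D)"
      using deg by (intro sum_mono mult_left_mono) (auto simp: charge_def)
    also have "\<dots> = 2 * D" using sum_charge[of U e ?Y] U e3 e2 e by (simp flip: sum_distrib_right)
    finally show ?thesis .
  qed
  have S: "(\<Sum>e\<in>H. \<Sum>f\<in>H. of_bool (z \<in> f) * T e f) \<le> 2 * D * card H"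
    using sum_mono[of H "\<lambda>e. \<Sum>f\<in>H. of_bool (z \<in> f) * T e f" "\<lambda>_. 2 * D"] half by (simp add: mult.commute)
  have S': "(\<Sum>e\<in>H. \<Sum>f\<in>H. of_bool (z \<in> e) * T f e) = (\<Sum>e\<in>H. \<Sum>f\<in>H. of_bool (z \<in> f) * T e f)"
    by (rule sum.swap)
  have diag: "(\<Sum>e\<in>H. \<Sum>f\<in>H. 8/9 + 4/9 * of_bool (e = f)) = 8/9 * (real (card H))\<^sup>2 + 4/9 * real (card H)"
  proof -
    have "(\<Sum>f\<in>H. 8/9 + 4/9 * of_bool (e = f)) = 8/9 * card H + (4/9 :: real)" if "e \<in> H" for e
    proof -
      have "(\<Sum>f\<in>H. of_bool (e = f)) = (1::real)" using fin that by (simp add: of_bool_def)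
      moreover have "(\<Sum>f\<in>H. 8/9 + 4/9 * of_bool (e = f)) = 8/9 * card H + 4/9 * (\<Sum>f\<in>H. of_bool (e = f) :: real)"
        by (simp only: sum.distrib sum_distrib_left) simp
      ultimately show ?thesis by simp
    qed
    then show ?thesis by (simp add: power2_eq_square algebra_simps)
  qed
  have "(\<Sum>a\<in>U - ?Y. (\<Sum>e\<in>H. charge ?Y e a)\<^sup>2) = (\<Sum>e\<in>H. \<Sum>f\<in>H. T e f)"
    unfolding T_def by (rule sum_squares_swap)
  also have "\<dots> \<le> (\<Sum>e\<in>H. \<Sum>f\<in>H. of_bool (z \<in> f) * T e f + of_bool (z \<in> e) * T f e + (8/9 + 4/9 * of_bool (e = f)))"
    by (intro sum_mono T)
  also have "\<dots> = (\<Sum>e\<in>H. \<Sum>f\<in>H. of_bool (z \<in> f) * T e f) + (\<Sum>e\<in>H. \<Sum>f\<in>H. of_bool (z \<in> e) * T f e)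
      + (\<Sum>e\<in>H. \<Sum>f\<in>H. 8/9 + 4/9 * of_bool (e = f))"
    by (simp only: sum.distrib)
  finally show ?thesis using S S' diag by simp
qed

text \<open>The lightest vertex \<open>z\<close> keeps its weight, and for some \<open>v\<close> the edges through \<open>{z, v}\<close>
  are separated from the \<open>q\<close> others. Minimising the remaining quadratic over the deviations
  from \<open>c\<close> gives the bound.\<close>
lemma cost_lower_split:
  fixes U :: "'a set" and x :: "'a \<Rightarrow> real" and c :: real
  assumes U: "finite U" and H: "H \<subseteq> nsets U 3"
    and x: "\<And>a. a \<in> U \<Longrightarrow> 0 \<le> x a" "sum x U = 1"
    and z: "z \<in> U" "\<And>a. a \<in> U \<Longrightarrow> x z \<le> x a" and v: "v \<in> U" "v \<noteq> z"
    and c: "x z \<le> c" "0 < c" "c \<le> 1/4"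
  defines "q \<equiv> real (card {e \<in> H. \<not> {z, v} \<subseteq> e})" and "d \<equiv> real (card {e \<in> H. {z, v} \<subseteq> e})"
    and "\<epsilon> \<equiv> x z" and "y \<equiv> min (x v) c"
  shows "pot \<epsilon> + pot (x v) + (real (card U) - 2) * pot c + (c - c\<^sup>2) * (1 - \<epsilon> - x v - (real (card U) - 2) * c)
     + \<epsilon> * y * d * c + \<epsilon> * q * c\<^sup>2
     - \<epsilon>\<^sup>2 / (2 * (1 - 2 * c)) * (c\<^sup>2 * (q\<^sup>2 + 10 * q) + 4 * q * c * y + y\<^sup>2 * d) \<le> cost U H x"
proof -
  let ?Y = "{z, v}"
  let ?H1 = "{e \<in> H. ?Y \<subseteq> e}" and ?H2 = "{e \<in> H. \<not> ?Y \<subseteq> e}"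
  define r where "r = (\<lambda>a. max 0 (c - x a))"
  define k where "k = 1 - 2 * c"
  have k: "0 < k" using c by (simp add: k_def)
  have fin: "finite H" using U H by (meson finite_imp_finite_nsets finite_subset)
  have e3: "finite e" "card e = 3" "e \<subseteq> U" if "e \<in> H" for e using that H by (auto simp: nsets_def)
  have x1: "x a \<le> 1" if "a \<in> U" for a
    using member_le_sum[of a U x] that x U by auto
  have eps: "0 \<le> \<epsilon>" using x z by (simp add: \<epsilon>_def)
  have y: "0 \<le> y" "y \<le> x v" using x v c by (auto simp: y_def)
  obtain L where L: "L \<subseteq> U - ?Y" "card L = card ?H1" "?H1 = pair_star z v L"
    by (rule pair_star_of_common_pair[of ?H1 U z v]) (use U H v in auto)
  define \<delta> where "\<delta> = (\<lambda>a. \<Sum>e\<in>?H2. charge ?Y e a)"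
  have cardUY: "real (card (U - ?Y)) = real (card U) - 2"
  proof -
    have "card ?Y \<le> card U" using U z v by (intro card_mono) auto
    then show ?thesis using U z v by (simp add: card_Diff_subset of_nat_diff)
  qed
  have sum_split: "sum g U = g z + g v + sum g (U - ?Y)" for g :: "'a \<Rightarrow> real"
    using U z v sum.remove[of U z g] sum.remove[of "U - {z}" v g]
    by (simp add: Diff_insert2[symmetric] insert_commute)
  have pots: "(\<Sum>a\<in>U - ?Y. pot (x a)) \<ge> (real (card U) - 2) * pot c
      + (c - c\<^sup>2) * (1 - \<epsilon> - x v - (real (card U) - 2) * c) + (\<Sum>a\<in>U - ?Y. k / 2 * (r a)\<^sup>2)"
  proof -
    have "sum x (U - ?Y) = 1 - \<epsilon> - x v" using sum_split[of x] x by (simp add: \<epsilon>_def)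
    moreover have "(1/2 - c) * (\<Sum>a\<in>U - ?Y. (max 0 (c - x a))\<^sup>2) = (\<Sum>a\<in>U - ?Y. k / 2 * (r a)\<^sup>2)"
      unfolding sum_distrib_left by (simp add: k_def r_def field_simps)
    ultimately show ?thesis
      using sum_pot_lower[of "U - ?Y" x c] x1 c cardUY by simp
  qed
  have H1: "\<epsilon> * y * (d * c - (\<Sum>a\<in>U - ?Y. of_bool (a \<in> L) * r a)) \<le> (\<Sum>e\<in>?H1. prod x e)"
  proof -
    have d: "d = card L" using L(2) by (simp add: d_def)
    have s: "(\<Sum>e\<in>?H1. prod x e) = \<epsilon> * x v * sum x L"
      unfolding L(3) \<epsilon>_def using v L(1) by (intro sum_pair_star) auto
    have "d * c - (\<Sum>a\<in>U - ?Y. of_bool (a \<in> L) * r a) = d * c - sum r L"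
    proof -
      have "(\<Sum>a\<in>U - ?Y. of_bool (a \<in> L) * r a) = sum r L"
        using U L(1) by (intro sum.mono_neutral_cong_right) auto
      then show ?thesis by simp
    qed
    also have "\<dots> = (\<Sum>a\<in>L. c - r a)" using d by (simp add: sum_subtractf)
    also have "\<epsilon> * y * (\<Sum>a\<in>L. c - r a) \<le> \<epsilon> * x v * (\<Sum>a\<in>L. x a)"
      using eps y x v c L(1) by (intro mult_mono sum_mono sum_nonneg mult_nonneg_nonneg)
        (auto simp: r_def)
    finally show ?thesis using s by simp
  qed
  have two: "2 \<le> card (e - ?Y)" if "e \<in> ?H2" for e
  proof -
    have "\<not> z \<in> e \<or> \<not> v \<in> e" using that by auto
    then have "e - ?Y = e - {v} \<or> e - ?Y = e - {z}" by auto
    then show ?thesis using e3[of e] that by (auto simp: card_Diff_singleton_if)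
  qed
  have H2: "\<epsilon> * (q * c\<^sup>2 - c * (\<Sum>a\<in>U - ?Y. \<delta> a * r a)) \<le> (\<Sum>e\<in>?H2. prod x e)"
  proof -
    have "(\<Sum>e\<in>?H2. \<epsilon> * (c\<^sup>2 - c * (\<Sum>a\<in>U - ?Y. charge ?Y e a * r a))) \<le> (\<Sum>e\<in>?H2. prod x e)"
    proof (rule sum_mono)
      fix e assume e: "e \<in> ?H2"
      then have "\<And>a. a \<in> e \<Longrightarrow> \<epsilon> \<le> x a" using z e3[of e] by (auto simp: \<epsilon>_def)
      then show "\<epsilon> * (c\<^sup>2 - c * (\<Sum>a\<in>U - ?Y. charge ?Y e a * r a)) \<le> prod x e"
        using edge_charge_lower[of e ?Y \<epsilon> x c] e e3[of e] two[OF e] eps c U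
        by (simp add: sum_charge_mult r_def \<epsilon>_def)
    qed
    also have "(\<Sum>e\<in>?H2. \<epsilon> * (c\<^sup>2 - c * (\<Sum>a\<in>U - ?Y. charge ?Y e a * r a)))
       = \<epsilon> * (q * c\<^sup>2 - c * (\<Sum>e\<in>?H2. \<Sum>a\<in>U - ?Y. charge ?Y e a * r a))"
      by (simp add: sum_subtractf q_def flip: sum_distrib_left)
    also have "(\<Sum>e\<in>?H2. \<Sum>a\<in>U - ?Y. charge ?Y e a * r a) = (\<Sum>a\<in>U - ?Y. \<delta> a * r a)"
      unfolding \<delta>_def sum_distrib_right by (rule sum.swap)
    finally show ?thesis .
  qed
  have cardH2: "real (card ?H2) = q" by (simp add: q_def)
  have \<delta>2: "(\<Sum>a\<in>U - ?Y. (\<delta> a)\<^sup>2) \<le> q\<^sup>2 + 10 * q"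
    unfolding \<delta>_def q_def using U H two v by (intro sum_squares_charge) auto
  have \<delta>0: "0 \<le> \<delta> a" for a by (auto simp: \<delta>_def charge_def intro!: sum_nonneg)
  have \<delta>1: "(\<Sum>a\<in>U - ?Y. \<delta> a) = 2 * q"
  proof -
    have "(\<Sum>a\<in>U - ?Y. \<delta> a) = (\<Sum>e\<in>?H2. \<Sum>a\<in>U - ?Y. charge ?Y e a)"
      unfolding \<delta>_def by (rule sum.swap)
    also have "\<dots> = (\<Sum>e\<in>?H2. 2)" using two e3 U by (intro sum.cong refl sum_charge) auto
    finally show ?thesis by (simp add: q_def)
  qed
  have cardL: "(\<Sum>a\<in>U - ?Y. of_bool (a \<in> L)) = d"
  proof -
    have "(\<Sum>a\<in>U - ?Y. of_bool (a \<in> L)) = (\<Sum>a\<in>L. 1::real)"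
      using U L(1) by (intro sum.mono_neutral_cong_right) auto
    then show ?thesis using L(2) by (simp add: d_def)
  qed
  \<comment> \<open>The saving in non-edge weight per unit of deviation at \<open>a\<close>, from
    the charges and, at a leaf, from the edge through \<open>z\<close> and \<open>v\<close>.\<close>
  define g where "g = (\<lambda>a. \<epsilon> * (c * \<delta> a + y * of_bool (a \<in> L)))"
  \<comment> \<open>In the cross term the indicator of \<open>L\<close> is bounded by 1, so the
    total charge \<open>2 * q\<close> controls it wherever the charges lie.\<close>
  have "(\<Sum>a\<in>U - ?Y. (c * \<delta> a + y * of_bool (a \<in> L))\<^sup>2)
      \<le> (\<Sum>a\<in>U - ?Y. c\<^sup>2 * (\<delta> a)\<^sup>2 + 2 * c * y * \<delta> a + y\<^sup>2 * of_bool (a \<in> L))"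
    using \<delta>0 c y by (intro sum_mono) (auto simp: power2_eq_square algebra_simps)
  also have "\<dots> = c\<^sup>2 * (\<Sum>a\<in>U - ?Y. (\<delta> a)\<^sup>2) + 2 * c * y * (\<Sum>a\<in>U - ?Y. \<delta> a) + y\<^sup>2 * (\<Sum>a\<in>U - ?Y. of_bool (a \<in> L))"
    by (simp only: sum.distrib sum_distrib_left)
  also have "\<dots> \<le> c\<^sup>2 * (q\<^sup>2 + 10 * q) + 4 * q * c * y + y\<^sup>2 * d"
    using \<delta>2 unfolding \<delta>1 cardL by (simp add: mult_left_mono)
  finally have sq: "(\<Sum>a\<in>U - ?Y. (c * \<delta> a + y * of_bool (a \<in> L))\<^sup>2) \<le> c\<^sup>2 * (q\<^sup>2 + 10 * q) + 4 * q * c * y + y\<^sup>2 * d" .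
  have "- (\<epsilon>\<^sup>2 / (2 * k) * (c\<^sup>2 * (q\<^sup>2 + 10 * q) + 4 * q * c * y + y\<^sup>2 * d))
     \<le> - (\<epsilon>\<^sup>2 / (2 * k) * (\<Sum>a\<in>U - ?Y. (c * \<delta> a + y * of_bool (a \<in> L))\<^sup>2))"
    using sq k by (intro le_imp_neg_le mult_left_mono) auto
  also have "\<dots> = (\<Sum>a\<in>U - ?Y. - ((g a)\<^sup>2 / (2 * k)))"
    by (simp add: g_def sum_negf sum_distrib_left power_mult_distrib)
  also have "\<dots> \<le> (\<Sum>a\<in>U - ?Y. k / 2 * (r a)\<^sup>2 - g a * r a)"
    using k by (intro sum_mono quadratic_lower)
  also have "\<dots> = (\<Sum>a\<in>U - ?Y. k / 2 * (r a)\<^sup>2) - (\<Sum>a\<in>U - ?Y. \<epsilon> * c * (\<delta> a * r a) + \<epsilon> * y * (of_bool (a \<in> L) * r a))"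
    by (simp only: sum_subtractf g_def) (simp add: algebra_simps)
  also have "(\<Sum>a\<in>U - ?Y. \<epsilon> * c * (\<delta> a * r a) + \<epsilon> * y * (of_bool (a \<in> L) * r a))
      = \<epsilon> * c * (\<Sum>a\<in>U - ?Y. \<delta> a * r a) + \<epsilon> * y * (\<Sum>a\<in>U - ?Y. of_bool (a \<in> L) * r a)"
    by (simp only: sum.distrib sum_distrib_left)
  finally have main: "- (\<epsilon>\<^sup>2 / (2 * k) * (c\<^sup>2 * (q\<^sup>2 + 10 * q) + 4 * q * c * y + y\<^sup>2 * d))
    \<le> (\<Sum>a\<in>U - ?Y. k / 2 * (r a)\<^sup>2)
       - (\<epsilon> * c * (\<Sum>a\<in>U - ?Y. \<delta> a * r a) + \<epsilon> * y * (\<Sum>a\<in>U - ?Y. of_bool (a \<in> L) * r a))" .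
  have "sum (prod x) (?H1 \<union> ?H2) = (\<Sum>e\<in>?H1. prod x e) + (\<Sum>e\<in>?H2. prod x e)"
    using fin by (intro sum.union_disjoint) auto
  moreover have "?H1 \<union> ?H2 = H" by auto
  ultimately have "(\<Sum>e\<in>H. prod x e) = (\<Sum>e\<in>?H1. prod x e) + (\<Sum>e\<in>?H2. prod x e)" by simp
  then have "cost U H x = pot \<epsilon> + pot (x v) + (\<Sum>a\<in>U - ?Y. pot (x a))
     + ((\<Sum>e\<in>?H1. prod x e) + (\<Sum>e\<in>?H2. prod x e))"
    by (simp add: cost_def sum_split \<epsilon>_def)
  moreover have "\<epsilon> * y * (d * c - (\<Sum>a\<in>U - ?Y. of_bool (a \<in> L) * r a))
      = \<epsilon> * y * d * c - \<epsilon> * y * (\<Sum>a\<in>U - ?Y. of_bool (a \<in> L) * r a)"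
    "\<epsilon> * (q * c\<^sup>2 - c * (\<Sum>a\<in>U - ?Y. \<delta> a * r a)) = \<epsilon> * q * c\<^sup>2 - \<epsilon> * c * (\<Sum>a\<in>U - ?Y. \<delta> a * r a)"
    by (simp_all add: algebra_simps)
  ultimately show ?thesis using pots H1 H2 main unfolding k_def[symmetric] by linarith
qed

text \<open>Counterpart of \<open>cost_lower_split\<close> for the case that no vertex has large
  codegree with \<open>z\<close>: only \<open>z\<close> keeps its weight, and the gain comes from
  the 8/9 for edges avoiding \<open>z\<close>.\<close>

lemma cost_lower_singleton:
  fixes U :: "'a set" and x :: "'a \<Rightarrow> real" and c :: real
  assumes U: "finite U" and H: "H \<subseteq> nsets U 3"
    and x: "\<And>a. a \<in> U \<Longrightarrow> 0 \<le> x a" "sum x U = 1"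
    and z: "z \<in> U" "\<And>a. a \<in> U \<Longrightarrow> x z \<le> x a"
    and deg: "\<And>a. a \<in> U - {z} \<Longrightarrow> real (card {e \<in> H. z \<in> e \<and> a \<in> e}) \<le> D"
    and c: "x z \<le> c" "0 < c" "c \<le> 1/4"
  defines "s \<equiv> real (card H)" and "\<epsilon> \<equiv> x z"
  shows "pot \<epsilon> + (real (card U) - 1) * pot c + (c - c\<^sup>2) * (1 - \<epsilon> - (real (card U) - 1) * c)
     + c\<^sup>2 * (\<epsilon> * s - \<epsilon>\<^sup>2 / (2 * (1 - 2 * c)) * (4 * D * s + 8/9 * s\<^sup>2 + 4/9 * s)) \<le> cost U H x"
proof -
  let ?Y = "{z}"
  define r where "r = (\<lambda>a. max 0 (c - x a))"
  define k where "k = 1 - 2 * c"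
  have k: "0 < k" using c by (simp add: k_def)
  have e3: "finite e" "card e = 3" "e \<subseteq> U" if "e \<in> H" for e using that H by (auto simp: nsets_def)
  have x1: "x a \<le> 1" if "a \<in> U" for a
    using member_le_sum[of a U x] that x U by auto
  have eps: "0 \<le> \<epsilon>" using x z by (simp add: \<epsilon>_def)
  define \<delta> where "\<delta> = (\<lambda>a. \<Sum>e\<in>H. charge ?Y e a)"
  have "0 < card U" using U z card_gt_0_iff by blast
  then have cardUY: "real (card (U - ?Y)) = real (card U) - 1"
    using U z by (simp add: of_nat_diff)
  have sum_split: "sum g U = g z + sum g (U - ?Y)" for g :: "'a \<Rightarrow> real"
    using U z(1) by (rule sum.remove)
  have pots: "(\<Sum>a\<in>U - ?Y. pot (x a)) \<ge> (real (card U) - 1) * pot c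
      + (c - c\<^sup>2) * (1 - \<epsilon> - (real (card U) - 1) * c) + (\<Sum>a\<in>U - ?Y. k / 2 * (r a)\<^sup>2)"
  proof -
    have "sum x (U - ?Y) = 1 - \<epsilon>" using sum_split[of x] x by (simp add: \<epsilon>_def)
    moreover have "(1/2 - c) * (\<Sum>a\<in>U - ?Y. (max 0 (c - x a))\<^sup>2) = (\<Sum>a\<in>U - ?Y. k / 2 * (r a)\<^sup>2)"
      unfolding sum_distrib_left by (simp add: k_def r_def field_simps)
    ultimately show ?thesis
      using sum_pot_lower[of "U - ?Y" x c] x1 c cardUY by simp
  qed
  have two: "2 \<le> card (e - ?Y)" if "e \<in> H" for e
    using e3[OF that] by (simp add: card_Diff_singleton_if)
  have H2: "\<epsilon> * (s * c\<^sup>2 - c * (\<Sum>a\<in>U - ?Y. \<delta> a * r a)) \<le> (\<Sum>e\<in>H. prod x e)"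
  proof -
    have "(\<Sum>e\<in>H. \<epsilon> * (c\<^sup>2 - c * (\<Sum>a\<in>U - ?Y. charge ?Y e a * r a))) \<le> (\<Sum>e\<in>H. prod x e)"
    proof (rule sum_mono)
      fix e assume e: "e \<in> H"
      then have "\<And>a. a \<in> e \<Longrightarrow> \<epsilon> \<le> x a" using z e3[of e] by (auto simp: \<epsilon>_def)
      then show "\<epsilon> * (c\<^sup>2 - c * (\<Sum>a\<in>U - ?Y. charge ?Y e a * r a)) \<le> prod x e"
        using edge_charge_lower[of e ?Y \<epsilon> x c] e e3[of e] two[OF e] eps c U
        by (simp add: sum_charge_mult r_def \<epsilon>_def)
    qed
    also have "(\<Sum>e\<in>H. \<epsilon> * (c\<^sup>2 - c * (\<Sum>a\<in>U - ?Y. charge ?Y e a * r a)))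
       = \<epsilon> * (s * c\<^sup>2 - c * (\<Sum>e\<in>H. \<Sum>a\<in>U - ?Y. charge ?Y e a * r a))"
      by (simp add: sum_subtractf s_def flip: sum_distrib_left)
    also have "(\<Sum>e\<in>H. \<Sum>a\<in>U - ?Y. charge ?Y e a * r a) = (\<Sum>a\<in>U - ?Y. \<delta> a * r a)"
      unfolding \<delta>_def sum_distrib_right by (rule sum.swap)
    finally show ?thesis .
  qed
  have \<delta>2: "(\<Sum>a\<in>U - ?Y. (\<delta> a)\<^sup>2) \<le> 4 * D * s + 8/9 * s\<^sup>2 + 4/9 * s"
    unfolding \<delta>_def s_def using U H z(1) deg by (rule sum_squares_charge_singleton)
  have "- (\<epsilon>\<^sup>2 * c\<^sup>2 / (2 * k) * (4 * D * s + 8/9 * s\<^sup>2 + 4/9 * s)) \<le> - (\<epsilon>\<^sup>2 * c\<^sup>2 / (2 * k) * (\<Sum>a\<in>U - ?Y. (\<delta> a)\<^sup>2))"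
    using \<delta>2 k by (intro le_imp_neg_le mult_left_mono) auto
  also have "\<dots> = (\<Sum>a\<in>U - ?Y. - ((\<epsilon> * c * \<delta> a)\<^sup>2 / (2 * k)))"
    by (simp add: sum_negf sum_distrib_left power_mult_distrib)
  also have "\<dots> \<le> (\<Sum>a\<in>U - ?Y. k / 2 * (r a)\<^sup>2 - (\<epsilon> * c * \<delta> a) * r a)"
    using k by (intro sum_mono quadratic_lower)
  also have "\<dots> = (\<Sum>a\<in>U - ?Y. k / 2 * (r a)\<^sup>2) - \<epsilon> * c * (\<Sum>a\<in>U - ?Y. \<delta> a * r a)"
    by (simp only: sum_subtractf sum_distrib_left mult.assoc)
  finally have main: "- (\<epsilon>\<^sup>2 * c\<^sup>2 / (2 * k) * (4 * D * s + 8/9 * s\<^sup>2 + 4/9 * s))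
     \<le> (\<Sum>a\<in>U - ?Y. k / 2 * (r a)\<^sup>2) - \<epsilon> * c * (\<Sum>a\<in>U - ?Y. \<delta> a * r a)" .
  have "cost U H x = pot \<epsilon> + (\<Sum>a\<in>U - ?Y. pot (x a)) + (\<Sum>e\<in>H. prod x e)"
    by (simp add: cost_def sum_split \<epsilon>_def)
  moreover have "\<epsilon> * (s * c\<^sup>2 - c * (\<Sum>a\<in>U - ?Y. \<delta> a * r a)) = \<epsilon> * s * c\<^sup>2 - \<epsilon> * c * (\<Sum>a\<in>U - ?Y. \<delta> a * r a)"
    by (simp add: algebra_simps)
  moreover have "c\<^sup>2 * (\<epsilon> * s - \<epsilon>\<^sup>2 / (2 * k) * (4 * D * s + 8/9 * s\<^sup>2 + 4/9 * s))
    = \<epsilon> * s * c\<^sup>2 - \<epsilon>\<^sup>2 * c\<^sup>2 / (2 * k) * (4 * D * s + 8/9 * s\<^sup>2 + 4/9 * s)"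
    by (simp add: algebra_simps)
  ultimately show ?thesis using pots H2 main unfolding k_def[symmetric] by linarith
qed

text \<open>The star whose vertex \<open>v\<close> keeps its weight \<open>y\<close>, with weight \<open>c - \<epsilon> y\<close> at the leaves and \<open>c\<close>
  elsewhere, beats the bound of \<open>cost_lower_split\<close>.\<close>
lemma keep_weight_real:
  fixes c \<epsilon> y q d s :: real
  assumes c: "0 < c" "c \<le> 1/10000" "c * s \<le> 1" and e: "0 \<le> \<epsilon>" "\<epsilon> \<le> 1"
    and y: "0 \<le> y" "y \<le> c * (1 - 501/1000 * \<epsilon> * (q + 17))"
    and q: "1 \<le> q" "0 \<le> d" "d + q = s"
  shows "s * ((1/2 - c) * (\<epsilon> * y)\<^sup>2 + (\<epsilon> * y)^3 / 3) + \<epsilon> * y * s * c - s * (\<epsilon> * y)\<^sup>2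
    \<le> \<epsilon> * y * d * c + \<epsilon> * q * c\<^sup>2 - \<epsilon>\<^sup>2 / (2 * (1 - 2 * c)) * (c\<^sup>2 * (q\<^sup>2 + 10 * q) + 4 * q * c * y + y\<^sup>2 * d)"
proof -
  define K where "K = 1 / (2 * (1 - 2 * c))"
  have K: "0 \<le> K" "K \<le> 501/1000" "K \<le> 1/2 + 101/100 * c"
    using c unfolding K_def by (auto simp: field_simps)
  have yc: "y \<le> c"
  proof -
    have "c * (1 - 501/1000 * \<epsilon> * (q + 17)) \<le> c * 1" using c e q by (intro mult_left_mono) auto
    then show ?thesis using y by simp
  qed
  have s0: "0 \<le> s" "q \<le> s" using q by auto
  \<comment> \<open>This gap between \<open>y\<close> and \<open>c\<close> pays for the
    \<open>q\<close> edges off the pair: \<open>q^2 + 10 * q\<close> from their overlaps,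
    \<open>4 * q\<close> from the cross term, and \<open>3 * q\<close> in reserve for the leaves,
    hence 17.\<close>
  have t1: "c * y \<le> c\<^sup>2 - 501/1000 * \<epsilon> * (q + 17) * c\<^sup>2"
    using mult_left_mono[OF y(2), of c] c by (simp add: power2_eq_square algebra_simps)
  have t1': "\<epsilon> * q * (c * y) \<le> \<epsilon> * q * (c\<^sup>2 - 501/1000 * \<epsilon> * (q + 17) * c\<^sup>2)"
    using t1 e q by (intro mult_left_mono) auto
  have "c\<^sup>2 * (q\<^sup>2 + 10 * q) + 4 * q * c * y \<le> c\<^sup>2 * (q\<^sup>2 + 14 * q)"
  proof -
    have "4 * q * c * y \<le> 4 * q * c * c" using yc q c by (intro mult_left_mono) auto
    then show ?thesis by (simp add: power2_eq_square algebra_simps)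
  qed
  then have "K * (c\<^sup>2 * (q\<^sup>2 + 10 * q) + 4 * q * c * y) \<le> 501/1000 * (c\<^sup>2 * (q\<^sup>2 + 14 * q))"
    using K c q y by (intro mult_mono) auto
  then have t2: "\<epsilon>\<^sup>2 * (K * (c\<^sup>2 * (q\<^sup>2 + 10 * q) + 4 * q * c * y)) \<le> \<epsilon>\<^sup>2 * (501/1000 * (c\<^sup>2 * (q\<^sup>2 + 14 * q)))"
    by (intro mult_left_mono) auto
  have y2: "y\<^sup>2 \<le> c\<^sup>2" using y yc by (intro power_mono) auto
  have "K * d \<le> (1/2 + 101/100 * c) * s" using K q c by (intro mult_mono) auto
  also have "\<dots> \<le> s / 2 + 101/100" using c by (simp add: algebra_simps)
  finally have "y\<^sup>2 * (K * d - s / 2) \<le> y\<^sup>2 * (101/100)" by (intro mult_left_mono) auto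
  also have "\<dots> \<le> c\<^sup>2 * (101/100)" using y2 by simp
  also have "\<dots> \<le> c\<^sup>2 * (101/100 * q)" using q by (intro mult_left_mono) auto
  finally have t3: "\<epsilon>\<^sup>2 * (y\<^sup>2 * (K * d - s / 2)) \<le> \<epsilon>\<^sup>2 * (c\<^sup>2 * (101/100 * q))"
    by (intro mult_left_mono) auto
  have t4: "s * ((\<epsilon> * y)^3 / 3) \<le> s * (c * (\<epsilon> * y)\<^sup>2)"
  proof -
    have "\<epsilon> * y \<le> 1 * c" using e y yc by (intro mult_mono) auto
    then have "(\<epsilon> * y) * (\<epsilon> * y)\<^sup>2 \<le> c * (\<epsilon> * y)\<^sup>2" by (intro mult_right_mono) auto
    moreover have "0 \<le> c * (\<epsilon> * y)\<^sup>2" using c by simp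
    ultimately have "(\<epsilon> * y)^3 / 3 \<le> c * (\<epsilon> * y)\<^sup>2" by (simp add: power3_eq_cube power2_eq_square)
    then show ?thesis using s0 by (intro mult_left_mono)
  qed
  have t5: "0 \<le> \<epsilon>\<^sup>2 * (c\<^sup>2 * (149/100 * q))" using q by simp
  have "s * ((1/2 - c) * (\<epsilon> * y)\<^sup>2 + (\<epsilon> * y)^3 / 3) + \<epsilon> * y * s * c - s * (\<epsilon> * y)\<^sup>2
     \<le> \<epsilon> * y * s * c - \<epsilon>\<^sup>2 * (y\<^sup>2 * (s / 2))"
    using t4 by (simp add: algebra_simps power_mult_distrib)
  also have "\<dots> = \<epsilon> * y * d * c + \<epsilon> * q * (c * y) - \<epsilon>\<^sup>2 * (y\<^sup>2 * (s / 2))"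
    using q(3) by (simp add: algebra_simps flip: q(3))
  also have "\<dots> \<le> \<epsilon> * y * d * c + \<epsilon> * q * (c\<^sup>2 - 501/1000 * \<epsilon> * (q + 17) * c\<^sup>2) - \<epsilon>\<^sup>2 * (y\<^sup>2 * (s / 2))"
    using t1' by simp
  also have "\<dots> = \<epsilon> * y * d * c + \<epsilon> * q * c\<^sup>2 - \<epsilon>\<^sup>2 * (501/1000 * (c\<^sup>2 * (q\<^sup>2 + 14 * q)))
      - \<epsilon>\<^sup>2 * (c\<^sup>2 * (1503/1000 * q)) - \<epsilon>\<^sup>2 * (y\<^sup>2 * (s / 2))"
    by (simp add: algebra_simps power2_eq_square)
  also have "\<dots> \<le> \<epsilon> * y * d * c + \<epsilon> * q * c\<^sup>2 - \<epsilon>\<^sup>2 * (K * (c\<^sup>2 * (q\<^sup>2 + 10 * q) + 4 * q * c * y))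
      - \<epsilon>\<^sup>2 * (y\<^sup>2 * (K * d))"
    using t2 t3 t5 by (simp add: algebra_simps)
  also have "\<dots> = \<epsilon> * y * d * c + \<epsilon> * q * c\<^sup>2 - \<epsilon>\<^sup>2 * K * (c\<^sup>2 * (q\<^sup>2 + 10 * q) + 4 * q * c * y + y\<^sup>2 * d)"
    by (simp add: algebra_simps)
  finally show ?thesis by (simp add: K_def)
qed

text \<open>When the weight of \<open>v\<close> is too close to \<open>c\<close>, the comparison is instead with the star having weights
  \<open>c (1 - \<epsilon> s)\<close> at \<open>v\<close> and \<open>c (1 - \<epsilon>)\<close> at the leaves.\<close>
lemma fresh_star_real:
  fixes c \<epsilon> s :: real
  assumes c: "0 < c" "c * s \<le> 101/100" "c \<le> 1" and e: "0 \<le> \<epsilon>" "\<epsilon> * s \<le> 1" and s: "1 \<le> s"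
  shows "(1/2 - c) * \<epsilon>\<^sup>2 * (s\<^sup>2 + s) + c / 3 * \<epsilon>^3 * (s^3 + s) + \<epsilon> * s * (1 - \<epsilon> * s) * (1 - \<epsilon>)
    \<le> \<epsilon> * s - \<epsilon>\<^sup>2 / 2 * (s\<^sup>2 - 2 * s - 2)"
proof -
  have "\<epsilon>\<^sup>2 * (\<epsilon> * s * s) \<le> \<epsilon>\<^sup>2 * (1 * s)" using e s by (intro mult_left_mono mult_right_mono) auto
  moreover have "c / 3 * \<epsilon>^3 * (s^3 + s) \<le> \<epsilon>\<^sup>2 * (34/100 * s + 34/100)"
  proof -
    have "c * s\<^sup>2 \<le> 101/100 * s" using mult_right_mono[OF c(2), of s] s by (simp add: power2_eq_square)
    then have "c / 3 * (s\<^sup>2 + 1) \<le> 34/100 * s + 34/100" using c s by (simp add: algebra_simps)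
    moreover have "\<epsilon> * s * (c / 3 * (s\<^sup>2 + 1)) \<le> 1 * (c / 3 * (s\<^sup>2 + 1))"
      using e c by (intro mult_right_mono) auto
    ultimately have "\<epsilon>\<^sup>2 * (\<epsilon> * s * (c / 3 * (s\<^sup>2 + 1))) \<le> \<epsilon>\<^sup>2 * (34/100 * s + 34/100)"
      by (intro mult_left_mono) auto
    then show ?thesis by (simp add: algebra_simps power2_eq_square power3_eq_cube)
  qed
  moreover have "0 \<le> c * \<epsilon>\<^sup>2 * (s\<^sup>2 + s)" "0 \<le> \<epsilon>\<^sup>2 * (16/100 * s + 66/100)" using c s by auto
  moreover have "(1/2 - c) * \<epsilon>\<^sup>2 * (s\<^sup>2 + s) + c / 3 * \<epsilon>^3 * (s^3 + s) + \<epsilon> * s * (1 - \<epsilon> * s) * (1 - \<epsilon>)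
     = \<epsilon> * s - \<epsilon>\<^sup>2 / 2 * (s\<^sup>2 - 2 * s - 2) + (c / 3 * \<epsilon>^3 * (s^3 + s) - \<epsilon>\<^sup>2 * (34/100 * s + 34/100))
       + (\<epsilon>\<^sup>2 * (\<epsilon> * s * s) - \<epsilon>\<^sup>2 * (1 * s)) - c * \<epsilon>\<^sup>2 * (s\<^sup>2 + s) - \<epsilon>\<^sup>2 * (16/100 * s + 66/100)"
    by (simp add: field_simps power2_eq_square power3_eq_cube)
  ultimately show ?thesis by linarith
qed

text \<open>The sum \<open>4/50 + 8/9\<close> is below 97/100, so even after multiplication by
  \<open>K\<close> the coefficient of \<open>s^2\<close> stays under 1/2;
  \<open>s \<ge> 2000\<close> takes care of the linear terms.\<close>

lemma low_codegree_real:
  fixes K s D :: real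
  assumes "0 \<le> K" "K \<le> 501/1000" "2000 \<le> s" "0 \<le> D" "D \<le> s / 50"
  shows "K * (4 * D * s + 8/9 * s\<^sup>2 + 4/9 * s) \<le> (s\<^sup>2 - 2 * s - 2) / 2"
proof -
  have "4 * D * s \<le> 4 * (s / 50) * s" using assms by (intro mult_right_mono) auto
  then have "4 * D * s + 8/9 * s\<^sup>2 + 4/9 * s \<le> 97/100 * s\<^sup>2 + 4/9 * s"
    using zero_le_square[of s] unfolding power2_eq_square by linarith
  then have "K * (4 * D * s + 8/9 * s\<^sup>2 + 4/9 * s) \<le> 501/1000 * (97/100 * s\<^sup>2 + 4/9 * s)"
    using assms by (intro mult_mono) auto
  also have "\<dots> \<le> (s\<^sup>2 - 2 * s - 2) / 2"
  proof -
    have "2000 * s \<le> s\<^sup>2" using assms by (simp add: power2_eq_square mult_right_mono)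
    then show ?thesis using assms by simp
  qed
  finally show ?thesis .
qed

text \<open>At most \<open>98/100 * s\<close> edges miss the pair, so the leading coefficient is
  \<open>501/1000 * 98/100\<close>, again below 1/2. In \<open>p\<close>, the added 2 accounts for
  passing between two levels, \<open>c1\<close> and \<open>c\<close>, in the application.\<close>

lemma high_codegree_real:
  fixes K q d s p c \<epsilon> y :: real
  assumes K: "0 \<le> K" "K \<le> 501/1000" and s: "2000 \<le> s" and q: "0 \<le> q" "d + q = s" "s / 50 \<le> d"
    and p: "p = 501/1000 * (q + 17) + 2" and e: "0 \<le> \<epsilon>" and c: "0 < c"
    and y: "0 \<le> y" "y \<le> c" "c * (1 - \<epsilon> * p) \<le> y"
  shows "c\<^sup>2 * (\<epsilon> * s - \<epsilon>\<^sup>2 / 2 * (s\<^sup>2 - 2 * s - 2))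
    \<le> \<epsilon> * y * d * c + \<epsilon> * q * c\<^sup>2 - \<epsilon>\<^sup>2 * K * (c\<^sup>2 * (q\<^sup>2 + 10 * q) + 4 * q * c * y + y\<^sup>2 * d)"
proof -
  have d: "0 \<le> d" using s q by simp
  have "d * p + 501/1000 * (q\<^sup>2 + 14 * q + d) \<le> (s\<^sup>2 - 2 * s - 2) / 2"
  proof -
    have "q * s \<le> 98/100 * s * s" using q s by (intro mult_right_mono) auto
    then have qs: "q * s \<le> 98/100 * s\<^sup>2" by (simp add: power2_eq_square)
    have "d * p + 501/1000 * (q\<^sup>2 + 14 * q + d) = 501/1000 * (q * (d + q)) + (11018/1000) * d + 7014/1000 * q"
      unfolding p by (simp add: field_simps power2_eq_square)
    also have "\<dots> \<le> 501/1000 * (98/100 * s\<^sup>2) + (11018/1000) * s"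
      using qs q d by simp
    also have "\<dots> \<le> (s\<^sup>2 - 2 * s - 2) / 2"
    proof -
      have "2000 * s \<le> s\<^sup>2" using s by (simp add: power2_eq_square mult_right_mono)
      then show ?thesis using s by simp
    qed
    finally show ?thesis .
  qed
  then have I1: "\<epsilon>\<^sup>2 * c\<^sup>2 * (d * p + 501/1000 * (q\<^sup>2 + 14 * q + d)) \<le> \<epsilon>\<^sup>2 * c\<^sup>2 * ((s\<^sup>2 - 2 * s - 2) / 2)"
    by (intro mult_left_mono) auto
  have I2: "\<epsilon> * d * c * (c * (1 - \<epsilon> * p)) \<le> \<epsilon> * d * c * y"
    using y e d c by (intro mult_left_mono) auto
  have I3: "\<epsilon>\<^sup>2 * (K * (c\<^sup>2 * (q\<^sup>2 + 10 * q) + 4 * q * c * y + y\<^sup>2 * d)) \<le> \<epsilon>\<^sup>2 * (501/1000 * (c\<^sup>2 * (q\<^sup>2 + 14 * q + d)))"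
  proof -
    have "4 * q * c * y \<le> 4 * q * c * c" using y q c by (intro mult_left_mono) auto
    moreover have "y\<^sup>2 * d \<le> c\<^sup>2 * d" using y d by (intro mult_right_mono power_mono) auto
    ultimately have "c\<^sup>2 * (q\<^sup>2 + 10 * q) + 4 * q * c * y + y\<^sup>2 * d \<le> c\<^sup>2 * (q\<^sup>2 + 14 * q + d)"
      by (simp add: power2_eq_square algebra_simps)
    then show ?thesis using K q c d y by (intro mult_left_mono mult_mono) auto
  qed
  have I4: "\<epsilon> * d * c * (c * (1 - \<epsilon> * p)) = c\<^sup>2 * (\<epsilon> * s) - \<epsilon> * q * c\<^sup>2 - \<epsilon>\<^sup>2 * c\<^sup>2 * (d * p)"
    by (simp add: algebra_simps power2_eq_square flip: q(2))
  have I5: "\<epsilon>\<^sup>2 * c\<^sup>2 * (d * p) + \<epsilon>\<^sup>2 * (501/1000 * (c\<^sup>2 * (q\<^sup>2 + 14 * q + d)))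
      \<le> \<epsilon>\<^sup>2 * c\<^sup>2 * ((s\<^sup>2 - 2 * s - 2) / 2)"
  proof -
    have "\<epsilon>\<^sup>2 * (501/1000 * (c\<^sup>2 * Q)) = \<epsilon>\<^sup>2 * c\<^sup>2 * (501/1000 * Q)" for Q by simp
    then show ?thesis using I1 by (simp only: distrib_left[of "\<epsilon>\<^sup>2 * c\<^sup>2" "d * p"])
  qed
  have comb: "C - E \<le> Y + Q - R" if "G1 + G2 \<le> E" "D \<le> Y" "R \<le> G2" "D = C - Q - G1" for C E Y Q R G1 G2 D :: real
    using that by linarith
  have "c\<^sup>2 * (\<epsilon> * s) - \<epsilon>\<^sup>2 * c\<^sup>2 * ((s\<^sup>2 - 2 * s - 2) / 2)
    \<le> \<epsilon> * d * c * y + \<epsilon> * q * c\<^sup>2 - \<epsilon>\<^sup>2 * (K * (c\<^sup>2 * (q\<^sup>2 + 10 * q) + 4 * q * c * y + y\<^sup>2 * d))"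
    by (rule comb[OF I5 I2 I3 I4])
  moreover have "c\<^sup>2 * (\<epsilon> * s - \<epsilon>\<^sup>2 / 2 * (s\<^sup>2 - 2 * s - 2)) = c\<^sup>2 * (\<epsilon> * s) - \<epsilon>\<^sup>2 * c\<^sup>2 * ((s\<^sup>2 - 2 * s - 2) / 2)"
    by (simp add: field_simps)
  moreover have "\<epsilon> * y * d * c = \<epsilon> * d * c * y" by simp
  ultimately show ?thesis by (simp only: mult.assoc)
qed

lemma pair_star_optimal_large:
  fixes U :: "'a set" and x :: "'a \<Rightarrow> real"
  assumes U: "finite U" "card U = n" "real n \<ge> 10^12" and H: "H \<subseteq> nsets U 3" "card H = s" "2000 \<le> s" "s \<le> n - 2"
    and x: "\<And>a. a \<in> U \<Longrightarrow> 0 \<le> x a" "sum x U = 1"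
    and nopair: "\<And>z v. z \<noteq> v \<Longrightarrow> \<exists>g\<in>H. \<not> {z, v} \<subseteq> g"
  obtains z v L x' where "z \<in> U" "v \<in> U" "z \<noteq> v" "L \<subseteq> U - {z, v}" "card L = s"
    "\<And>a. a \<in> U \<Longrightarrow> 0 \<le> x' a" "sum x' U = 1"
    "cost U (pair_star z v L) x' \<le> cost U H x"
proof -
  note goal = that
  have n: "real n \<ge> 1000000" using U(3) by simp
  have finH: "finite H" using U H by (meson finite_imp_finite_nsets finite_subset)
  have ne: "U \<noteq> {}" using U n by auto
  define z where "z = arg_min_on x U"
  have z: "z \<in> U" "\<And>a. a \<in> U \<Longrightarrow> x z \<le> x a"
    using arg_min_if_finite(1)[OF U(1) ne] arg_min_least[OF U(1) ne] by (auto simp: z_def)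
  define codeg where "codeg = (\<lambda>a. card {e \<in> H. {z, a} \<subseteq> e})"
  have "card (U - {z}) = n - 1" using U z by simp
  then have "card (U - {z}) \<noteq> 0" using n by simp
  then have ne': "U - {z} \<noteq> {}" by (metis card.empty)
  define v where "v = arg_min_on (\<lambda>a. - int (codeg a)) (U - {z})"
  have v: "v \<in> U" "v \<noteq> z" and vmax: "\<And>a. a \<in> U - {z} \<Longrightarrow> codeg a \<le> codeg v"
    using arg_min_if_finite(1)[of "U - {z}"] arg_min_least[of "U - {z}" _ "\<lambda>a. - int (codeg a)"] ne' U(1)
    by (auto simp: v_def)
  define \<epsilon> where "\<epsilon> = x z"
  define d where "d = real (codeg v)"
  define q where "q = real (card {e \<in> H. \<not> {z, v} \<subseteq> e})"
  have dq: "d + q = real s"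
  proof -
    have "card {e \<in> H. {z, v} \<subseteq> e} + card {e \<in> H. \<not> {z, v} \<subseteq> e}
        = card ({e \<in> H. {z, v} \<subseteq> e} \<union> {e \<in> H. \<not> {z, v} \<subseteq> e})"
      using finH by (intro card_Un_disjoint[symmetric]) auto
    also have "{e \<in> H. {z, v} \<subseteq> e} \<union> {e \<in> H. \<not> {z, v} \<subseteq> e} = H" by auto
    finally show ?thesis using H(2) by (simp add: d_def q_def codeg_def)
  qed
  have d0: "0 \<le> d" by (simp add: d_def)
  have q1: "1 \<le> q"
  proof -
    obtain g where "g \<in> {e \<in> H. \<not> {z, v} \<subseteq> e}" using nopair[of z v] v by auto
    then have "card {e \<in> H. \<not> {z, v} \<subseteq> e} > 0" using finH by (subst card_gt_0_iff) auto
    then show ?thesis by (simp add: q_def)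
  qed
  have s: "2000 \<le> real s" "real s \<le> real n - 2" using H n by linarith+
  have eps: "0 \<le> \<epsilon>" "\<epsilon> * n \<le> 1"
  proof -
    show "0 \<le> \<epsilon>" using x z by (simp add: \<epsilon>_def)
    have "real (card U) * \<epsilon> \<le> sum x U" using z by (intro sum_bounded_below) (simp add: \<epsilon>_def)
    then show "\<epsilon> * n \<le> 1" using x U by (simp add: mult.commute)
  qed
  have eps1: "\<epsilon> \<le> 1"
  proof -
    have "\<epsilon> * 1 \<le> \<epsilon> * n" using eps n by (intro mult_left_mono) auto
    then show ?thesis using eps by simp
  qed
  have es: "\<epsilon> * s \<le> 1"
  proof -
    have "\<epsilon> * s \<le> \<epsilon> * n" using eps s by (intro mult_left_mono) auto
    then show ?thesis using eps by simp
  qed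
  have "card (U - {z, v}) = n - 2" using U z v by (simp add: card_Diff_subset)
  then obtain L where L: "L \<subseteq> U - {z, v}" "card L = s"
    using H(4) obtain_subset_with_card_n by metis
  have xv: "\<epsilon> \<le> x v" "0 \<le> x v" "\<epsilon> + x v \<le> 1"
  proof -
    show "\<epsilon> \<le> x v" "0 \<le> x v" using z v x by (auto simp: \<epsilon>_def)
    have "sum x {z, v} \<le> sum x U" using U z v x by (intro sum_mono2) auto
    then show "\<epsilon> + x v \<le> 1" using v x by (simp add: \<epsilon>_def)
  qed
  \<comment> \<open>The level at which the star keeping \<open>\<epsilon>\<close> at
    \<open>z\<close> and \<open>x v\<close> at \<open>v\<close>, with
    \<open>c1 - \<epsilon> * x v\<close> at the \<open>s\<close> leaves and \<open>c1\<close>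
    elsewhere, has total 1.\<close>
  define c1 where "c1 = (1 - \<epsilon> - x v * (1 - s * \<epsilon>)) / (real n - 2)"
  have c1n: "c1 * (real n - 2) = 1 - \<epsilon> - x v * (1 - s * \<epsilon>)" using n by (simp add: c1_def)
  have sx: "0 \<le> x v * (1 - s * \<epsilon>)" "x v * (1 - s * \<epsilon>) \<le> x v * 1"
  proof -
    show "0 \<le> x v * (1 - s * \<epsilon>)" using xv es by (simp add: mult.commute)
    have "0 \<le> x v * (s * \<epsilon>)" using xv eps by simp
    then show "x v * (1 - s * \<epsilon>) \<le> x v * 1" by (simp add: algebra_simps)
  qed
  have c10: "0 \<le> c1" using sx xv n by (simp add: c1_def)
  show thesis
  proof (cases "x v \<le> c1 * (1 - 501/1000 * \<epsilon> * (q + 17))")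
    case True
    have "c1 * (1 - 501/1000 * \<epsilon> * (q + 17)) \<le> c1 * 1"
      using c10 eps q1 by (intro mult_left_mono) auto
    then have xc: "x v \<le> c1" using True by simp
    have c1pos: "0 < c1"
    proof (rule ccontr)
      assume "\<not> 0 < c1"
      then have "c1 = 0" using c10 by simp
      then have "x v = 0" "\<epsilon> = 0" using xc xv eps by auto
      then show False using c1n \<open>c1 = 0\<close> by simp
    qed
    have "c1 * (real n - 2) \<le> 1" using c1n sx eps by linarith
    moreover have "c1 * 10000 \<le> c1 * (real n - 2)" "c1 * s \<le> c1 * (real n - 2)"
      using c10 n s by (auto intro!: mult_left_mono)
    ultimately have c1s: "c1 \<le> 1/10000" "c1 * s \<le> 1" by auto
    define x' where "x' = (\<lambda>a. if a = z then \<epsilon> else if a = v then x v else if a \<in> L then c1 - \<epsilon> * x v else c1)"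
    have ex: "\<epsilon> * x v \<le> 1 * c1" using eps1 eps xc xv by (intro mult_mono) auto
    have nn: "0 \<le> x' a" for a using ex eps xv c10 by (auto simp: x'_def)
    have sum1: "sum x' U = 1"
      using sum_star_weights[of U z v L "\<lambda>y. y" \<epsilon> "x v" "c1 - \<epsilon> * x v" c1] U z v L c1n
      by (simp add: x'_def algebra_simps)
    have star: "cost U (pair_star z v L) x' = pot \<epsilon> + pot (x v) + s * pot (c1 - \<epsilon> * x v)
        + (real n - 2 - real s) * pot c1 + \<epsilon> * x v * (s * (c1 - \<epsilon> * x v))"
      unfolding x'_def using cost_pair_star[of U z v L \<epsilon> "x v" "c1 - \<epsilon> * x v" c1] U z v L by simp
    have lower: "pot \<epsilon> + pot (x v) + (real n - 2) * pot c1 + (c1 - c1\<^sup>2) * (1 - \<epsilon> - x v - (real n - 2) * c1)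
     + \<epsilon> * x v * d * c1 + \<epsilon> * q * c1\<^sup>2
     - \<epsilon>\<^sup>2 / (2 * (1 - 2 * c1)) * (c1\<^sup>2 * (q\<^sup>2 + 10 * q) + 4 * q * c1 * x v + (x v)\<^sup>2 * d) \<le> cost U H x"
      using cost_lower_split[OF U(1) H(1) x z v, of c1] xc xv c1pos c1s U(2)
      by (simp add: q_def d_def codeg_def \<epsilon>_def min_absorb1)
    have main: "s * ((1/2 - c1) * (\<epsilon> * x v)\<^sup>2 + (\<epsilon> * x v)^3 / 3) + \<epsilon> * x v * s * c1 - s * (\<epsilon> * x v)\<^sup>2
      \<le> \<epsilon> * x v * d * c1 + \<epsilon> * q * c1\<^sup>2
        - \<epsilon>\<^sup>2 / (2 * (1 - 2 * c1)) * (c1\<^sup>2 * (q\<^sup>2 + 10 * q) + 4 * q * c1 * x v + (x v)\<^sup>2 * d)"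
      using keep_weight_real[of c1 s \<epsilon> "x v" q d] c1pos c1s eps eps1 xv True q1 d0 dq by simp
    have shift: "1 - \<epsilon> - x v - (real n - 2) * c1 = - (s * (\<epsilon> * x v))"
      using c1n by (simp add: algebra_simps)
    have ring: "s * (P - k * r + h * r\<^sup>2 + t) + (n - 2 - s) * P + r * (s * (c - r))
       = (n - 2) * P + k * (- (s * r)) + (s * (h * r\<^sup>2 + t) + r * s * c - s * r\<^sup>2)"
      for s P k r h t n c :: real by algebra
    have "cost U (pair_star z v L) x' = pot \<epsilon> + pot (x v) + ((real n - 2) * pot c1 + (c1 - c1\<^sup>2) * (- (s * (\<epsilon> * x v)))
       + (s * ((1/2 - c1) * (\<epsilon> * x v)\<^sup>2 + (\<epsilon> * x v)^3 / 3) + \<epsilon> * x v * s * c1 - s * (\<epsilon> * x v)\<^sup>2))"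
      unfolding star pot_diff ring[symmetric] by simp
    then have "cost U (pair_star z v L) x' \<le> cost U H x"
      using lower main unfolding shift by linarith
    with goal[OF z(1) v(1) v(2)[symmetric] L nn sum1] show thesis .
  next
    case False
    \<comment> \<open>Total 1 for the other star: \<open>v\<close> loses
      \<open>c * \<epsilon> * s\<close>, and so do the leaves together.\<close>
    define c where "c = (1 - \<epsilon>) / (real n - 1 - 2 * \<epsilon> * s)"
    have pos: "real n - 3 \<le> real n - 1 - 2 * \<epsilon> * s" using es by simp
    have cn: "c * (real n - 1 - 2 * \<epsilon> * s) = 1 - \<epsilon>" using pos n by (simp add: c_def)
    have "\<epsilon> * 1000000 \<le> \<epsilon> * n" using n eps by (intro mult_left_mono) auto
    then have "\<epsilon> \<le> 1/1000000" using eps by simp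
    then have cpos: "0 < c" unfolding c_def using pos n by (intro divide_pos_pos) auto
    have ce: "\<epsilon> \<le> c"
    proof -
      have "c * (real n - 1 - 2 * \<epsilon> * s) \<le> c * (real n - 1)" using cpos eps by (intro mult_left_mono) auto
      moreover have "\<epsilon> * (real n - 1) \<le> 1 - \<epsilon>" using eps by (simp add: algebra_simps)
      ultimately have "\<epsilon> * (real n - 1) \<le> c * (real n - 1)" using cn by simp
      then show ?thesis using n by simp
    qed
    have c3: "c * (real n - 3) \<le> 1"
    proof -
      have "c * (real n - 3) \<le> c * (real n - 1 - 2 * \<epsilon> * s)" using pos cpos by (intro mult_left_mono) auto
      then show ?thesis using cn eps by simp
    qed
    have c4: "c \<le> 1/10000" "c * s \<le> 101/100"
    proof -
      have "c * 10000 \<le> c * (real n - 3)" using cpos n by (intro mult_left_mono) auto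
      then show "c \<le> 1/10000" using c3 by simp
      have "c * s \<le> c * (real n - 3 + 1)" using cpos s by (intro mult_left_mono) auto
      also have "\<dots> = c * (real n - 3) + c" by (simp add: algebra_simps)
      finally show "c * s \<le> 101/100" using c3 \<open>c \<le> 1/10000\<close> by simp
    qed
    define K where "K = 1 / (2 * (1 - 2 * c))"
    have K: "0 \<le> K" "K \<le> 501/1000"
      using cpos c4 unfolding K_def by (auto simp: field_simps)
    define x' where "x' = (\<lambda>a. if a = z then \<epsilon> else if a = v then c - c * (\<epsilon> * s) else if a \<in> L then c - c * \<epsilon> else c)"
    have nn: "0 \<le> x' a" for a
    proof -
      have "c * (\<epsilon> * s) \<le> c * 1" "c * \<epsilon> \<le> c * 1" using es eps1 cpos by (auto intro!: mult_left_mono)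
      then show ?thesis using eps cpos by (auto simp: x'_def)
    qed
    have sum1: "sum x' U = 1"
      using sum_star_weights[of U z v L "\<lambda>y. y" \<epsilon> "c - c * (\<epsilon> * s)" "c - c * \<epsilon>" c] U z v L cn
      by (simp add: x'_def algebra_simps)
    have star: "cost U (pair_star z v L) x' = pot \<epsilon> + pot (c - c * (\<epsilon> * s)) + s * pot (c - c * \<epsilon>)
        + (real n - 2 - real s) * pot c + \<epsilon> * (c - c * (\<epsilon> * s)) * (s * (c - c * \<epsilon>))"
      unfolding x'_def using cost_pair_star[of U z v L \<epsilon> "c - c * (\<epsilon> * s)" "c - c * \<epsilon>" c] U z v L by simp
    have cn': "1 - \<epsilon> - (real n - 1) * c = - (c * (2 * \<epsilon> * s))" using cn by (simp add: algebra_simps)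
    have "cost U (pair_star z v L) x' = pot \<epsilon> + (real n - 1) * pot c + (c - c\<^sup>2) * (1 - \<epsilon> - (real n - 1) * c)
       + c\<^sup>2 * ((1/2 - c) * \<epsilon>\<^sup>2 * (s\<^sup>2 + s) + c / 3 * \<epsilon>^3 * (s^3 + s) + \<epsilon> * s * (1 - \<epsilon> * s) * (1 - \<epsilon>))"
      unfolding star cn' pot_diff by (simp add: field_simps power2_eq_square power3_eq_cube)
    also have "\<dots> \<le> pot \<epsilon> + (real n - 1) * pot c + (c - c\<^sup>2) * (1 - \<epsilon> - (real n - 1) * c)
       + c\<^sup>2 * (\<epsilon> * s - \<epsilon>\<^sup>2 / 2 * ((real s)\<^sup>2 - 2 * real s - 2))"
      using fresh_star_real[of c s \<epsilon>] cpos c4 eps es s by (intro add_left_mono mult_left_mono) auto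
    finally have upper: "cost U (pair_star z v L) x' \<le> pot \<epsilon> + (real n - 1) * pot c
       + (c - c\<^sup>2) * (1 - \<epsilon> - (real n - 1) * c) + c\<^sup>2 * (\<epsilon> * s - \<epsilon>\<^sup>2 / 2 * ((real s)\<^sup>2 - 2 * real s - 2))" .
    have "cost U (pair_star z v L) x' \<le> cost U H x"
    proof (cases "d \<le> real s / 50")
      case low: True
      have deg: "real (card {e \<in> H. z \<in> e \<and> a \<in> e}) \<le> d" if "a \<in> U - {z}" for a
        using vmax[OF that] by (simp add: codeg_def d_def)
      have "K * (4 * d * s + 8/9 * s\<^sup>2 + 4/9 * s) \<le> ((real s)\<^sup>2 - 2 * real s - 2) / 2"
        using low_codegree_real[OF K s(1) d0 low] by simp
      then have "\<epsilon>\<^sup>2 * (K * (4 * d * s + 8/9 * s\<^sup>2 + 4/9 * s)) \<le> \<epsilon>\<^sup>2 * (((real s)\<^sup>2 - 2 * real s - 2) / 2)"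
        by (intro mult_left_mono) auto
      then have "c\<^sup>2 * (\<epsilon> * s - \<epsilon>\<^sup>2 / 2 * ((real s)\<^sup>2 - 2 * real s - 2))
         \<le> c\<^sup>2 * (\<epsilon> * s - \<epsilon>\<^sup>2 / (2 * (1 - 2 * c)) * (4 * d * s + 8/9 * s\<^sup>2 + 4/9 * s))"
        by (intro mult_left_mono) (auto simp: K_def)
      moreover have "pot \<epsilon> + (real n - 1) * pot c + (c - c\<^sup>2) * (1 - \<epsilon> - (real n - 1) * c)
        + c\<^sup>2 * (\<epsilon> * s - \<epsilon>\<^sup>2 / (2 * (1 - 2 * c)) * (4 * d * s + 8/9 * s\<^sup>2 + 4/9 * s)) \<le> cost U H x"
        using cost_lower_singleton[OF U(1) H(1) x z deg, of c] ce cpos c4 U(2) H(2) by (simp add: \<epsilon>_def)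
      ultimately show ?thesis using upper by linarith
    next
      case high: False
      define p where "p = 501/1000 * (q + 17) + 2"
      define y where "y = min (x v) c"
      have y: "0 \<le> y" "y \<le> c" using xv cpos by (auto simp: y_def)
      \<comment> \<open>The case hypothesis compares \<open>x v\<close> with \<open>c1\<close>, but
        the bound is needed at level \<open>c\<close>. If \<open>x v < c\<close>, the two
        total-weight equations give \<open>c * (1 - 2 * \<epsilon>) \<le> c1\<close>.\<close>
      have ylow: "c * (1 - \<epsilon> * p) \<le> y"
      proof (cases "c \<le> x v")
        case True
        have "c * (1 - \<epsilon> * p) \<le> c * 1" using cpos eps q1 by (intro mult_left_mono) (auto simp: p_def)
        then show ?thesis using True by (simp add: y_def)
      next
        case xvc: False
        define w where "w = 1 - 501/1000 * \<epsilon> * (q + 17)"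
        have pw: "1 - \<epsilon> * p = w - 2 * \<epsilon>" by (simp add: p_def w_def algebra_simps)
        show ?thesis
        proof (cases "0 \<le> w")
          case True
          have "c * (real n - 2 - 2 * \<epsilon> * s) \<le> c1 * (real n - 2)"
            using c1n cn sx xvc by (simp add: algebra_simps)
          moreover have "c * ((1 - 2 * \<epsilon>) * (real n - 2)) \<le> c * (real n - 2 - 2 * \<epsilon> * s)"
          proof (rule mult_left_mono)
            have "2 * \<epsilon> * s \<le> 2 * \<epsilon> * (real n - 2)" using eps s by (intro mult_left_mono) auto
            then show "(1 - 2 * \<epsilon>) * (real n - 2) \<le> real n - 2 - 2 * \<epsilon> * s" by (simp add: algebra_simps)
          qed (use cpos in simp)
          ultimately have "(c * (1 - 2 * \<epsilon>)) * (real n - 2) \<le> c1 * (real n - 2)" by (simp add: mult.assoc)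
          then have c1c: "c * (1 - 2 * \<epsilon>) \<le> c1" using n by simp
          have "c * (w - 2 * \<epsilon>) \<le> c * ((1 - 2 * \<epsilon>) * w)"
          proof (rule mult_left_mono)
            have "w \<le> 1" using eps q1 by (simp add: w_def)
            then have "\<epsilon> * w \<le> \<epsilon> * 1" using eps by (intro mult_left_mono) auto
            then show "w - 2 * \<epsilon> \<le> (1 - 2 * \<epsilon>) * w" by (simp add: algebra_simps)
          qed (use cpos in simp)
          also have "\<dots> = (c * (1 - 2 * \<epsilon>)) * w" by simp
          also have "\<dots> \<le> c1 * w" using c1c True by (intro mult_right_mono)
          also have "\<dots> \<le> x v" using False by (simp add: w_def)
          finally show ?thesis using xvc by (simp add: pw y_def)
        next
          case False
          then have "c * (1 - \<epsilon> * p) \<le> 0" using cpos eps by (simp add: pw mult_nonneg_nonpos)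
          then show ?thesis using y by simp
        qed
      qed
      have "x v \<le> 1" using xv eps by simp
      \<comment> \<open>The tangent at \<open>c\<close> merges \<open>v\<close> with the vertices at
        level \<open>c\<close>, matching the \<open>n - 1\<close> copies of \<open>pot c\<close> in
        the upper bound.\<close>
      have "pot (x v) \<ge> pot c + (c - c\<^sup>2) * (x v - c)"
      proof -
        have "0 \<le> (1/2 - c) * (max 0 (c - x v))\<^sup>2" using c4 by (intro mult_nonneg_nonneg) auto
        then show ?thesis using pot_lower[of "x v" c] \<open>x v \<le> 1\<close> cpos c4 by linarith
      qed
      moreover have "pot \<epsilon> + pot (x v) + (real n - 2) * pot c + (c - c\<^sup>2) * (1 - \<epsilon> - x v - (real n - 2) * c)
         + \<epsilon> * y * d * c + \<epsilon> * q * c\<^sup>2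
         - \<epsilon>\<^sup>2 / (2 * (1 - 2 * c)) * (c\<^sup>2 * (q\<^sup>2 + 10 * q) + 4 * q * c * y + y\<^sup>2 * d) \<le> cost U H x"
        using cost_lower_split[OF U(1) H(1) x z v, of c] ce cpos c4 U(2)
        by (simp add: q_def d_def codeg_def \<epsilon>_def y_def)
      moreover have "c\<^sup>2 * (\<epsilon> * s - \<epsilon>\<^sup>2 / 2 * ((real s)\<^sup>2 - 2 * real s - 2))
         \<le> \<epsilon> * y * d * c + \<epsilon> * q * c\<^sup>2 - \<epsilon>\<^sup>2 * K * (c\<^sup>2 * (q\<^sup>2 + 10 * q) + 4 * q * c * y + y\<^sup>2 * d)"
        using high_codegree_real[OF K s(1) _ dq _ p_def eps(1) cpos y ylow] q1 high by simp
      moreover have "\<epsilon>\<^sup>2 * K = \<epsilon>\<^sup>2 / (2 * (1 - 2 * c))" by (simp add: K_def)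
      moreover have "pot \<epsilon> + (pot c + (c - c\<^sup>2) * (x v - c)) + (real n - 2) * pot c
          + (c - c\<^sup>2) * (1 - \<epsilon> - x v - (real n - 2) * c)
        = pot \<epsilon> + (real n - 1) * pot c + (c - c\<^sup>2) * (1 - \<epsilon> - (real n - 1) * c)"
        by (simp add: algebra_simps)
      ultimately show ?thesis using upper by simp
    qed
    with goal[OF z(1) v(1) v(2)[symmetric] L nn sum1] show thesis .
  qed
qed

text \<open>A family with a common pair is itself a pair star and keeps its weighting
  \<open>x\<close>. Setting it aside gives the other two cases a strict gap to work with: two
  different edges, or an edge missing the chosen pair.\<close>

lemma pair_star_optimal:
  fixes U :: "'a set" and x :: "'a \<Rightarrow> real"
  assumes U: "finite U" "real (card U) \<ge> 10^12" and H: "H \<subseteq> nsets U 3" "card H \<le> card U - 2"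
    and x: "\<And>a. a \<in> U \<Longrightarrow> 0 \<le> x a" "sum x U = 1"
  obtains z v L x' where "z \<in> U" "v \<in> U" "z \<noteq> v" "L \<subseteq> U - {z, v}" "card L = card H"
    "\<And>a. a \<in> U \<Longrightarrow> 0 \<le> x' a" "sum x' U = 1"
    "cost U (pair_star z v L) x' \<le> cost U H x"
proof (cases "\<exists>z v. z \<noteq> v \<and> (\<forall>e\<in>H. {z, v} \<subseteq> e)")
  case True
  note goal = that
  have finH: "finite H" using U H by (meson finite_imp_finite_nsets finite_subset)
  have "\<exists>z v. z \<in> U \<and> v \<in> U \<and> z \<noteq> v \<and> (\<forall>e\<in>H. {z, v} \<subseteq> e)"
  proof (cases "H = {}")
    case True
    have "2 \<le> real (card U)" using U(2) by simp
    then have "2 \<le> card U" by simp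
    then obtain T where "T \<subseteq> U" "card T = 2" using obtain_subset_with_card_n by metis
    then show ?thesis using True by (auto simp: card_2_iff)
  next
    case False
    then obtain e where e: "e \<in> H" "e \<subseteq> U" using H by (auto simp: nsets_def)
    then show ?thesis using True by blast
  qed
  then obtain z v where zv: "z \<in> U" "v \<in> U" "z \<noteq> v" "\<And>e. e \<in> H \<Longrightarrow> {z, v} \<subseteq> e" by blast
  obtain L where L: "L \<subseteq> U - {z, v}" "card L = card H" "H = pair_star z v L"
    using pair_star_of_common_pair[OF H(1) U(1) zv(3,4)] by blast
  show thesis by (rule goal[OF zv(1-3) L(1,2) x]) (use L(3) in auto)
next
  case False
  note goal = that
  have nopair: "\<exists>g\<in>H. \<not> {z, v} \<subseteq> g" if "z \<noteq> v" for z v using False that by blast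
  show thesis
  proof (cases "card H \<ge> 2000")
    case True
    show thesis
    proof (rule pair_star_optimal_large[OF U(1) refl U(2) H(1) refl True H(2)])
      show "0 \<le> x a" if "a \<in> U" for a using that by (rule x(1))
      show "\<exists>g\<in>H. \<not> {z, v} \<subseteq> g" if "z \<noteq> v" for z v using that by (rule nopair)
    qed (rule x(2), rule goal)
  next
    case le: False
    have "2 \<le> real (card U)" using U(2) by simp
    then have "2 \<le> card U" by simp
    then obtain T where T: "T \<subseteq> U" "card T = 2" using obtain_subset_with_card_n by metis
    then obtain z v where "T = {z, v}" and zv: "z \<noteq> v" by (auto simp: card_2_iff)
    obtain e where e: "e \<in> H" using nopair[OF zv] by blast
    then have e3: "finite e" "card e = 3" using H by (auto simp: nsets_def)
    have "\<exists>z v. z \<noteq> v \<and> {z, v} \<subseteq> e" using e3 by (auto simp: card_3_iff)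
    then obtain z' v' where "z' \<noteq> v'" "{z', v'} \<subseteq> e" by blast
    obtain f where f: "f \<in> H" "\<not> {z', v'} \<subseteq> f" using nopair[OF \<open>z' \<noteq> v'\<close>] by blast
    have "e \<noteq> f" using f \<open>{z', v'} \<subseteq> e\<close> by blast
    have s: "card H \<le> 2000" using le by simp
    show thesis
    proof (rule pair_star_optimal_small[OF U(1) refl U(2) H(1) refl s])
      show "0 \<le> x a" if "a \<in> U" for a using that by (rule x(1))
      show "\<exists>g\<in>H. \<not> {z, v} \<subseteq> g" if "z \<noteq> v" for z v using that by (rule nopair)
      show "e \<in> H" "f \<in> H" "e \<noteq> f" by fact+
    qed (rule x(2), rule goal)
  qed
qed

section \<open>Initial segments of the colexicographic order\<close>

text \<open>A down-closed family contains all predecessors of each of its members, so a member has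
  fewer than \<open>card S\<close> of them.\<close>

lemma downset_subset_colex_initial:
  assumes S: "finite S" "S \<subseteq> nsets {1..} 3" "card S \<le> m"
    and down: "\<And>A B. A \<in> S \<Longrightarrow> B \<in> nsets {1..} 3 \<Longrightarrow> colex_less B A \<Longrightarrow> B \<in> S"
  shows "S \<subseteq> colex_initial m 3"
proof
  fix A assume A: "A \<in> S"
  have "{B \<in> nsets {1..} 3. colex_less B A} \<subseteq> S - {A}"
    using down[OF A] by (auto simp: colex_less_def)
  then have "card {B \<in> nsets {1..} 3. colex_less B A} \<le> card (S - {A})"
    using S by (intro card_mono) auto
  also have "\<dots> < card S" using A S by (intro card_Diff1_less) auto
  finally show "A \<in> colex_initial m 3" using A S by (auto simp: colex_initial_def)
qed

text \<open>All powers up to \<open>2 ^ n\<close> together stay below \<open>2 ^ (n + 1)\<close>, so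
  the largest element decides.\<close>

lemma colex_less_member_bound:
  assumes "finite A" "finite B" "colex_less B A" "b \<in> B" "A \<subseteq> {1..n}"
  shows "b \<le> n"
proof (rule ccontr)
  assume "\<not> b \<le> n"
  have "(\<Sum>i\<in>A. 2 ^ i :: nat) \<le> (\<Sum>i\<in>{1..n}. 2 ^ i)" using assms by (intro sum_mono2) auto
  also have "\<dots> \<le> (\<Sum>i<Suc n. 2 ^ i)" by (intro sum_mono2) auto
  also have "\<dots> < 2 ^ Suc n" by (simp only: sum_power2 lessThan_atLeast0) simp
  also have "(2::nat) ^ Suc n \<le> 2 ^ b" using \<open>\<not> b \<le> n\<close> by (intro power_increasing) auto
  also have "(2::nat) ^ b \<le> (\<Sum>i\<in>B. 2 ^ i)" using assms by (intro member_le_sum) auto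
  finally show False using assms(3) by (simp add: colex_less_def)
qed

lemma nsets_subset_colex_initial:
  assumes "n choose 3 \<le> m"
  shows "nsets {1..n} 3 \<subseteq> colex_initial m 3"
proof (rule downset_subset_colex_initial)
  show "nsets {1..n} 3 \<subseteq> nsets {1..} 3" by (auto simp: nsets_def)
  fix A B assume A: "A \<in> nsets {1..n} 3" and B: "B \<in> nsets {1..} 3" "colex_less B A"
  have "b \<le> n" if "b \<in> B" for b
    using colex_less_member_bound[of A B b n] A B that by (auto simp: nsets_def)
  then show "B \<in> nsets {1..n} 3" using B by (auto simp: nsets_def)
qed (use assms in \<open>auto intro: finite_imp_finite_nsets\<close>)

text \<open>The last triples of \<open>{1..n}\<close> contain both \<open>n\<close> and
  \<open>n - 1\<close> and are ordered by their third element, so cutting off the last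
  \<open>s \<le> n - 2\<close> of them removes a pair star.\<close>

lemma nsets_minus_star_subset_colex_initial:
  assumes n: "3 \<le> n" and s: "s \<le> n - 2" and m: "m + s = n choose 3"
  shows "nsets {1..n} 3 - pair_star n (n - 1) {n - 2 - s <.. n - 2} \<subseteq> colex_initial m 3"
    (is "?S \<subseteq> _")
proof (rule downset_subset_colex_initial)
  let ?L = "{n - 2 - s <.. n - 2}"
  have sub: "pair_star n (n - 1) ?L \<subseteq> nsets {1..n} 3"
  proof
    fix e assume "e \<in> pair_star n (n - 1) ?L"
    then obtain b where b: "b \<in> ?L" "e = {n, n - 1, b}" by (auto simp: pair_star_def)
    then have "b \<noteq> n" "b \<noteq> n - 1" "n \<noteq> n - 1" using n by auto
    then have "card e = 3" using b(2) by simp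
    then show "e \<in> nsets {1..n} 3" using b n by (auto simp: nsets_def)
  qed
  have "inj_on (\<lambda>b. {n, n - 1, b}) ?L"
  proof (rule inj_onI)
    fix b b' assume b: "b \<in> ?L" "b' \<in> ?L" "{n, n - 1, b} = {n, n - 1, b'}"
    have "b \<in> {n, n - 1, b'}" unfolding b(3)[symmetric] by simp
    then show "b = b'" using b n by auto
  qed
  then have "card (pair_star n (n - 1) ?L) = s" using s by (simp add: pair_star_def card_image)
  then show "card ?S \<le> m" using sub m
    by (subst card_Diff_subset) (auto intro: finite_subset[OF _ finite_imp_finite_nsets])
  show "finite ?S" by (auto intro: finite_imp_finite_nsets)
  show "?S \<subseteq> nsets {1..} 3" by (auto simp: nsets_def)
  fix A B assume A: "A \<in> ?S" and B: "B \<in> nsets {1..} 3" "colex_less B A"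
  have A3: "A \<subseteq> {1..n}" "finite A" "card A = 3" and B3: "finite B" "card B = 3" "B \<subseteq> {1..}"
    using A B by (auto simp: nsets_def)
  have "b \<le> n" if "b \<in> B" for b
    using colex_less_member_bound[of A B b n] A3 B3 B that by auto
  then have Bn: "B \<in> nsets {1..n} 3" using B3 by (auto simp: nsets_def)
  have "B \<notin> pair_star n (n - 1) ?L"
  proof
    assume "B \<in> pair_star n (n - 1) ?L"
    then obtain b where b: "b \<in> ?L" "B = {n, n - 1, b}" by (auto simp: pair_star_def)
    have "n \<noteq> b" "n - 1 \<noteq> b" "n \<noteq> n - 1" using b n by auto
    then have "(\<Sum>i\<in>B. 2 ^ i :: nat) = 2 ^ n + 2 ^ (n - 1) + 2 ^ b" unfolding b(2) by simp
    then have less: "2 ^ n + 2 ^ (n - 1) + 2 ^ b < (\<Sum>i\<in>A. 2 ^ i :: nat)"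
      using B by (simp add: colex_less_def)
    have bound: "(\<Sum>i\<in>C. 2 ^ i :: nat) < 2 ^ Suc k" if "C \<subseteq> {1..k}" for C k
    proof -
      have "(\<Sum>i\<in>C. 2 ^ i :: nat) \<le> (\<Sum>i<Suc k. 2 ^ i)" using that by (intro sum_mono2) auto
      also have "\<dots> < 2 ^ Suc k" by (simp only: sum_power2 lessThan_atLeast0) simp
      finally show ?thesis .
    qed
    have nA: "n \<in> A"
    proof (rule ccontr)
      assume "n \<notin> A"
      have "A \<subseteq> {1..n - 1}"
      proof
        fix a assume a: "a \<in> A"
        then have "a \<noteq> n" "1 \<le> a" "a \<le> n" using A3 \<open>n \<notin> A\<close> by auto
        then show "a \<in> {1..n - 1}" by auto
      qed
      from bound[OF this] less n show False by simp
    qed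
    have nA': "n - 1 \<in> A"
    proof (rule ccontr)
      assume "n - 1 \<notin> A"
      have "A - {n} \<subseteq> {1..n - 2}"
      proof
        fix a assume a: "a \<in> A - {n}"
        then have "a \<noteq> n - 1" "a \<noteq> n" "1 \<le> a" "a \<le> n" using A3 \<open>n - 1 \<notin> A\<close> by auto
        then show "a \<in> {1..n - 2}" by auto
      qed
      from bound[OF this] have "(\<Sum>i\<in>A - {n}. 2 ^ i :: nat) < 2 ^ (n - 1)"
        using n by (simp add: Suc_diff_Suc numeral_2_eq_2)
      then show False using less nA A3 by (simp add: sum.remove)
    qed
    have "card (A - {n, n - 1}) = 1" using A3 nA nA' n by (subst card_Diff_subset) auto
    then obtain a where a: "A - {n, n - 1} = {a}" by (auto simp: card_1_singleton_iff)
    then have Aeq: "A = {n, n - 1, a}" using nA nA' by auto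
    have "a \<noteq> n" "a \<noteq> n - 1" using a by auto
    then have "n \<noteq> a" "n - 1 \<noteq> a" "n \<noteq> n - 1" using n by auto
    then have "(\<Sum>i\<in>A. 2 ^ i :: nat) = 2 ^ n + 2 ^ (n - 1) + 2 ^ a" unfolding Aeq by simp
    then have "(2::nat) ^ b < 2 ^ a" using less by simp
    then have "b < a" by simp
    moreover have "a \<le> n - 2" using Aeq A3 \<open>a \<noteq> n\<close> \<open>a \<noteq> n - 1\<close> by auto
    ultimately have "A \<in> pair_star n (n - 1) ?L" using b Aeq by (auto simp: pair_star_def)
    then show False using A by simp
  qed
  then show "B \<in> ?S" using Bn by simp
qed

section \<open>Finitely supported weightings and relabelling\<close>

lemma weighting_of_finite:
  assumes "finite V" "V \<subseteq> {1..}" "\<And>a. a \<in> V \<Longrightarrow> 0 \<le> y a" "sum y V = 1"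
  shows "weighting (\<lambda>a. if a \<in> V then y a else 0)" (is "weighting ?w")
proof -
  have "sum ?w V = 1" using assms by simp
  then have "(?w has_sum 1) V" using assms by (simp add: has_sum_finiteI)
  then have "(?w has_sum 1) {1..}"
    using assms by (subst has_sum_cong_neutral[where S=V and g="?w", symmetric]) auto
  then show ?thesis using assms by (auto simp: weighting_def)
qed

text \<open>Weights are nonnegative, so a relabelled copy of a mere subfamily bounds the Lagrangian
  from below; inclusions into colex segments are then enough.\<close>

lemma lagrangian_ge_transport:
  fixes x :: "nat \<Rightarrow> real"
  assumes G: "rgraph r G" and b: "bij_betw \<phi> V U" "finite V" "V \<subseteq> {1..}"
    and x: "\<And>a. a \<in> U \<Longrightarrow> 0 \<le> x a" "sum x U = 1"
    and F: "F \<subseteq> Pow V" "F \<subseteq> G"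
  shows "(\<Sum>e\<in>(`) \<phi> ` F. prod x e) \<le> lagrangian G"
proof -
  define w where "w = (\<lambda>a. if a \<in> V then x (\<phi> a) else 0)"
  have \<phi>: "\<phi> a \<in> U" if "a \<in> V" for a using b that by (auto simp: bij_betw_def)
  have w0: "0 \<le> w a" for a using x \<phi> by (simp add: w_def)
  have "(\<Sum>a\<in>V. x (\<phi> a)) = 1" using x sum.reindex_bij_betw[OF b(1)] by metis
  then have ww: "weighting w" unfolding w_def using b x \<phi> by (intro weighting_of_finite) auto
  obtain w' where "lagrangian G = edge_weight G w'" "\<And>w'. weighting w' \<Longrightarrow> edge_weight G w' \<le> lagrangian G"
    using lagrangian_attained[OF G] by metis
  then have le: "edge_weight G w \<le> lagrangian G" using ww by blast
  have finG: "finite G" using G by (simp add: rgraph_def)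
  have inj: "inj_on ((`) \<phi>) F"
    using b F by (intro inj_on_subset[OF inj_on_image_Pow]) (auto simp: bij_betw_def)
  have "(\<Sum>e\<in>(`) \<phi> ` F. prod x e) = (\<Sum>e\<in>F. prod x (\<phi> ` e))"
    by (simp add: sum.reindex[OF inj])
  also have "\<dots> = (\<Sum>e\<in>F. prod w e)"
  proof (rule sum.cong)
    fix e assume e: "e \<in> F"
    then have "inj_on \<phi> e" using b F by (meson PowD bij_betw_def inj_on_subset subsetD)
    then have "prod x (\<phi> ` e) = (\<Prod>a\<in>e. x (\<phi> a))" by (simp add: prod.reindex)
    also have "\<dots> = prod w e" using e F by (intro prod.cong) (auto simp: w_def)
    finally show "prod x (\<phi> ` e) = prod w e" .
  qed simp
  also have "\<dots> \<le> edge_weight G w"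
    unfolding edge_weight_def using finG F w0 by (intro sum_mono2 prod_nonneg) auto
  finally show ?thesis using le by simp
qed

section \<open>The support of an optimal weighting\<close>

lemma sum_triples_through:
  fixes x :: "'a \<Rightarrow> real"
  assumes "finite W" "i \<in> W"
  shows "(\<Sum>e\<in>{e \<in> nsets W 3. i \<in> e}. prod x (e - {i}))
    = ((sum x W - x i)\<^sup>2 - ((\<Sum>a\<in>W. (x a)\<^sup>2) - (x i)\<^sup>2)) / 2"
proof -
  have "(\<Sum>p\<in>nsets (W - {i}) 2. prod x p) = (\<Sum>e\<in>{e \<in> nsets W 3. i \<in> e}. prod x (e - {i}))"
  proof (rule sum.reindex_bij_witness[where i = "\<lambda>e. e - {i}" and j = "insert i"])
    fix p assume "p \<in> nsets (W - {i}) 2"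
    then have p: "p \<subseteq> W" "i \<notin> p" "finite p" "card p = 2" by (auto simp: nsets_def)
    then show "insert i p - {i} = p" "insert i p \<in> {e \<in> nsets W 3. i \<in> e}"
      "prod x (insert i p - {i}) = prod x p"
      using assms by (auto simp: nsets_def)
  next
    fix e assume "e \<in> {e \<in> nsets W 3. i \<in> e}"
    then show "insert i (e - {i}) = e" "e - {i} \<in> nsets (W - {i}) 2"
      by (auto simp: nsets_def)
  qed
  moreover have "sum x (W - {i}) = sum x W - x i" "(\<Sum>a\<in>W - {i}. (x a)\<^sup>2) = (\<Sum>a\<in>W. (x a)\<^sup>2) - (x i)\<^sup>2"
    using assms by (simp_all add: sum_diff1)
  ultimately show ?thesis using sum_nsets_2[of "W - {i}" x] assms by simp
qed

text \<open>Few edges of large total weight force the weights not to be spread too thinly.\<close>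
lemma sum_squares_lower:
  fixes x :: "'a \<Rightarrow> real"
  assumes W: "finite W" "G \<subseteq> nsets W 3" and x: "\<And>a. a \<in> W \<Longrightarrow> 0 \<le> x a"
  shows "6 * (\<Sum>e\<in>G. prod x e)\<^sup>2 \<le> card G * (\<Sum>a\<in>W. (x a)\<^sup>2) ^ 3"
proof -
  let ?p = "\<Sum>a\<in>W. (x a)\<^sup>2"
  have "(\<Sum>e\<in>G. 1 * prod x e)\<^sup>2 \<le> (\<Sum>e\<in>G. 1\<^sup>2) * (\<Sum>e\<in>G. (prod x e)\<^sup>2)"
    by (rule Cauchy_Schwarz_ineq_sum)
  also have "(\<Sum>e\<in>G. (prod x e)\<^sup>2) = (\<Sum>e\<in>G. prod (\<lambda>a. (x a)\<^sup>2) e)"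
    by (simp add: prod_power_distrib)
  finally have 1: "(\<Sum>e\<in>G. prod x e)\<^sup>2 \<le> card G * (\<Sum>e\<in>G. prod (\<lambda>a. (x a)\<^sup>2) e)" by simp
  have "(\<Sum>e\<in>G. prod (\<lambda>a. (x a)\<^sup>2) e) \<le> (\<Sum>e\<in>nsets W 3. prod (\<lambda>a. (x a)\<^sup>2) e)"
    using W by (intro sum_mono2 finite_imp_finite_nsets prod_nonneg) auto
  also have "\<dots> = (?p ^ 3 - 3 * ?p * (\<Sum>a\<in>W. ((x a)\<^sup>2)\<^sup>2) + 2 * (\<Sum>a\<in>W. ((x a)\<^sup>2) ^ 3)) / 6"
    using W(1) by (rule sum_nsets_3)
  also have "(\<Sum>a\<in>W. ((x a)\<^sup>2) ^ 3) \<le> ?p * (\<Sum>a\<in>W. ((x a)\<^sup>2)\<^sup>2)"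
    unfolding sum_distrib_left
  proof (rule sum_mono)
    fix a assume "a \<in> W"
    then have "(x a)\<^sup>2 \<le> ?p" using W by (intro member_le_sum) auto
    then have "(x a)\<^sup>2 * ((x a)\<^sup>2)\<^sup>2 \<le> ?p * ((x a)\<^sup>2)\<^sup>2" by (intro mult_right_mono) auto
    then show "((x a)\<^sup>2) ^ 3 \<le> ?p * ((x a)\<^sup>2)\<^sup>2" by (simp add: power3_eq_cube power2_eq_square)
  qed
  also have "(?p ^ 3 - 3 * ?p * (\<Sum>a\<in>W. ((x a)\<^sup>2)\<^sup>2) + 2 * (?p * (\<Sum>a\<in>W. ((x a)\<^sup>2)\<^sup>2))) / 6 \<le> ?p ^ 3 / 6"
    using mult_nonneg_nonneg[of ?p "\<Sum>a\<in>W. ((x a)\<^sup>2)\<^sup>2"] by (simp add: sum_nonneg)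
  finally have "card G * (\<Sum>e\<in>G. prod (\<lambda>a. (x a)\<^sup>2) e) \<le> card G * (?p ^ 3 / 6)"
    by (intro mult_left_mono) auto
  with 1 show ?thesis by simp
qed

lemma real_choose_3: "6 * real (k choose 3) = real k * (real k - 1) * (real k - 2)"
  by (simp add: binomial_gbinomial gbinomial_prod_rev numeral_3_eq_3 fact_numeral)

text \<open>A support of \<open>t + 2\<close> vertices would span at least
  \<open>(t^2 + t) / 2\<close> more triples than \<open>G\<close> may have edges, whereas the
  missing triples number at most a constant times \<open>t\<close>.\<close>

lemma support_bound:
  fixes x :: "'a \<Rightarrow> real" and t :: nat
  assumes W: "finite W" "G \<subseteq> nsets W 3" and x: "\<And>a. a \<in> W \<Longrightarrow> 0 < x a" "sum x W = 1"
    and t: "100000 \<le> t" and G: "6 * real (card G) \<le> real t ^ 3 - t"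
    and f: "(1 - 1 / real t) * (1 - 2 / real t) \<le> 6 * (\<Sum>e\<in>G. prod x e)"
    and kkt: "\<And>i. i \<in> W \<Longrightarrow> 3 * (\<Sum>e\<in>G. prod x e) \<le> (\<Sum>e\<in>{e \<in> G. i \<in> e}. prod x (e - {i}))"
  shows "card W \<le> t + 1"
proof (rule ccontr)
  assume many: "\<not> card W \<le> t + 1"
  define \<tau> where "\<tau> = real t"
  have \<tau>: "100000 \<le> \<tau>" using t by (simp add: \<tau>_def)
  define p where "p = (\<Sum>a\<in>W. (x a)\<^sup>2)"
  define fG where "fG = (\<Sum>e\<in>G. prod x e)"
  \<comment> \<open>The part of the link of \<open>i\<close> lost to missing triples. Its
    nonnegativity bounds \<open>x i\<close>; its sum over \<open>i\<close> bounds the number of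
    missing triples.\<close>
  define M where "M = (\<lambda>i. \<Sum>e\<in>{e \<in> nsets W 3 - G. i \<in> e}. prod x (e - {i}))"
  have finG: "finite G" using W by (meson finite_imp_finite_nsets finite_subset)
  have finN: "finite (nsets W 3)" using W by (intro finite_imp_finite_nsets)
  have e3: "finite e" "card e = 3" "e \<subseteq> W" if "e \<in> nsets W 3" for e using that by (auto simp: nsets_def)
  have p0: "0 \<le> p" by (simp add: p_def sum_nonneg)
  have f6: "1 - 3 / \<tau> + 2 / \<tau>\<^sup>2 \<le> 6 * fG"
    using f \<tau> by (simp add: fG_def \<tau>_def field_simps power2_eq_square)
  have small: "3 / \<tau> \<le> 1" "0 \<le> 2 / \<tau>\<^sup>2" using \<tau> by auto
  then have f6': "1 - 3 / \<tau> \<le> 6 * fG" using f6 by linarith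
  \<comment> \<open>Otherwise Cauchy-Schwarz makes the square of \<open>1 - 3 / \<tau>\<close>
    smaller than its cube, impossible in [0,1].\<close>
  have p_lower: "1 - 3 / \<tau> \<le> \<tau> * p"
  proof (rule ccontr)
    assume neg: "\<not> ?thesis"
    have "6 * (6 * fG\<^sup>2) \<le> 6 * (card G * p ^ 3)"
      using sum_squares_lower[OF W] x by (simp add: fG_def p_def less_imp_le)
    also have "\<dots> = (6 * card G) * p ^ 3" by simp
    also have "\<dots> \<le> \<tau> ^ 3 * p ^ 3" using G p0 by (intro mult_right_mono) (auto simp: \<tau>_def)
    finally have "(6 * fG)\<^sup>2 \<le> (\<tau> * p) ^ 3" by (simp add: power_mult_distrib)
    moreover have "(1 - 3 / \<tau>)\<^sup>2 \<le> (6 * fG)\<^sup>2" using f6' small by (intro power_mono) auto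
    moreover have "(\<tau> * p) ^ 3 < (1 - 3 / \<tau>) ^ 3" using neg p0 \<tau> by (intro power_strict_mono) auto
    moreover have "(1 - 3 / \<tau>) ^ 3 \<le> (1 - 3 / \<tau>)\<^sup>2" using small \<tau> by (intro power_decreasing) auto
    ultimately show False by linarith
  qed
  have p_lower': "1 / \<tau> - 3 / \<tau>\<^sup>2 \<le> p"
    using p_lower \<tau> by (simp add: field_simps power2_eq_square)
  have prod0: "0 \<le> prod x e" if "e \<subseteq> W" for e
    using that x by (intro prod_nonneg) (auto intro: less_imp_le)
  have M0: "0 \<le> M i" for i
    unfolding M_def
  proof (rule sum_nonneg)
    fix e assume "e \<in> {e \<in> nsets W 3 - G. i \<in> e}"
    then have "e - {i} \<subseteq> W" by (auto simp: nsets_def)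
    then show "0 \<le> prod x (e - {i})" by (rule prod0)
  qed
  have link: "3 * fG + M i \<le> (1 - 2 * x i + 2 * (x i)\<^sup>2 - p) / 2" if i: "i \<in> W" for i
  proof -
    have "(\<Sum>e\<in>{e \<in> G. i \<in> e}. prod x (e - {i})) + M i = (\<Sum>e\<in>{e \<in> G. i \<in> e} \<union> {e \<in> nsets W 3 - G. i \<in> e}. prod x (e - {i}))"
      unfolding M_def using finG finN by (intro sum.union_disjoint[symmetric]) auto
    also have "{e \<in> G. i \<in> e} \<union> {e \<in> nsets W 3 - G. i \<in> e} = {e \<in> nsets W 3. i \<in> e}" using W by auto
    also have "(\<Sum>e\<in>{e \<in> nsets W 3. i \<in> e}. prod x (e - {i})) = ((1 - x i)\<^sup>2 - (p - (x i)\<^sup>2)) / 2"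
      using sum_triples_through[OF W(1) i, of x] x(2) by (simp add: p_def)
    finally show ?thesis using kkt[OF i] by (simp add: fG_def power2_eq_square algebra_simps)
  qed
  have x1: "x i \<le> 1" if "i \<in> W" for i
    using member_le_sum[of i W x] that x W by (auto simp: less_imp_le)
  have M_le: "M i \<le> 1 / \<tau> - x i + (x i)\<^sup>2 + 1 / (2 * \<tau>\<^sup>2)" if "i \<in> W" for i
  proof -
    define a b where "a = 1 / \<tau>" and "b = 1 / \<tau>\<^sup>2"
    have "1 - 3 * a + 2 * b \<le> 6 * fG" "a - 3 * b \<le> p"
      using f6 p_lower' by (simp_all add: a_def b_def)
    then have "M i \<le> a - x i + (x i)\<^sup>2 + b / 2" using link[OF that] by (simp add: field_simps)
    then show ?thesis by (simp add: a_def b_def)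
  qed
  \<comment> \<open>A crude bound, which makes the square in \<open>M_le\<close> negligible and lets
    \<open>x_le\<close> improve the constant to 1.\<close>
  have x_le3: "x i \<le> 3 / \<tau>" if i: "i \<in> W" for i
  proof -
    have "(x i)\<^sup>2 \<le> p" unfolding p_def using W i by (intro member_le_sum) auto
    moreover have "(x i)\<^sup>2 \<le> x i" using x1[OF i] x(1)[OF i] by (simp add: power2_eq_square mult_left_le)
    moreover have "6 * fG + 2 * M i \<le> 1 - 2 * x i + 2 * (x i)\<^sup>2 - p" using link[OF i] by simp
    ultimately have "6 * fG \<le> 1 - x i" using M0[of i] by linarith
    then show ?thesis using f6' by linarith
  qed
  have x_le: "x i \<le> 1 / \<tau> + 10 / \<tau>\<^sup>2" if i: "i \<in> W" for i
  proof -
    have "(x i)\<^sup>2 \<le> (3 / \<tau>)\<^sup>2" using x_le3[OF i] x(1)[OF i] by (intro power_mono) auto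
    then have "(x i)\<^sup>2 \<le> 9 * (1 / \<tau>\<^sup>2)" by (simp add: power_divide)
    moreover have "1 / (2 * \<tau>\<^sup>2) = (1 / \<tau>\<^sup>2) / 2" "10 / \<tau>\<^sup>2 = 10 * (1 / \<tau>\<^sup>2)" "0 \<le> 1 / \<tau>\<^sup>2" by auto
    ultimately show ?thesis using M_le[OF i] M0[of i] by linarith
  qed
  define \<xi> where "\<xi> = 1 / \<tau> + 10 / \<tau>\<^sup>2"
  define T where "T = real (card W)"
  \<comment> \<open>A link of weight about 1/2, built from products of at most
    \<open>\<xi>^2\<close>, needs about \<open>\<tau>^2 / 2\<close> edges.\<close>
  have deg: "(\<tau>\<^sup>2 - 23 * \<tau>) / 2 \<le> card {e \<in> G. i \<in> e}" if i: "i \<in> W" for i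
  proof -
    have "(\<Sum>e\<in>{e \<in> G. i \<in> e}. prod x (e - {i})) \<le> (\<Sum>e\<in>{e \<in> G. i \<in> e}. \<xi>\<^sup>2)"
    proof (rule sum_mono)
      fix e assume e: "e \<in> {e \<in> G. i \<in> e}"
      then have "e \<in> nsets W 3" using W by auto
      note e' = e3[OF this]
      have "prod x (e - {i}) \<le> (\<Prod>a\<in>e - {i}. \<xi>)"
        using e' x x_le by (intro prod_mono) (auto simp: \<xi>_def less_imp_le subset_iff)
      then show "prod x (e - {i}) \<le> \<xi>\<^sup>2" using e e' by simp
    qed
    then have "3 * fG \<le> card {e \<in> G. i \<in> e} * \<xi>\<^sup>2" using kkt[OF i] by (simp add: fG_def)
    then have "1 - 3 / \<tau> \<le> 2 * (card {e \<in> G. i \<in> e} * \<xi>\<^sup>2)" using f6' by linarith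
    then have "(1 - 3 / \<tau>) / 2 \<le> card {e \<in> G. i \<in> e} * \<xi>\<^sup>2" by simp
    then have "(\<tau> * (1 - 10 / \<tau>))\<^sup>2 * ((1 - 3 / \<tau>) / 2) \<le> (\<tau> * (1 - 10 / \<tau>))\<^sup>2 * (card {e \<in> G. i \<in> e} * \<xi>\<^sup>2)"
      by (intro mult_left_mono) auto
    also have "\<dots> = card {e \<in> G. i \<in> e} * (\<tau> * (1 - 10 / \<tau>) * \<xi>)\<^sup>2" by (simp add: power_mult_distrib)
    also have "\<tau> * (1 - 10 / \<tau>) * \<xi> = 1 - 100 / \<tau>\<^sup>2"
      using \<tau> by (simp add: \<xi>_def field_simps power2_eq_square)
    also have "card {e \<in> G. i \<in> e} * (1 - 100 / \<tau>\<^sup>2)\<^sup>2 \<le> real (card {e \<in> G. i \<in> e}) * 1"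
    proof -
      have "100 * 1 \<le> \<tau> * \<tau>" using \<tau> by (intro mult_mono) auto
      then have "100 / \<tau>\<^sup>2 \<le> 1" using \<tau> by (simp add: power2_eq_square)
      then show ?thesis by (intro mult_left_mono power_le_one) auto
    qed
    also have "(\<tau> * (1 - 10 / \<tau>))\<^sup>2 * ((1 - 3 / \<tau>) / 2) = (\<tau> - 10)\<^sup>2 * ((1 - 3 / \<tau>) / 2)"
    proof -
      have "\<tau> * (1 - 10 / \<tau>) = \<tau> - 10" using \<tau> by (simp add: field_simps)
      then show ?thesis by (simp only:)
    qed
    finally have "(\<tau> - 10)\<^sup>2 * ((1 - 3 / \<tau>) / 2) \<le> card {e \<in> G. i \<in> e}" by simp
    moreover have "(\<tau>\<^sup>2 - 23 * \<tau>) / 2 \<le> (\<tau> - 10)\<^sup>2 * ((1 - 3 / \<tau>) / 2)"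
    proof -
      have "(\<tau> - 10)\<^sup>2 * ((1 - 3 / \<tau>) / 2) = (\<tau>\<^sup>2 - 23 * \<tau> + 160 - 300 / \<tau>) / 2"
        using \<tau> by (simp add: field_simps power2_eq_square)
      moreover have "300 / \<tau> \<le> 160" using \<tau> by (simp add: field_simps)
      ultimately show ?thesis by simp
    qed
    ultimately show ?thesis by linarith
  qed
  \<comment> \<open>Double counting of incidences: the degrees add up to
    \<open>3 * card G\<close>.\<close>
  have T_le: "T \<le> \<tau> + 24"
  proof (rule ccontr)
    assume "\<not> T \<le> \<tau> + 24"
    have "T * ((\<tau>\<^sup>2 - 23 * \<tau>) / 2) \<le> (\<Sum>i\<in>W. real (card {e \<in> G. i \<in> e}))"
      unfolding T_def using deg by (intro sum_bounded_below)
    also have "\<dots> = (\<Sum>i\<in>W. \<Sum>e\<in>G. of_bool (i \<in> e))"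
      using finG by (simp add: of_bool_def sum.If_cases Int_def)
    also have "\<dots> = (\<Sum>e\<in>G. \<Sum>i\<in>W. of_bool (i \<in> e))" by (rule sum.swap)
    also have "\<dots> = (\<Sum>e\<in>G. 3)"
    proof (rule sum.cong)
      fix e assume "e \<in> G"
      then have "e \<in> nsets W 3" using W by auto
      then have "W \<inter> e = e" "card e = 3" using e3 by auto
      then show "(\<Sum>i\<in>W. of_bool (i \<in> e)) = (3::real)" using W by (simp add: of_bool_def sum.If_cases)
    qed simp
    also have "\<dots> \<le> (\<tau> ^ 3 - \<tau>) / 2" using G by (simp add: \<tau>_def)
    finally have "2 * (T * ((\<tau>\<^sup>2 - 23 * \<tau>) / 2)) \<le> \<tau> ^ 3 - \<tau>" by simp
    moreover have "2 * (T * ((\<tau>\<^sup>2 - 23 * \<tau>) / 2)) = T * (\<tau>\<^sup>2 - 23 * \<tau>)" by simp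
    moreover have "0 \<le> \<tau>\<^sup>2 - 23 * \<tau>" using \<tau> by (simp add: power2_eq_square)
    then have "(\<tau> + 24) * (\<tau>\<^sup>2 - 23 * \<tau>) \<le> T * (\<tau>\<^sup>2 - 23 * \<tau>)"
      using \<open>\<not> T \<le> \<tau> + 24\<close> by (intro mult_right_mono) auto
    moreover have "(\<tau> + 24) * (\<tau>\<^sup>2 - 23 * \<tau>) = \<tau> ^ 3 - \<tau> + (\<tau>\<^sup>2 - 551 * \<tau>)"
      by (simp add: algebra_simps power2_eq_square power3_eq_cube)
    moreover have "0 < \<tau>\<^sup>2 - 551 * \<tau>" using \<tau> by (simp add: power2_eq_square)
    ultimately show False by linarith
  qed
  \<comment> \<open>Of the 27, the surplus vertices give 24, the term
    \<open>T / (2 * \<tau>^2)\<close> gives 1, and \<open>p \<le> \<xi>\<close> gives 2.\<close>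
  have sumM: "(\<Sum>i\<in>W. M i) \<le> 27 / \<tau>"
  proof -
    have "(\<Sum>i\<in>W. M i) \<le> (\<Sum>i\<in>W. 1 / \<tau> - x i + (x i)\<^sup>2 + 1 / (2 * \<tau>\<^sup>2))" by (intro sum_mono M_le)
    also have "\<dots> = T / \<tau> - 1 + p + T / (2 * \<tau>\<^sup>2)"
      using x by (simp add: sum.distrib sum_subtractf T_def p_def)
    also have "p \<le> (\<Sum>a\<in>W. \<xi> * x a)"
      unfolding p_def power2_eq_square using x x_le
      by (intro sum_mono mult_right_mono) (auto simp: \<xi>_def less_imp_le)
    also have "(\<Sum>a\<in>W. \<xi> * x a) = \<xi>" using x by (simp flip: sum_distrib_left)
    finally have "(\<Sum>i\<in>W. M i) \<le> T / \<tau> - 1 + \<xi> + T / (2 * \<tau>\<^sup>2)" by simp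
    moreover have "T / \<tau> \<le> (\<tau> + 24) / \<tau>" using T_le \<tau> by (intro divide_right_mono) auto
    moreover have "T / (2 * \<tau>\<^sup>2) \<le> (2 * \<tau>) / (2 * \<tau>\<^sup>2)" using T_le \<tau> by (intro divide_right_mono) auto
    moreover have "(\<tau> + 24) / \<tau> = 1 + 24 / \<tau>" "(2 * \<tau>) / (2 * \<tau>\<^sup>2) = 1 / \<tau>"
      using \<tau> by (auto simp: field_simps power2_eq_square)
    moreover have "10 / \<tau>\<^sup>2 \<le> 1 / \<tau>" using \<tau> by (simp add: field_simps power2_eq_square)
    moreover have "24 / \<tau> = 24 * (1 / \<tau>)" "27 / \<tau> = 27 * (1 / \<tau>)" by auto
    ultimately show ?thesis unfolding \<xi>_def by linarith
  qed
  \<comment> \<open>Light vertices fall short of \<open>\<xi>\<close> by at least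
    \<open>1 / (2 * \<tau>)\<close> each, while the total shortfall is at most
    \<open>35 / \<tau>\<close>; hence there are at most 70.\<close>
  define C where "C = {i \<in> W. x i < 1 / (2 * \<tau>)}"
  have finC: "finite C" using W by (simp add: C_def)
  have cardC: "real (card C) \<le> 70"
  proof -
    have "real (card C) * (1 / (2 * \<tau>)) \<le> (\<Sum>i\<in>C. \<xi> - x i)"
    proof (rule sum_bounded_below)
      fix i assume "i \<in> C"
      then have "x i \<le> 1 / (2 * \<tau>)" by (simp add: C_def)
      then have "1 / (2 * \<tau>) + x i \<le> 1 / (2 * \<tau>) + 1 / (2 * \<tau>)" by simp
      also have "\<dots> = 1 / \<tau>" using \<tau> by (simp add: field_simps)
      also have "\<dots> \<le> \<xi>" by (simp add: \<xi>_def)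
      finally show "1 / (2 * \<tau>) \<le> \<xi> - x i" by simp
    qed
    also have "\<dots> \<le> (\<Sum>i\<in>W. \<xi> - x i)"
      using W x_le by (intro sum_mono2) (auto simp: C_def \<xi>_def)
    also have "\<dots> = T * \<xi> - 1" using x by (simp add: sum_subtractf T_def)
    also have "\<dots> \<le> (\<tau> + 24) * \<xi> - 1"
      using T_le \<tau> by (simp add: \<xi>_def mult_right_mono)
    also have "\<dots> = 34 / \<tau> + 240 / \<tau>\<^sup>2" using \<tau> by (simp add: \<xi>_def field_simps power2_eq_square)
    also have "\<dots> \<le> 35 / \<tau>" using \<tau> by (simp add: field_simps power2_eq_square)
    finally show ?thesis using \<tau> by (simp add: field_simps)
  qed
  define N where "N = nsets W 3 - G"
  \<comment> \<open>A missing triple with at most one light vertex contains two heavy ones and so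
    contributes at least \<open>1 / (4 * \<tau>^2)\<close> to the sum of \<open>M\<close>. Triples
    with two light vertices are counted directly.\<close>
  define N1 where "N1 = {e \<in> N. card (e \<inter> C) \<le> 1}"
  define N2 where "N2 = {e \<in> N. \<not> card (e \<inter> C) \<le> 1}"
  have finNN: "finite N" "finite N1" "finite N2" using finN by (auto simp: N_def N1_def N2_def)
  have cardN1: "real (card N1) \<le> 108 * \<tau>"
  proof -
    have "real (card N1) * (1 / (2 * \<tau>))\<^sup>2 \<le> (\<Sum>e\<in>N1. \<Sum>i\<in>e. prod x (e - {i}))"
    proof (rule sum_bounded_below)
      fix e assume e: "e \<in> N1"
      then have eW: "e \<in> nsets W 3" and eC: "card (e \<inter> C) \<le> 1" by (auto simp: N1_def N_def)
      note e' = e3[OF eW]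
      have "\<exists>i\<in>e. e \<inter> C \<subseteq> {i}"
      proof (cases "e \<inter> C = {}")
        case True
        then show ?thesis using e' by (metis card.empty empty_subsetI ex_in_conv zero_neq_numeral)
      next
        case False
        then have "card (e \<inter> C) = 1" using eC e' card_gt_0_iff[of "e \<inter> C"] by auto
        then show ?thesis by (metis Int_iff card_1_singletonE insertI1 order_refl)
      qed
      then obtain i where i: "i \<in> e" "e \<inter> C \<subseteq> {i}" by blast
      have "(\<Prod>a\<in>e - {i}. 1 / (2 * \<tau>)) \<le> prod x (e - {i})"
        using i e' \<tau> by (intro prod_mono) (auto simp: C_def subset_iff not_less)
      then have "(1 / (2 * \<tau>))\<^sup>2 \<le> prod x (e - {i})" using i e' by simp
      also have "\<dots> \<le> (\<Sum>i\<in>e. prod x (e - {i}))"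
      proof (rule member_le_sum)
        show "0 \<le> prod x (e - {j})" for j using e' by (intro prod0) auto
      qed (use i e' in auto)
      finally show "(1 / (2 * \<tau>))\<^sup>2 \<le> (\<Sum>i\<in>e. prod x (e - {i}))" .
    qed
    also have "\<dots> \<le> (\<Sum>e\<in>N. \<Sum>i\<in>e. prod x (e - {i}))"
    proof (rule sum_mono2)
      fix e assume "e \<in> N - N1"
      then have "e \<subseteq> W" by (auto simp: N_def nsets_def)
      then show "0 \<le> (\<Sum>i\<in>e. prod x (e - {i}))" by (intro sum_nonneg prod0) auto
    qed (use finNN in \<open>auto simp: N1_def\<close>)
    also have "\<dots> = (\<Sum>e\<in>N. \<Sum>i\<in>W. if i \<in> e then prod x (e - {i}) else 0)"
    proof (rule sum.cong)
      fix e assume "e \<in> N"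
      then have "e \<subseteq> W" by (auto simp: N_def nsets_def)
      then show "(\<Sum>i\<in>e. prod x (e - {i})) = (\<Sum>i\<in>W. if i \<in> e then prod x (e - {i}) else 0)"
        using W by (intro sum.mono_neutral_cong_left) auto
    qed simp
    also have "\<dots> = (\<Sum>i\<in>W. \<Sum>e\<in>N. if i \<in> e then prod x (e - {i}) else 0)" by (rule sum.swap)
    also have "\<dots> = (\<Sum>i\<in>W. M i)"
      using finNN by (intro sum.cong) (auto simp: M_def N_def sum.inter_filter[symmetric])
    finally have "real (card N1) * (1 / (2 * \<tau>))\<^sup>2 \<le> 27 / \<tau>" using sumM by linarith
    then show ?thesis using \<tau> by (simp add: field_simps power2_eq_square)
  qed
  have cardN2: "real (card N2) \<le> 4900 * (\<tau> + 24)"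
  proof -
    have "N2 \<subseteq> (\<lambda>(a, b, c). {a, b, c}) ` (C \<times> C \<times> W)"
    proof
      fix e assume e: "e \<in> N2"
      then have eW: "e \<in> nsets W 3" and "2 \<le> card (e \<inter> C)" by (auto simp: N2_def N_def)
      note e' = e3[OF eW]
      obtain P where P: "P \<subseteq> e \<inter> C" "card P = 2" using \<open>2 \<le> card (e \<inter> C)\<close> obtain_subset_with_card_n by metis
      then obtain a b where ab: "P = {a, b}" "a \<noteq> b" by (auto simp: card_2_iff)
      have "card (e - P) = 1" using P e' by (subst card_Diff_subset) (auto intro: finite_subset)
      then obtain c where "e - P = {c}" by (auto simp: card_1_singleton_iff)
      then have "e = {a, b, c}" "a \<in> C" "b \<in> C" "c \<in> W" using P ab e' by auto
      then show "e \<in> (\<lambda>(a, b, c). {a, b, c}) ` (C \<times> C \<times> W)" by force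
    qed
    then have "card N2 \<le> card ((\<lambda>(a, b, c). {a, b, c}) ` (C \<times> C \<times> W))"
      using finC W by (intro card_mono) auto
    also have "\<dots> \<le> card (C \<times> C \<times> W)" using finC W by (intro card_image_le) auto
    also have "\<dots> = card C * (card C * card W)" by (simp add: card_cartesian_product)
    finally have "real (card N2) \<le> real (card C) * (real (card C) * T)"
      unfolding T_def by (metis of_nat_le_iff of_nat_mult)
    also have "\<dots> \<le> 70 * (70 * (\<tau> + 24))"
      using cardC T_le by (intro mult_mono) (auto simp: T_def)
    finally show ?thesis by simp
  qed
  have "N = N1 \<union> N2" by (auto simp: N1_def N2_def)
  then have "card N \<le> card N1 + card N2" using card_Un_le by metis
  then have cardN: "real (card N) \<le> 108 * \<tau> + 4900 * (\<tau> + 24)" using cardN1 cardN2 by linarith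
  have "card N = card (nsets W 3) - card G" unfolding N_def using W finG by (intro card_Diff_subset)
  moreover have "card G \<le> card (nsets W 3)" using W finN by (intro card_mono)
  ultimately have "real (card N) = real (card W choose 3) - card G" by (simp add: of_nat_diff)
  moreover have "(t + 2) choose 3 \<le> card W choose 3" using many by (intro binomial_right_mono) simp
  ultimately have "6 * real (card N) \<ge> 6 * real ((t + 2) choose 3) - (\<tau> ^ 3 - \<tau>)"
    using G by (simp add: \<tau>_def)
  also have "6 * real ((t + 2) choose 3) = (\<tau> + 2) * (\<tau> + 1) * \<tau>"
    by (subst real_choose_3) (simp add: \<tau>_def algebra_simps)
  also have "(\<tau> + 2) * (\<tau> + 1) * \<tau> - (\<tau> ^ 3 - \<tau>) = 3 * \<tau>\<^sup>2 + 3 * \<tau>"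
    by (simp add: algebra_simps power2_eq_square power3_eq_cube)
  also have "6 * real (card N) \<le> 6 * (108 * \<tau> + 4900 * (\<tau> + 24))" using cardN by (intro mult_left_mono) auto
  finally have "3 * \<tau>\<^sup>2 + 3 * \<tau> \<le> 6 * (108 * \<tau> + 4900 * (\<tau> + 24))" .
  moreover have "100000 * \<tau> \<le> \<tau>\<^sup>2" using \<tau> by (simp add: power2_eq_square)
  ultimately show False using \<tau> by simp
qed

section \<open>The theorem\<close>

text \<open>Stationarity without derivatives: taking \<open>u\<close> from \<open>x i\<close> and
  rescaling turns \<open>f\<close> into \<open>(f - u * l) / (1 - u)^3\<close>, by homogeneity of
  degree 3. If \<open>l < 3 * f\<close>, this would exceed \<open>f\<close> for small
  \<open>u\<close>.\<close>

lemma link_weight_of_max: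
  fixes x :: "'a \<Rightarrow> real"
  assumes W: "finite W" "G \<subseteq> nsets W 3" and x: "\<And>a. a \<in> W \<Longrightarrow> 0 \<le> x a" "sum x W = 1"
    and max: "\<And>y. (\<And>a. a \<in> W \<Longrightarrow> 0 \<le> y a) \<Longrightarrow> sum y W = 1 \<Longrightarrow> (\<Sum>e\<in>G. prod y e) \<le> (\<Sum>e\<in>G. prod x e)"
    and i: "i \<in> W" "0 < x i" and pos: "0 < (\<Sum>e\<in>G. prod x e)"
  shows "3 * (\<Sum>e\<in>G. prod x e) \<le> (\<Sum>e\<in>{e \<in> G. i \<in> e}. prod x (e - {i}))" (is "3 * ?f \<le> ?l")
proof (rule ccontr)
  assume less: "\<not> 3 * ?f \<le> ?l"
  have finG: "finite G" using W by (meson finite_imp_finite_nsets finite_subset)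
  have e3: "finite e" "card e = 3" "e \<subseteq> W" if "e \<in> G" for e using that W by (auto simp: nsets_def)
  have l0: "0 \<le> ?l" using x e3 by (intro sum_nonneg prod_nonneg) (auto simp: subset_iff)
  \<comment> \<open>Bounded by \<open>x i\<close> to keep weights nonnegative; the other bound makes
    the second-order loss \<open>3 * ?f * u\<close> at most half of the gap
    \<open>3 * ?f - ?l\<close>.\<close>
  define u where "u = min (x i) ((3 * ?f - ?l) / (6 * ?f))"
  have "(3 * ?f - ?l) / (6 * ?f) \<le> 1/2" using pos l0 by (simp add: field_simps)
  then have "u \<le> 1/2" unfolding u_def by (rule min.coboundedI2)
  moreover have "0 < u" "u \<le> x i" using i less pos by (auto simp: u_def)
  ultimately have u: "0 < u" "u \<le> x i" "u \<le> 1/2" by auto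
  have "u \<le> (3 * ?f - ?l) / (6 * ?f)" by (simp add: u_def)
  then have u': "6 * ?f * u \<le> 3 * ?f - ?l" using pos by (simp add: field_simps)
  define y where "y = (\<lambda>a. (x a - (if a = i then u else 0)) / (1 - u))"
  have "sum y W = (\<Sum>a\<in>W. x a - (if a = i then u else 0)) / (1 - u)"
    by (simp add: y_def sum_divide_distrib)
  also have "\<dots> = 1" using x i W u by (simp add: sum_subtractf)
  finally have "sum y W = 1" .
  moreover have "0 \<le> y a" if "a \<in> W" for a using x(1)[OF that] u by (auto simp: y_def)
  ultimately have le: "(\<Sum>e\<in>G. prod y e) \<le> ?f" by (intro max) auto
  have "prod y e = (prod x e - (if i \<in> e then u * prod x (e - {i}) else 0)) / (1 - u) ^ 3" if e: "e \<in> G" for e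
  proof -
    have "prod y e = (\<Prod>a\<in>e. x a - (if a = i then u else 0)) / (1 - u) ^ 3"
      using e3[OF e] by (simp add: y_def prod_dividef)
    also have "(\<Prod>a\<in>e. x a - (if a = i then u else 0)) = prod x e - (if i \<in> e then u * prod x (e - {i}) else 0)"
    proof (cases "i \<in> e")
      case True
      have "(\<Prod>a\<in>e. x a - (if a = i then u else 0)) = (x i - u) * (\<Prod>a\<in>e - {i}. x a - (if a = i then u else 0))"
        using e3[OF e] True by (simp add: prod.remove)
      also have "(\<Prod>a\<in>e - {i}. x a - (if a = i then u else 0)) = prod x (e - {i})"
        by (intro prod.cong) auto
      finally show ?thesis using True e3[OF e] by (simp add: prod.remove algebra_simps)
    next
      case False
      then have "(\<Prod>a\<in>e. x a - (if a = i then u else 0)) = prod x e" by (intro prod.cong) auto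
      then show ?thesis using False by simp
    qed
    finally show ?thesis .
  qed
  then have "(\<Sum>e\<in>G. prod y e) = (\<Sum>e\<in>G. prod x e - (if i \<in> e then u * prod x (e - {i}) else 0)) / (1 - u) ^ 3"
    by (simp add: sum_divide_distrib)
  also have "(\<Sum>e\<in>G. prod x e - (if i \<in> e then u * prod x (e - {i}) else 0)) = ?f - u * ?l"
  proof -
    have "(\<Sum>e\<in>G. if i \<in> e then u * prod x (e - {i}) else 0) = u * ?l"
      unfolding sum_distrib_left by (rule sum.inter_filter[OF finG, symmetric])
    then show ?thesis by (simp add: sum_subtractf)
  qed
  finally have "?f - u * ?l = (\<Sum>e\<in>G. prod y e) * (1 - u) ^ 3" using u by simp
  also have "\<dots> \<le> ?f * (1 - u) ^ 3" using le u by (intro mult_right_mono) auto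
  finally have "?f - u * ?l \<le> ?f * (1 - u) ^ 3" .
  moreover have "?f * (1 - u) ^ 3 = ?f - 3 * ?f * u + 3 * ?f * u * u - ?f * u ^ 3"
    by (simp add: algebra_simps power3_eq_cube)
  moreover have "0 < ?f * u ^ 3" using pos u by simp
  ultimately have "u * ?l > u * (3 * ?f - 3 * ?f * u)" by (simp add: algebra_simps)
  then have "?l > 3 * ?f - 3 * ?f * u" using u by simp
  moreover have "0 < ?f * u" using pos u by simp
  ultimately show False using u' by simp
qed

text \<open>An optimal weighting puts no weight outside the edges: rescaling the part on
  \<open>W\<close>, of total \<open>S\<close>, multiplies the value by \<open>1 / S^3\<close>, which
  forces \<open>S = 1\<close>.\<close>

lemma optimal_finite_support:
  assumes G: "rgraph 3 G" and pos: "0 < lagrangian G"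
  obtains W x where "finite W" "W \<subseteq> {1..}" "\<And>a. a \<in> W \<Longrightarrow> 0 < x a" "sum x W = 1"
    "lagrangian G = (\<Sum>e\<in>G \<inter> nsets W 3. prod x e)"
    "\<And>y. (\<And>a. a \<in> W \<Longrightarrow> 0 \<le> y a) \<Longrightarrow> sum y W = 1 \<Longrightarrow> (\<Sum>e\<in>G \<inter> nsets W 3. prod y e) \<le> lagrangian G"
proof -
  obtain w where w: "weighting w" "lagrangian G = edge_weight G w"
    and wmax: "\<And>w'. weighting w' \<Longrightarrow> edge_weight G w' \<le> lagrangian G"
    using lagrangian_attained[OF G] by metis
  have finG: "finite G" and G3: "G \<subseteq> nsets {1..} 3" using G by (auto simp: rgraph_def)
  have w0: "0 \<le> w a" if "a \<in> {1..}" for a using w that by (simp add: weighting_def)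
  define W where "W = {a \<in> \<Union>G. 0 < w a}"
  have "finite (\<Union>G)" using finG G3 by (auto simp: nsets_def)
  then have W: "finite W" "W \<subseteq> {1..}" using G3 by (auto simp: W_def nsets_def elim: finite_subset[rotated])
  define f where "f = (\<Sum>e\<in>G \<inter> nsets W 3. prod w e)"
  have f: "lagrangian G = f"
    unfolding w(2) edge_weight_def f_def
  proof (rule sum.mono_neutral_right)
    show "\<forall>e\<in>G - G \<inter> nsets W 3. prod w e = 0"
    proof
      fix e assume e: "e \<in> G - G \<inter> nsets W 3"
      then have e3: "finite e" "card e = 3" "e \<subseteq> {1..}" using G3 by (auto simp: nsets_def)
      then have "\<not> e \<subseteq> W" using e by (auto simp: nsets_def)
      then obtain a where a: "a \<in> e" "a \<notin> W" by blast
      then have "w a = 0" using e e3 w0[of a] by (force simp: W_def)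
      then show "prod w e = 0" using a e3 by auto
    qed
  qed (use finG in auto)
  have sub: "(\<Sum>e\<in>G \<inter> nsets W 3. prod y e) \<le> lagrangian G"
    if y: "\<And>a. a \<in> W \<Longrightarrow> 0 \<le> y a" "sum y W = 1" for y
  proof -
    let ?y = "\<lambda>a. if a \<in> W then y a else 0"
    have "(\<Sum>e\<in>G \<inter> nsets W 3. prod y e) = (\<Sum>e\<in>G \<inter> nsets W 3. prod ?y e)"
      by (intro sum.cong prod.cong) (auto simp: nsets_def)
    also have "\<dots> \<le> edge_weight G ?y"
      unfolding edge_weight_def using finG y by (intro sum_mono2 prod_nonneg) auto
    also have "\<dots> \<le> lagrangian G" using weighting_of_finite[OF W y] wmax by blast
    finally show ?thesis .
  qed
  define S where "S = sum w W"
  have wp: "0 < w a" if "a \<in> W" for a using that by (simp add: W_def)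
  have "W \<noteq> {}"
  proof
    assume "W = {}"
    then have "nsets W 3 = {}" by (auto simp: nsets_def)
    then show False using pos f by (simp add: f_def)
  qed
  then have S0: "0 < S" unfolding S_def using W wp by (intro sum_pos) auto
  have S1: "S \<le> 1"
  proof (rule has_sum_mono_neutral)
    show "(w has_sum S) W" using W by (simp add: S_def has_sum_finite)
    show "(w has_sum 1) {1..}" using w by (simp add: weighting_def)
  qed (use w0 W in auto)
  have "(\<Sum>e\<in>G \<inter> nsets W 3. prod (\<lambda>a. w a / S) e) \<le> lagrangian G"
    using wp S0 by (intro sub) (auto simp: less_imp_le S_def simp flip: sum_divide_distrib)
  also have "(\<Sum>e\<in>G \<inter> nsets W 3. prod (\<lambda>a. w a / S) e) = (\<Sum>e\<in>G \<inter> nsets W 3. prod w e / S ^ 3)"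
    by (intro sum.cong) (auto simp: nsets_def prod_dividef)
  finally have "f / S ^ 3 \<le> f" using f by (simp add: f_def sum_divide_distrib)
  then have "f \<le> f * S ^ 3" using S0 by (simp add: field_simps)
  then have "1 \<le> S ^ 3" using pos f by simp
  then have "S = 1" using S0 S1 power_less_one_iff[of S 3] by (cases "S = 1") auto
  then show thesis using that[of W w] W wp f sub by (simp add: S_def f_def)
qed

section \<open>Embedding cliques and complements of stars into colex segments\<close>

text \<open>The labels are arranged so that the star corresponds to the last \<open>card L\<close>
  triples of \<open>{1..n}\<close> in colexicographic order.\<close>

lemma star_bijection:
  assumes U: "finite U" "card U = n" and zv: "z \<in> U" "v \<in> U" "z \<noteq> v" and L: "L \<subseteq> U - {z, v}"
    and n: "2 \<le> n"
  obtains \<phi> where "bij_betw \<phi> {1..n} U" "\<phi> n = z" "\<phi> (n - 1) = v"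
    "\<phi> ` {n - 2 - card L <.. n - 2} = L"
proof -
  let ?s = "card L"
  have finL: "finite L" using L U finite_subset by auto
  have cUzv: "card (U - {z, v}) = n - 2" using U zv by (simp add: card_Diff_subset)
  then have s: "?s \<le> n - 2" using L U card_mono[of "U - {z, v}" L] by simp
  have "card (U - {z, v} - L) = n - 2 - ?s" using cUzv L finL by (simp add: card_Diff_subset)
  then obtain \<alpha> where \<alpha>: "bij_betw \<alpha> {1..n - 2 - ?s} (U - {z, v} - L)"
    using finite_same_card_bij[of "{1..n - 2 - ?s}" "U - {z, v} - L"] U by auto
  have "card {n - 2 - ?s <.. n - 2} = ?s" using s by simp
  then obtain \<beta> where \<beta>: "bij_betw \<beta> {n - 2 - ?s <.. n - 2} L"
    using finite_same_card_bij[of "{n - 2 - ?s <.. n - 2}" L] finL by auto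
  define \<phi> where "\<phi> = (\<lambda>i. if i = n then z else if i = n - 1 then v else if n - 2 - ?s < i then \<beta> i else \<alpha> i)"
  have "bij_betw \<phi> {1..n - 2 - ?s} (U - {z, v} - L)"
    using \<alpha> n by (subst bij_betw_cong[of _ _ \<alpha>]) (auto simp: \<phi>_def)
  moreover have b2: "bij_betw \<phi> {n - 2 - ?s <.. n - 2} L"
    using \<beta> n by (subst bij_betw_cong[of _ _ \<beta>]) (auto simp: \<phi>_def)
  ultimately have "bij_betw \<phi> ({1..n - 2 - ?s} \<union> {n - 2 - ?s <.. n - 2}) (U - {z, v} - L \<union> L)"
    by (rule bij_betw_combine) auto
  moreover have "bij_betw \<phi> {n - 1, n} {v, z}"
    using zv n by (auto simp: bij_betw_def \<phi>_def)
  ultimately have "bij_betw \<phi> ({1..n - 2 - ?s} \<union> {n - 2 - ?s <.. n - 2} \<union> {n - 1, n}) (U - {z, v} - L \<union> L \<union> {v, z})"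
    by (rule bij_betw_combine) (use L in auto)
  moreover have "{1..n - 2 - ?s} \<union> {n - 2 - ?s <.. n - 2} \<union> {n - 1, n} = {1..n}" using n by auto
  moreover have "U - {z, v} - L \<union> L \<union> {v, z} = U" using L zv by auto
  ultimately have "bij_betw \<phi> {1..n} U" by simp
  moreover have "\<phi> n = z" "\<phi> (n - 1) = v" using n by (auto simp: \<phi>_def)
  moreover have "\<phi> ` {n - 2 - ?s <.. n - 2} = L" using b2 by (simp add: bij_betw_def)
  ultimately show thesis by (rule that)
qed

text \<open>If \<open>{z, v}\<close> is uncovered, the total is affine along the exchange of weight between
  \<open>z\<close> and \<open>v\<close>; by symmetry of the two links it is even constant.\<close>
lemma sum_uncovered_pair:
  fixes x :: "'a \<Rightarrow> real"
  assumes U: "finite U" and zv: "z \<in> U" "v \<in> U" "z \<noteq> v" and x: "sum x U = 1"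
  shows "1/6 - cost U (pair_star z v (U - {z, v})) x
    = (\<Sum>e\<in>nsets (U - {z}) 3. prod (x(v := x z + x v)) e)"
proof -
  let ?R = "U - {z, v}" and ?y = "x(v := x z + x v)"
  have sum_U: "sum g U = g z + g v + sum g ?R" for g :: "'a \<Rightarrow> real"
    using U zv sum.remove[of U z g] sum.remove[of "U - {z}" v g]
    by (simp add: Diff_insert2[symmetric] insert_commute)
  have sum_Uz: "sum g (U - {z}) = g v + sum g ?R" for g :: "'a \<Rightarrow> real"
    using U zv sum.remove[of "U - {z}" v g] by (simp add: Diff_insert2[symmetric] insert_commute)
  have R: "(\<Sum>a\<in>?R. h (?y a)) = (\<Sum>a\<in>?R. h (x a))" for h :: "real \<Rightarrow> real"
    by (intro sum.cong) auto
  have sR: "sum x ?R = 1 - x z - x v" using sum_U[of x] x by simp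
  have "sum ?y (U - {z}) = 1" using sum_Uz[of ?y] R[of "\<lambda>t. t"] sR by simp
  then have "(\<Sum>e\<in>nsets (U - {z}) 3. prod ?y e)
    = (1 - 3 * ((x z + x v)\<^sup>2 + (\<Sum>a\<in>?R. (x a)\<^sup>2)) + 2 * ((x z + x v) ^ 3 + (\<Sum>a\<in>?R. (x a) ^ 3))) / 6"
    using U sum_Uz[of "\<lambda>a. (?y a)\<^sup>2"] sum_Uz[of "\<lambda>a. (?y a) ^ 3"] R[of "\<lambda>t. t\<^sup>2"] R[of "\<lambda>t. t ^ 3"]
    by (simp add: sum_nsets_3)
  moreover have "cost U (pair_star z v ?R) x
    = pot (x z) + pot (x v) + ((\<Sum>a\<in>?R. (x a)\<^sup>2) / 2 - (\<Sum>a\<in>?R. (x a) ^ 3) / 3) + x z * x v * (1 - x z - x v)"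
    unfolding cost_def using sum_U[of "\<lambda>a. pot (x a)"] zv sum_pair_star[of z v ?R x] sR
    by (simp add: pot_def sum_subtractf sum_divide_distrib)
  ultimately show ?thesis
    by (simp add: pot_def field_simps power2_eq_square power3_eq_cube)
qed

lemma lagrangian_colex_ge_nsets:
  fixes x :: "nat \<Rightarrow> real"
  assumes "finite U" "card U choose 3 \<le> m" "\<And>a. a \<in> U \<Longrightarrow> 0 \<le> x a" "sum x U = 1"
  shows "(\<Sum>e\<in>nsets U 3. prod x e) \<le> lagrangian (colex_initial m 3)"
proof -
  obtain \<phi> where \<phi>: "bij_betw \<phi> {1..card U} U"
    using finite_same_card_bij[of "{1..card U}" U] assms by auto
  have "(`) \<phi> ` nsets {1..card U} 3 = nsets U 3"
    using bij_betw_nsets[OF \<phi>, of 3] by (simp add: bij_betw_def)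
  moreover have "nsets {1..card U} 3 \<subseteq> Pow {1..card U}" by (auto simp: nsets_def)
  ultimately show ?thesis
    using lagrangian_ge_transport[OF rgraph_colex_initial[of 3] \<phi> _ _ assms(3,4), of "nsets {1..card U} 3" m]
      nsets_subset_colex_initial[OF assms(2)] by auto
qed

lemma lagrangian_colex_ge_star:
  fixes x :: "nat \<Rightarrow> real"
  assumes U: "finite U" "3 \<le> card U" and zv: "z \<in> U" "v \<in> U" "z \<noteq> v" and L: "L \<subseteq> U - {z, v}"
    and m: "m + card L = card U choose 3" and x: "\<And>a. a \<in> U \<Longrightarrow> 0 \<le> x a" "sum x U = 1"
  shows "1/6 - cost U (pair_star z v L) x \<le> lagrangian (colex_initial m 3)"
proof -
  define n where "n = card U"
  let ?I = "{n - 2 - card L <.. n - 2}"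
  have n: "3 \<le> n" using U by (simp add: n_def)
  have "card L \<le> card (U - {z, v})" using U L by (intro card_mono) auto
  then have s: "card L \<le> n - 2" using U zv by (simp add: card_Diff_subset n_def)
  obtain \<phi> where \<phi>: "bij_betw \<phi> {1..n} U" "\<phi> n = z" "\<phi> (n - 1) = v" "\<phi> ` ?I = L"
    using star_bijection[OF U(1) n_def[symmetric] zv L] n by auto
  have star_sub: "pair_star z v L \<subseteq> nsets U 3"
    using zv L by (auto simp: pair_star_def nsets_def card_insert_if)
  have inj: "inj_on ((`) \<phi>) (Pow {1..n})"
    using \<phi>(1) by (intro inj_on_image_Pow) (simp add: bij_betw_def)
  have sI: "pair_star n (n - 1) ?I \<subseteq> Pow {1..n}" using n by (auto simp: pair_star_def)
  have "(`) \<phi> ` (nsets {1..n} 3 - pair_star n (n - 1) ?I)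
      = (`) \<phi> ` nsets {1..n} 3 - (`) \<phi> ` pair_star n (n - 1) ?I"
    by (rule inj_on_image_set_diff[OF inj]) (use sI in \<open>auto simp: nsets_def\<close>)
  also have "(`) \<phi> ` nsets {1..n} 3 = nsets U 3"
    using bij_betw_nsets[OF \<phi>(1), of 3] by (simp add: bij_betw_def)
  also have "(`) \<phi> ` pair_star n (n - 1) ?I = (\<lambda>i. {z, v, \<phi> i}) ` ?I"
    using \<phi>(2,3) by (simp add: pair_star_def image_image)
  also have "\<dots> = (\<lambda>b. {z, v, b}) ` \<phi> ` ?I" by (simp only: image_image)
  also have "\<dots> = pair_star z v L" by (simp only: \<phi>(4) pair_star_def)
  finally have img: "(`) \<phi> ` (nsets {1..n} 3 - pair_star n (n - 1) ?I) = nsets U 3 - pair_star z v L" .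
  have "nsets {1..n} 3 - pair_star n (n - 1) ?I \<subseteq> colex_initial m 3"
    using nsets_minus_star_subset_colex_initial[OF n s] m by (simp add: n_def)
  moreover have "nsets {1..n} 3 - pair_star n (n - 1) ?I \<subseteq> Pow {1..n}" by (auto simp: nsets_def)
  ultimately have "(\<Sum>e\<in>nsets U 3 - pair_star z v L. prod x e) \<le> lagrangian (colex_initial m 3)"
    using lagrangian_ge_transport[OF rgraph_colex_initial[of 3] \<phi>(1) _ _ x, of "nsets {1..n} 3 - pair_star n (n - 1) ?I" m]
    unfolding img by auto
  moreover have "(\<Sum>e\<in>nsets U 3 - pair_star z v L. prod x e) = 1/6 - cost U (nsets U 3 - (nsets U 3 - pair_star z v L)) x"
    using U x by (intro sum_prod_eq_cost) auto
  moreover have "nsets U 3 - (nsets U 3 - pair_star z v L) = pair_star z v L" using star_sub by auto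
  ultimately show ?thesis by simp
qed

lemma obtain_choose_3_bracket:
  assumes "N choose 3 < m"
  obtains t where "N \<le> t" "t choose 3 < m" "m \<le> (t + 1) choose 3"
proof -
  have ex: "m \<le> (m + 2) choose 3"
  proof (induction m)
    case (Suc k)
    have e: "Suc k + 2 = Suc (k + 2)" "(3::nat) = Suc 2" by simp_all
    have "(Suc k + 2) choose 3 = ((k + 2) choose 2) + ((k + 2) choose 3)"
      unfolding e by (rule binomial_Suc_Suc)
    moreover have "0 < (k + 2) choose 2" by (simp add: zero_less_binomial)
    ultimately show ?case using Suc by linarith
  qed simp
  define n where "n = (LEAST n. m \<le> n choose 3)"
  have n: "m \<le> n choose 3" unfolding n_def using ex by (rule LeastI)
  have "n \<noteq> 0" using n assms by (intro notI) (simp add: binomial_eq_0)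
  then have "\<not> m \<le> (n - 1) choose 3" unfolding n_def by (intro not_less_Least) simp
  moreover have "N \<le> n - 1"
  proof (rule ccontr)
    assume "\<not> N \<le> n - 1"
    then have "n choose 3 \<le> N choose 3" by (intro binomial_right_mono) simp
    then show False using n assms by simp
  qed
  ultimately show thesis using that[of "n - 1"] n \<open>n \<noteq> 0\<close> by simp
qed

theorem theorem1p1:
  shows "\<exists>m\<^sub>0::nat. m\<^sub>0 \<ge> 1 \<and> (\<forall>m\<ge>m\<^sub>0. \<forall>G. rgraph 3 G \<and> card G = m \<longrightarrow>
           lagrangian G \<le> lagrangian (colex_initial m 3))"
proof -
  obtain N :: nat where N: "real N \<ge> 10^12" using real_arch_simple by blast
  have "lagrangian G \<le> lagrangian (colex_initial m 3)"
    if m: "N choose 3 < m" and G: "rgraph 3 G" "card G = m" for m G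
  proof -
    obtain t where t: "N \<le> t" "t choose 3 < m" "m \<le> (t + 1) choose 3"
      using obtain_choose_3_bracket[OF m] by blast
    have tbig: "real t \<ge> 10^12" using N t(1) by linarith
    then have t5: "100000 \<le> t" by simp
    \<comment> \<open>Uniform weights on \<open>t\<close> vertices, whose triples all lie in the
      segment because \<open>t choose 3 < m\<close>. If \<open>G\<close> does not exceed this value
      nothing is left to prove; otherwise its value meets the hypothesis of
      \<open>support_bound\<close>.\<close>
    have clique: "(1 - 1 / real t) * (1 - 2 / real t) \<le> 6 * lagrangian (colex_initial m 3)"
    proof -
      have "(\<Sum>e\<in>nsets {1..t} 3. prod (\<lambda>_. 1 / real t) e) \<le> lagrangian (colex_initial m 3)"
        using t t5 by (intro lagrangian_colex_ge_nsets) auto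
      also have "(\<Sum>e\<in>nsets {1..t} 3. prod (\<lambda>_. 1 / real t) e) = (\<Sum>e\<in>nsets {1..t} 3. (1 / real t) ^ 3)"
        by (intro sum.cong) (auto simp: nsets_def)
      finally have "6 * real (t choose 3) * (1 / real t) ^ 3 \<le> 6 * lagrangian (colex_initial m 3)" by simp
      moreover have "real t * (real t - 1) * (real t - 2) * (1 / real t) ^ 3 = (1 - 1 / real t) * (1 - 2 / real t)"
        using t5 by (simp add: field_simps power3_eq_cube)
      ultimately show ?thesis unfolding real_choose_3 by simp
    qed
    show ?thesis
    proof (cases "6 * lagrangian G \<le> (1 - 1 / real t) * (1 - 2 / real t)")
      case True
      then show ?thesis using clique by linarith
    next
      case False
      have "0 \<le> (1 - 1 / real t) * (1 - 2 / real t)" using t5 by simp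
      then have pos: "0 < lagrangian G" using False by linarith
      obtain W x where W: "finite W" "W \<subseteq> {1..}" and x: "\<And>a. a \<in> W \<Longrightarrow> 0 < x a" "sum x W = 1"
        and f: "lagrangian G = (\<Sum>e\<in>G \<inter> nsets W 3. prod x e)"
        and fmax: "\<And>y. (\<And>a. a \<in> W \<Longrightarrow> 0 \<le> y a) \<Longrightarrow> sum y W = 1 \<Longrightarrow> (\<Sum>e\<in>G \<inter> nsets W 3. prod y e) \<le> lagrangian G"
        using optimal_finite_support[OF G(1) pos] by metis
      let ?G = "G \<inter> nsets W 3"
      have cG: "card ?G \<le> m" using G by (auto simp: rgraph_def intro: card_mono)
      have cardW: "card W \<le> t + 1"
      proof (rule support_bound[of W ?G x])
        have "6 * real (card ?G) \<le> 6 * real ((t + 1) choose 3)" using cG t by simp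
        also have "\<dots> = real t ^ 3 - t"
          unfolding real_choose_3 by (simp add: algebra_simps power3_eq_cube)
        finally show "6 * real (card ?G) \<le> real t ^ 3 - t" .
        show "(1 - 1 / real t) * (1 - 2 / real t) \<le> 6 * (\<Sum>e\<in>?G. prod x e)" using False f by simp
        show "3 * (\<Sum>e\<in>?G. prod x e) \<le> (\<Sum>e\<in>{e \<in> ?G. i \<in> e}. prod x (e - {i}))" if "i \<in> W" for i
          using that W x f fmax pos by (intro link_weight_of_max[of W]) (auto simp: less_imp_le)
      qed (use W x t5 in auto)
      define n where "n = t + 1"
      \<comment> \<open>The support is padded with vertices of weight 0 to exactly
        \<open>n = t + 1\<close> vertices.\<close>
      have "infinite ({1..} - W)" using W infinite_Ici by (simp add: Diff_infinite_finite)
      then obtain T where T: "finite T" "card T = n - card W" "T \<subseteq> {1..} - W"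
        using infinite_arbitrarily_large by blast
      define U where "U = W \<union> T"
      have "card U = card W + card T" unfolding U_def using W T by (intro card_Un_disjoint) auto
      then have U: "finite U" "card U = n" using W T cardW by (auto simp: U_def n_def)
      define y where "y = (\<lambda>a. if a \<in> W then x a else 0)"
      have y: "0 \<le> y a" for a using x by (auto simp: y_def less_imp_le)
      have ysum: "sum y U = 1"
      proof -
        have "sum y U = sum x W"
          using U by (intro sum.mono_neutral_cong_right) (auto simp: U_def y_def)
        then show ?thesis using x by simp
      qed
      have GU: "?G \<subseteq> nsets U 3" by (auto simp: U_def nsets_def)
      have "lagrangian G = (\<Sum>e\<in>?G. prod y e)"
        unfolding f by (intro sum.cong prod.cong) (auto simp: y_def nsets_def)
      also have "\<dots> = 1/6 - cost U (nsets U 3 - ?G) y" using U GU ysum by (intro sum_prod_eq_cost)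
      finally have fcost: "lagrangian G = 1/6 - cost U (nsets U 3 - ?G) y" .
      \<comment> \<open>A pair star on \<open>n\<close> vertices has at most \<open>n - 2\<close>
        edges, hence the cap. Forgetting surplus non-edges only lowers the cost.\<close>
      define s where "s = min ((n choose 3) - m) (n - 2)"
      have "card (nsets U 3 - ?G) = (n choose 3) - card ?G"
        using U GU by (subst card_Diff_subset) (auto intro: finite_subset[OF _ finite_imp_finite_nsets])
      moreover have "s \<le> (n choose 3) - m" by (simp add: s_def)
      ultimately have "s \<le> card (nsets U 3 - ?G)" using cG by linarith
      then obtain H where H: "H \<subseteq> nsets U 3 - ?G" "card H = s"
        using obtain_subset_with_card_n by metis
      have "cost U H y \<le> cost U (nsets U 3 - ?G) y"
        unfolding cost_def using U y H
        by (intro add_left_mono sum_mono2 prod_nonneg) (auto intro: finite_imp_finite_nsets)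
      moreover have big: "real (card U) \<ge> 10^12" using U tbig by (simp add: n_def)
      have H3: "H \<subseteq> nsets U 3" "card H \<le> card U - 2" using H U by (auto simp: s_def)
      obtain z v L x' where star: "z \<in> U" "v \<in> U" "z \<noteq> v" "L \<subseteq> U - {z, v}" "card L = card H"
        "\<And>a. a \<in> U \<Longrightarrow> 0 \<le> x' a" "sum x' U = 1" "cost U (pair_star z v L) x' \<le> cost U H y"
        by (rule pair_star_optimal[OF U(1) big H3 y ysum]) (rule that)
      ultimately have le: "lagrangian G \<le> 1/6 - cost U (pair_star z v L) x'" using fcost by linarith
      show ?thesis
      proof (cases "(n choose 3) - m \<le> n - 2")
        case True
        then have "m + card L = card U choose 3" using star H U t by (simp add: s_def n_def)
        moreover have "3 \<le> card U" using U t5 by (simp add: n_def)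
        ultimately show ?thesis
          using lagrangian_colex_ge_star[OF U(1) _ star(1-4) _ star(6,7), of m] le by simp
      next
        case False
        then have "card L = n - 2" using star H by (simp add: s_def)
        moreover have "card (U - {z, v}) = n - 2" using U star by (simp add: card_Diff_subset)
        ultimately have "L = U - {z, v}" using star U by (intro card_subset_eq) auto
        \<comment> \<open>All triples through \<open>z\<close> and \<open>v\<close> are missing, so
          the weight of \<open>z\<close> can be moved to \<open>v\<close>; a complete 3-graph on
          \<open>t\<close> vertices remains.\<close>
        then have "lagrangian G \<le> (\<Sum>e\<in>nsets (U - {z}) 3. prod (x'(v := x' z + x' v)) e)"
          using le sum_uncovered_pair[OF U(1) star(1-3,7)] by simp
        also have "\<dots> \<le> lagrangian (colex_initial m 3)"
        proof (rule lagrangian_colex_ge_nsets)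
          show "card (U - {z}) choose 3 \<le> m" using U star t by (simp add: n_def)
          show "0 \<le> (x'(v := x' z + x' v)) a" if "a \<in> U - {z}" for a using that star by auto
          have "sum (x'(v := x' z + x' v)) (U - {z}) = x' z + x' v + sum x' (U - {z} - {v})"
            using U star by (subst sum.remove[of _ v]) (auto intro!: sum.cong)
          also have "\<dots> = sum x' U"
            using U star sum.remove[of U z x'] sum.remove[of "U - {z}" v x'] by simp
          finally show "sum (x'(v := x' z + x' v)) (U - {z}) = 1" using star by simp
        qed (use U in auto)
        finally show ?thesis .
      qed
    qed
  qed
  then show ?thesis by (intro exI[of _ "Suc (N choose 3)"]) auto
qed

end
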